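(* Let $r^*\colon\mathcal{E}_0^{\mathbf{O}}\to\mathcal{E}_0^{\mathbf{U}}$ be precomposition with realification and let $r_!\colon\mathcal{E}_0^{\mathbf{U}}\to\mathcal{E}_0^{\mathbf{O}}$ be its left adjoint. The adjoint pair $r_!\colon\mathcal{E}_0^{\mathbf{U}}\rightleftarrows\mathcal{E}_0^{\mathbf{O}}\colon r^*$ is a Quillen adjunction when both categories are equipped with their projective model structures.
   Context: Let $\mathbb{F}$ be $\mathbb{R}$ or $\mathbb{C}$. $\mathsf{Top}_*$ is the category of based compactly generated weak Hausdorff spaces. $\mathcal{J}$ is the category of finite-dimensional $\mathbb{F}$-inner product subspaces of $\mathbb{F}^\infty$ and $\mathbb{F}$-linear isometries (not necessarily surjective), with $\mathcal{J}(U,V)$ topologised as a Stiefel manifold; $\mathcal{J}_0$ has the same objects and $\mathcal{J}_0(U,V)=\mathcal{J}(U,V)_+$. $\mathcal{E}_0$ is the category of $\mathsf{Top}_*$-enriched functors $\mathcal{J}_0 \to \mathsf{Top}_*$. A superscript $\mathbf{O}$ denotes the case $\mathbb{F}=\mathbb{R}$, a superscript $\mathbf{U}$ the case $\mathbb{F}=\mathbb{C}$. Projective model structure on $\mathcal{E}_0$: weak equivalences are levelwise weak homotopy equivalences and fibrations are levelwise Serre fibrations. Realification $r\colon \mathcal{J}_0^{\mathbf{U}}\to\mathcal{J}_0^{\mathbf{O}}$ sends $W$ to the underlying real vector space $W_{\mathbb{R}}$ with inner product the real part of the Hermitian one, and $T$ to $T_{\mathbb{R}}$. $(r^*F)(W)=F(W_{\mathbb{R}})$,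 and $r_!$ is the enriched left Kan extension along $r$: $(r_!E)(V)=\int^{W\in\mathcal{J}_0^{\mathbf{U}}}E(W)\wedge\mathcal{J}_0^{\mathbf{O}}(W_{\mathbb{R}},V)$. *)

theory Defs
  imports "HOL-Analysis.Analysis" "HOL-Library.Function_Algebras"
begin

section \<open>Compactly generated weak Hausdorff spaces\<close>

text \<open>
  The test spaces range over compact Hausdorff topologies on points of type \<open>'a set set\<close>. For weak
  Hausdorffness this is no restriction: given \<open>u\<close> from a compact Hausdorff space of any size, choose
  one preimage of every point in the image of \<open>u\<close>; the closure of the chosen points is a compact
  Hausdorff space with the same image, and (points of a Hausdorff space being separated by the
  traces of their neighbourhoods on a dense set) it has at most as many points as \<open>'a set set\<close>.
  In a weak Hausdorff space the images of test maps are compact Hausdorff subspaces, so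
  \<open>kify\<close> and \<open>compactly_generated\<close> do not depend on the bound either.
\<close>

definition weak_hausdorff :: "'a topology \<Rightarrow> bool" where
  "weak_hausdorff X \<longleftrightarrow>
     (\<forall>(K :: 'a set set topology) u.
        compact_space K \<and> Hausdorff_space K \<and> continuous_map K X u
          \<longrightarrow> closedin X (u ` topspace K))"

definition kify :: "'a topology \<Rightarrow> 'a topology" where
  "kify X = topology (\<lambda>U. U \<subseteq> topspace X \<and>
     (\<forall>(K :: 'a set set topology) u.
        compact_space K \<and> Hausdorff_space K \<and> continuous_map K X u
          \<longrightarrow> openin K {k \<in> topspace K. u k \<in> U}))"

definition compactly_generated :: "'a topology \<Rightarrow> bool" where
  "compactly_generated X \<longleftrightarrow> kify X = X"

definition quotient_topology :: "'a topology \<Rightarrow> ('a \<Rightarrow> 'b) \<Rightarrow> 'b topology" where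
  "quotient_topology X q =
     topology (\<lambda>U. U \<subseteq> q ` topspace X \<and> openin X {x \<in> topspace X. q x \<in> U})"

lemma openin_kify:
  "openin (kify X) U \<longleftrightarrow> U \<subseteq> topspace X \<and>
     (\<forall>(K :: 'a set set topology) u.
        compact_space K \<and> Hausdorff_space K \<and> continuous_map K X u
          \<longrightarrow> openin K {k \<in> topspace K. u k \<in> U})"
  for X :: "'a topology"
proof -
  have "istopology (\<lambda>U. U \<subseteq> topspace X \<and>
     (\<forall>(K :: 'a set set topology) u.
        compact_space K \<and> Hausdorff_space K \<and> continuous_map K X u
          \<longrightarrow> openin K {k \<in> topspace K. u k \<in> U}))" (is "istopology ?P")
    unfolding istopology_def
  proof (intro conjI allI impI)
    fix S T assume S: "?P S" and T: "?P T"
    show "S \<inter> T \<subseteq> topspace X" using S by blast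
    fix K :: "'a set set topology" and u
    assume "compact_space K \<and> Hausdorff_space K \<and> continuous_map K X u"
    then have "openin K ({k \<in> topspace K. u k \<in> S} \<inter> {k \<in> topspace K. u k \<in> T})"
      using S T by (intro openin_Int) auto
    then show "openin K {k \<in> topspace K. u k \<in> S \<inter> T}"
      by (rule back_subst[where P = "openin K"]) auto
  next
    fix \<U> assume U: "\<forall>S\<in>\<U>. ?P S"
    show "\<Union>\<U> \<subseteq> topspace X" using U by blast
    fix K :: "'a set set topology" and u
    assume "compact_space K \<and> Hausdorff_space K \<and> continuous_map K X u"
    then have "openin K (\<Union>S\<in>\<U>. {k \<in> topspace K. u k \<in> S})"
      using U by (intro openin_Union) auto
    then show "openin K {k \<in> topspace K. u k \<in> \<Union>\<U>}"
      by (rule back_subst[where P = "openin K"]) auto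
  qed
  then show ?thesis by (simp add: kify_def)
qed

lemma openin_quotient_topology:
  "openin (quotient_topology X q) U \<longleftrightarrow>
     U \<subseteq> q ` topspace X \<and> openin X {x \<in> topspace X. q x \<in> U}"
proof -
  have "istopology (\<lambda>U. U \<subseteq> q ` topspace X \<and> openin X {x \<in> topspace X. q x \<in> U})"
    (is "istopology ?P")
    unfolding istopology_def
  proof (intro conjI allI impI)
    fix S T assume S: "?P S" and T: "?P T"
    show "S \<inter> T \<subseteq> q ` topspace X" using S by blast
    have "openin X ({x \<in> topspace X. q x \<in> S} \<inter> {x \<in> topspace X. q x \<in> T})"
      using S T by blast
    then show "openin X {x \<in> topspace X. q x \<in> S \<inter> T}"
      by (rule back_subst[where P = "openin X"]) auto
  next
    fix \<U> assume U: "\<forall>S\<in>\<U>. ?P S"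
    show "\<Union>\<U> \<subseteq> q ` topspace X" using U by blast
    have "openin X (\<Union>S\<in>\<U>. {x \<in> topspace X. q x \<in> S})"
      using U by (intro openin_Union) auto
    then show "openin X {x \<in> topspace X. q x \<in> \<Union>\<U>}"
      by (rule back_subst[where P = "openin X"]) auto
  qed
  then show ?thesis by (simp add: quotient_topology_def)
qed


section \<open>The category of based spaces\<close>

record 'a based =
  sp :: "'a topology"
  pt :: 'a

abbreviation pts :: "'a based \<Rightarrow> 'a set" where
  "pts X \<equiv> topspace (sp X)"

definition based_space :: "'a based \<Rightarrow> bool" where
  "based_space X \<longleftrightarrow> compactly_generated (sp X) \<and> weak_hausdorff (sp X) \<and> pt X \<in> pts X"

definition based_map :: "'a based \<Rightarrow> 'b based \<Rightarrow> ('a \<Rightarrow> 'b) \<Rightarrow> bool" where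
  "based_map X Y f \<longleftrightarrow> continuous_map (sp X) (sp Y) f \<and> f (pt X) = pt Y"

definition add_point :: "'a topology \<Rightarrow> 'a option based" where
  "add_point X =
     \<lparr>sp = topology (\<lambda>U. U \<subseteq> insert None (Some ` topspace X) \<and> openin X (Some -` U)),
      pt = None\<rparr>"

lemma openin_add_point:
  "openin (sp (add_point X)) U \<longleftrightarrow> U \<subseteq> insert None (Some ` topspace X) \<and> openin X (Some -` U)"
proof -
  have "istopology (\<lambda>U. U \<subseteq> insert None (Some ` topspace X) \<and> openin X (Some -` U))"
    unfolding istopology_def by (auto simp: vimage_Union)
  then show ?thesis by (simp add: add_point_def)
qed

text \<open>
  The smash product collapses the wedge of \<open>X\<close> and \<open>Y\<close> (which is closed in the compactly generated
  product) to a point; the pair of base points represents the collapsed wedge.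
\<close>

definition smash_pt :: "'a based \<Rightarrow> 'b based \<Rightarrow> 'a \<times> 'b \<Rightarrow> 'a \<times> 'b" where
  "smash_pt X Y p = (if fst p = pt X \<or> snd p = pt Y then (pt X, pt Y) else p)"

definition smash :: "'a based \<Rightarrow> 'b based \<Rightarrow> ('a \<times> 'b) based" where
  "smash X Y =
     \<lparr>sp = quotient_topology (kify (prod_topology (sp X) (sp Y))) (smash_pt X Y),
      pt = (pt X, pt Y)\<rparr>"


section \<open>Categories enriched in based spaces, and enriched functors\<close>

record ('o, 'm) tcat =
  Ob :: "'o set"
  Hom :: "'o \<Rightarrow> 'o \<Rightarrow> 'm based"
  Idt :: "'o \<Rightarrow> 'm"
  Cmp :: "'m \<Rightarrow> 'm \<Rightarrow> 'm"

record ('o, 'm, 'p, 'n) tfunctor =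
  on_ob :: "'o \<Rightarrow> 'p"
  on_hom :: "'o \<Rightarrow> 'o \<Rightarrow> 'm \<Rightarrow> 'n"

record ('o, 'm, 'u) efunctor =
  obj :: "'o \<Rightarrow> 'u based"
  act :: "'o \<Rightarrow> 'o \<Rightarrow> 'm \<Rightarrow> 'u \<Rightarrow> 'u"

text \<open>
  An enriched functor to based spaces, its structure maps being given in the form
  \<open>C(U,V) \<and> F(U) \<rightarrow> F(V)\<close>.
\<close>

definition enriched_functor :: "('o, 'm) tcat \<Rightarrow> ('o, 'm, 'u) efunctor \<Rightarrow> bool" where
  "enriched_functor C F \<longleftrightarrow>
     (\<forall>U\<in>Ob C. based_space (obj F U)) \<and>
     (\<forall>U\<in>Ob C. \<forall>V\<in>Ob C.
        based_map (smash (Hom C U V) (obj F U)) (obj F V) (\<lambda>(f, x). act F U V f x) \<and>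
        (\<forall>x\<in>pts (obj F U). act F U V (pt (Hom C U V)) x = pt (obj F V)) \<and>
        (\<forall>f\<in>pts (Hom C U V). act F U V f (pt (obj F U)) = pt (obj F V))) \<and>
     (\<forall>U\<in>Ob C. \<forall>x\<in>pts (obj F U). act F U U (Idt C U) x = x) \<and>
     (\<forall>U\<in>Ob C. \<forall>V\<in>Ob C. \<forall>W\<in>Ob C.
        \<forall>f\<in>pts (Hom C U V). \<forall>g\<in>pts (Hom C V W). \<forall>x\<in>pts (obj F U).
          act F U W (Cmp C g f) x = act F V W g (act F U V f x))"

text \<open>
  A natural transformation is stored together with its source and target. Its components are
  \<open>undefined\<close> outside their domains, so that equality is equality of natural transformations.
\<close>

type_synonym ('o, 'm, 'u) ntrans =
  "('o, 'm, 'u) efunctor \<times> ('o, 'm, 'u) efunctor \<times> ('o \<Rightarrow> 'u \<Rightarrow> 'u)"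

definition natural_transformation :: "('o, 'm) tcat \<Rightarrow> ('o, 'm, 'u) ntrans \<Rightarrow> bool" where
  "natural_transformation C = (\<lambda>(E, F, \<alpha>).
     enriched_functor C E \<and> enriched_functor C F \<and>
     \<alpha> \<in> extensional (Ob C) \<and>
     (\<forall>V\<in>Ob C. \<alpha> V \<in> extensional (pts (obj E V)) \<and> based_map (obj E V) (obj F V) (\<alpha> V)) \<and>
     (\<forall>U\<in>Ob C. \<forall>V\<in>Ob C. \<forall>f\<in>pts (Hom C U V). \<forall>x\<in>pts (obj E U).
        \<alpha> V (act E U V f x) = act F U V f (\<alpha> U x)))"


section \<open>Model-categorical notions\<close>

record ('o, 'm) category =
  objs :: "'o set"
  arrs :: "'m set"
  source :: "'m \<Rightarrow> 'o"
  target :: "'m \<Rightarrow> 'o"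
  ident :: "'o \<Rightarrow> 'm"
  compo :: "'m \<Rightarrow> 'm \<Rightarrow> 'm"

definition homset :: "('o, 'm, 'z) category_scheme \<Rightarrow> 'o \<Rightarrow> 'o \<Rightarrow> 'm set" where
  "homset M a b = {f \<in> arrs M. source M f = a \<and> target M f = b}"

record ('o, 'm, 'p, 'n) cfunctor =
  fobj :: "'o \<Rightarrow> 'p"
  farr :: "'m \<Rightarrow> 'n"

definition is_functor ::
    "('o, 'm, 'y) category_scheme \<Rightarrow> ('p, 'n, 'z) category_scheme \<Rightarrow> ('o, 'm, 'p, 'n) cfunctor \<Rightarrow> bool"
  where
  "is_functor M N L \<longleftrightarrow>
     (\<forall>a\<in>objs M. fobj L a \<in> objs N \<and> farr L (ident M a) = ident N (fobj L a)) \<and>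
     (\<forall>a\<in>objs M. \<forall>b\<in>objs M. \<forall>f\<in>homset M a b. farr L f \<in> homset N (fobj L a) (fobj L b)) \<and>
     (\<forall>a\<in>objs M. \<forall>b\<in>objs M. \<forall>c\<in>objs M. \<forall>f\<in>homset M a b. \<forall>g\<in>homset M b c.
        farr L (compo M g f) = compo N (farr L g) (farr L f))"

definition adjunction ::
    "('o, 'm, 'y) category_scheme \<Rightarrow> ('p, 'n, 'z) category_scheme \<Rightarrow>
     ('o, 'm, 'p, 'n) cfunctor \<Rightarrow> ('p, 'n, 'o, 'm) cfunctor \<Rightarrow> bool"
  where
  "adjunction M N L R \<longleftrightarrow>
     is_functor M N L \<and> is_functor N M R \<and>
     (\<exists>\<phi>. (\<forall>a\<in>objs M. \<forall>b\<in>objs N.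
              bij_betw (\<phi> a b) (homset N (fobj L a) b) (homset M a (fobj R b))) \<and>
          (\<forall>a\<in>objs M. \<forall>a'\<in>objs M. \<forall>b\<in>objs N. \<forall>b'\<in>objs N.
             \<forall>h\<in>homset M a' a. \<forall>k\<in>homset N b b'. \<forall>f\<in>homset N (fobj L a) b.
               \<phi> a' b' (compo N k (compo N f (farr L h))) =
               compo M (farr R k) (compo M (\<phi> a b f) h)))"

record ('o, 'm) model_cat = "('o, 'm) category" +
  weqs :: "'m set"
  fibs :: "'m set"
  cofs :: "'m set"

definition has_lifting :: "('o, 'm, 'z) category_scheme \<Rightarrow> 'm \<Rightarrow> 'm \<Rightarrow> bool" where
  "has_lifting M i p \<longleftrightarrow>
     (\<forall>f\<in>homset M (source M i) (source M p). \<forall>g\<in>homset M (target M i) (target M p).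
        compo M p f = compo M g i \<longrightarrow>
        (\<exists>h\<in>homset M (target M i) (source M p). compo M h i = f \<and> compo M p h = g))"

text \<open>
  The right adjoint is a right Quillen functor (it preserves fibrations and acyclic fibrations) and
  the left adjoint preserves cofibrations. Between model categories the left adjoint then also
  preserves acyclic cofibrations: \<open>left_adjoint_acyclic_cofibrations\<close> below.
\<close>

definition quillen_adjunction ::
    "('o, 'm) model_cat \<Rightarrow> ('p, 'n) model_cat \<Rightarrow>
     ('o, 'm, 'p, 'n) cfunctor \<Rightarrow> ('p, 'n, 'o, 'm) cfunctor \<Rightarrow> bool"
  where
  "quillen_adjunction M N L R \<longleftrightarrow>
     adjunction M N L R \<and>
     farr L ` cofs M \<subseteq> cofs N \<and>
     farr R ` fibs N \<subseteq> fibs M \<and>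
     farr R ` (fibs N \<inter> weqs N) \<subseteq> fibs M \<inter> weqs M"

definition is_category :: "('o, 'm, 'z) category_scheme \<Rightarrow> bool" where
  "is_category M \<longleftrightarrow>
     (\<forall>f\<in>arrs M. source M f \<in> objs M \<and> target M f \<in> objs M) \<and>
     (\<forall>a\<in>objs M. ident M a \<in> homset M a a) \<and>
     (\<forall>a b c. \<forall>f\<in>homset M a b. \<forall>g\<in>homset M b c. compo M g f \<in> homset M a c) \<and>
     (\<forall>a b. \<forall>f\<in>homset M a b. compo M f (ident M a) = f \<and> compo M (ident M b) f = f) \<and>
     (\<forall>a b c d. \<forall>f\<in>homset M a b. \<forall>g\<in>homset M b c. \<forall>h\<in>homset M c d.
        compo M h (compo M g f) = compo M (compo M h g) f)"

definition is_retract :: "('o, 'm, 'z) category_scheme \<Rightarrow> 'm \<Rightarrow> 'm \<Rightarrow> bool" where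
  "is_retract M f g \<longleftrightarrow>
     (\<exists>s\<in>homset M (source M f) (source M g). \<exists>t\<in>homset M (target M f) (target M g).
      \<exists>u\<in>homset M (source M g) (source M f). \<exists>v\<in>homset M (target M g) (target M f).
        compo M g s = compo M t f \<and> compo M f u = compo M v g \<and>
        compo M u s = ident M (source M f) \<and> compo M v t = ident M (target M f))"

text \<open>The axioms of a model structure, apart from the existence of limits and colimits.\<close>

definition model_structure :: "('o, 'm) model_cat \<Rightarrow> bool" where
  "model_structure M \<longleftrightarrow>
     is_category M \<and> weqs M \<subseteq> arrs M \<and> fibs M \<subseteq> arrs M \<and> cofs M \<subseteq> arrs M \<and>
     (\<forall>a b c. \<forall>f\<in>homset M a b. \<forall>g\<in>homset M b c.
        (f \<in> weqs M \<and> g \<in> weqs M \<longrightarrow> compo M g f \<in> weqs M) \<and>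
        (f \<in> weqs M \<and> compo M g f \<in> weqs M \<longrightarrow> g \<in> weqs M) \<and>
        (g \<in> weqs M \<and> compo M g f \<in> weqs M \<longrightarrow> f \<in> weqs M)) \<and>
     (\<forall>f\<in>arrs M. \<forall>g\<in>arrs M. is_retract M f g \<longrightarrow>
        (g \<in> weqs M \<longrightarrow> f \<in> weqs M) \<and> (g \<in> fibs M \<longrightarrow> f \<in> fibs M) \<and> (g \<in> cofs M \<longrightarrow> f \<in> cofs M)) \<and>
     (\<forall>i\<in>cofs M. \<forall>p\<in>fibs M. i \<in> weqs M \<or> p \<in> weqs M \<longrightarrow> has_lifting M i p) \<and>
     (\<forall>a b. \<forall>f\<in>homset M a b.
        (\<exists>c. \<exists>i\<in>homset M a c \<inter> cofs M. \<exists>p\<in>homset M c b \<inter> fibs M \<inter> weqs M. f = compo M p i) \<and>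
        (\<exists>c. \<exists>i\<in>homset M a c \<inter> cofs M \<inter> weqs M. \<exists>p\<in>homset M c b \<inter> fibs M. f = compo M p i))"

lemma left_adjoint_acyclic_cofibrations:
  assumes M: "model_structure M" and N: "model_structure N" and Q: "quillen_adjunction M N L R"
  shows "farr L ` (cofs M \<inter> weqs M) \<subseteq> cofs N \<inter> weqs N"
proof
  fix y assume "y \<in> farr L ` (cofs M \<inter> weqs M)"
  then obtain i where i: "i \<in> cofs M" "i \<in> weqs M" and y: "y = farr L i" by blast
  have cM: "is_category M" and cN: "is_category N"
    using M N by (simp_all add: model_structure_def)
  note CM = cM[unfolded is_category_def] and CN = cN[unfolded is_category_def]
  have A: "adjunction M N L R" and fR: "farr R ` fibs N \<subseteq> fibs M"
    using Q by (simp_all add: quillen_adjunction_def)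
  have L: "is_functor M N L" and R: "is_functor N M R"
    using A by (simp_all add: adjunction_def)
  obtain \<phi> where
    bij: "\<And>a b. a \<in> objs M \<Longrightarrow> b \<in> objs N \<Longrightarrow>
              bij_betw (\<phi> a b) (homset N (fobj L a) b) (homset M a (fobj R b))" and
    nat: "\<And>a a' b b' h k f. \<lbrakk>a \<in> objs M; a' \<in> objs M; b \<in> objs N; b' \<in> objs N;
              h \<in> homset M a' a; k \<in> homset N b b'; f \<in> homset N (fobj L a) b\<rbrakk> \<Longrightarrow>
              \<phi> a' b' (compo N k (compo N f (farr L h))) =
              compo M (farr R k) (compo M (\<phi> a b f) h)"
    using A unfolding adjunction_def by metis
  define a b where "a = source M i" and "b = target M i"
  have ia: "i \<in> arrs M" using i M by (auto simp: model_structure_def)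
  have ob: "a \<in> objs M" "b \<in> objs M" using ia CM by (auto simp: a_def b_def)
  have ih: "i \<in> homset M a b" using ia by (simp add: homset_def a_def b_def)
  have Lo: "fobj L a \<in> objs N" "fobj L b \<in> objs N"
    and Lid: "\<And>a. a \<in> objs M \<Longrightarrow> farr L (ident M a) = ident N (fobj L a)"
    and Lh: "farr L i \<in> homset N (fobj L a) (fobj L b)"
    using L ob ih unfolding is_functor_def by blast+
  have Ro: "\<And>c. c \<in> objs N \<Longrightarrow> fobj R c \<in> objs M"
    and Rid: "\<And>c. c \<in> objs N \<Longrightarrow> farr R (ident N c) = ident M (fobj R c)"
    and Rh: "\<And>c d f. c \<in> objs N \<Longrightarrow> d \<in> objs N \<Longrightarrow> f \<in> homset N c d
               \<Longrightarrow> farr R f \<in> homset M (fobj R c) (fobj R d)"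
    using R unfolding is_functor_def by blast+
  obtain c j p where j: "j \<in> homset N (fobj L a) c" "j \<in> cofs N" "j \<in> weqs N"
    and p: "p \<in> homset N c (fobj L b)" "p \<in> fibs N" and pj: "farr L i = compo N p j"
    using N Lh unfolding model_structure_def by blast
  have c: "c \<in> objs N" using j(1) CN by (auto simp: homset_def)
  have idM: "\<And>x y f. f \<in> homset M x y \<Longrightarrow> compo M f (ident M x) = f \<and> compo M (ident M y) f = f"
    and idN: "\<And>x y f. f \<in> homset N x y \<Longrightarrow> compo N f (ident N x) = f \<and> compo N (ident N y) f = f"
    and idhM: "\<And>x. x \<in> objs M \<Longrightarrow> ident M x \<in> homset M x x"
    and idhN: "\<And>x. x \<in> objs N \<Longrightarrow> ident N x \<in> homset N x x"
    and coM: "\<And>x y z f g. f \<in> homset M x y \<Longrightarrow> g \<in> homset M y z \<Longrightarrow> compo M g f \<in> homset M x z"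
    and coN: "\<And>x y z f g. f \<in> homset N x y \<Longrightarrow> g \<in> homset N y z \<Longrightarrow> compo N g f \<in> homset N x z"
    using CM CN by simp_all
  have phih: "\<And>x z f. x \<in> objs M \<Longrightarrow> z \<in> objs N \<Longrightarrow> f \<in> homset N (fobj L x) z
                \<Longrightarrow> \<phi> x z f \<in> homset M x (fobj R z)"
    using bij by (meson bij_betw_apply)
  have nat1: "\<phi> a' z (compo N f (farr L h)) = compo M (\<phi> x z f) h"
    if "x \<in> objs M" "a' \<in> objs M" "z \<in> objs N" "h \<in> homset M a' x" "f \<in> homset N (fobj L x) z"
    for x a' z h f
  proof -
    have "farr L h \<in> homset N (fobj L a') (fobj L x)"
      using L that unfolding is_functor_def by blast
    then have "compo N f (farr L h) \<in> homset N (fobj L a') z" using coN that by blast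
    moreover have "compo M (\<phi> x z f) h \<in> homset M a' (fobj R z)"
      using coM that phih by blast
    ultimately show ?thesis
      using nat[OF that(1) that(2) that(3) that(3) that(4) idhN[OF that(3)] that(5)] idN idM
        Rid[OF that(3)] by metis
  qed
  have nat2: "\<phi> x z' (compo N k f) = compo M (farr R k) (\<phi> x z f)"
    if "x \<in> objs M" "z \<in> objs N" "z' \<in> objs N" "k \<in> homset N z z'" "f \<in> homset N (fobj L x) z"
    for x z z' k f
    using nat[OF that(1) that(1) that(2) that(3) idhM[OF that(1)] that(4) that(5)]
      Lid[OF that(1)] idN[OF that(5)] idM[OF phih[OF that(1,2,5)]] by metis
  let ?e = "\<phi> b (fobj L b) (ident N (fobj L b))"
  have sq: "compo M (farr R p) (\<phi> a c j) = compo M ?e i"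
    using nat2[OF ob(1) c Lo(2) p(1) j(1)]
      nat1[OF ob(2) ob(1) Lo(2) ih idhN[OF Lo(2)]] idN[OF Lh] pj by metis
  have Rp: "farr R p \<in> fibs M" "farr R p \<in> homset M (fobj R c) (fobj R (fobj L b))"
    using fR p Rh[OF c Lo(2)] by blast+
  have "has_lifting M i (farr R p)"
    using M i Rp(1) unfolding model_structure_def by blast
  then obtain k where k: "k \<in> homset M b (fobj R c)" "compo M k i = \<phi> a c j"
      "compo M (farr R p) k = ?e"
  proof -
    have "source M (farr R p) = fobj R c" "target M (farr R p) = fobj R (fobj L b)"
      using Rp(2) by (simp_all add: homset_def)
    then have "\<exists>k\<in>homset M b (fobj R c). compo M k i = \<phi> a c j \<and> compo M (farr R p) k = ?e"
      using \<open>has_lifting M i (farr R p)\<close> sq phih[OF ob(1) c j(1)]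
        phih[OF ob(2) Lo(2) idhN[OF Lo(2)]]
      unfolding has_lifting_def a_def[symmetric] b_def[symmetric] by simp
    then show thesis using that by blast
  qed
  obtain h where h: "h \<in> homset N (fobj L b) c" "\<phi> b c h = k"
    using bij_betw_imp_surj_on[OF bij[OF ob(2) c]] k(1) by (metis imageE)
  have hj: "compo N h (farr L i) = j"
  proof -
    have "\<phi> a c (compo N h (farr L i)) = \<phi> a c j"
      using nat1[OF ob(2) ob(1) c ih h(1)] h(2) k(2) by simp
    then show ?thesis
      using inj_onD[OF bij_betw_imp_inj_on[OF bij[OF ob(1) c]] _ coN[OF Lh h(1)] j(1)] by blast
  qed
  have ph: "compo N p h = ident N (fobj L b)"
  proof -
    have "\<phi> b (fobj L b) (compo N p h) = ?e"
      using nat2[OF ob(2) c Lo(2) p(1) h(1)] h(2) k(3) by simp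
    then show ?thesis
      using inj_onD[OF bij_betw_imp_inj_on[OF bij[OF ob(2) Lo(2)]] _ coN[OF h(1) p(1)] idhN[OF Lo(2)]]
      by blast
  qed
  have "is_retract N (farr L i) j"
  proof -
    have st: "source N (farr L i) = fobj L a" "target N (farr L i) = fobj L b"
      "source N j = fobj L a" "target N j = c"
      using Lh j(1) by (auto simp: homset_def)
    show ?thesis
      unfolding is_retract_def st
    proof (rule bexI[OF _ idhN[OF Lo(1)]], rule bexI[OF _ h(1)],
        rule bexI[OF _ idhN[OF Lo(1)]], rule bexI[OF _ p(1)], intro conjI)
      show "compo N j (ident N (fobj L a)) = compo N h (farr L i)" using idN[OF j(1)] hj by simp
      show "compo N (farr L i) (ident N (fobj L a)) = compo N p j" using idN[OF Lh] pj by simp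
      show "compo N (ident N (fobj L a)) (ident N (fobj L a)) = ident N (fobj L a)"
        using idN[OF idhN[OF Lo(1)]] by simp
    qed (fact ph)
  qed
  moreover have "farr L i \<in> arrs N" "j \<in> arrs N" using Lh j(1) by (auto simp: homset_def)
  ultimately show "y \<in> cofs N \<inter> weqs N"
    using N j(2,3) unfolding y model_structure_def by blast
qed


section \<open>Weak homotopy equivalences and Serre fibrations\<close>

definition cube :: "nat \<Rightarrow> (nat \<Rightarrow> real) topology" where
  "cube n = product_topology (\<lambda>_. top_of_set {0..1}) {..<n}"

definition cube_boundary :: "nat \<Rightarrow> (nat \<Rightarrow> real) set" where
  "cube_boundary n = {t \<in> topspace (cube n). \<exists>i<n. t i = 0 \<or> t i = 1}"

definition spheroids :: "nat \<Rightarrow> 'a topology \<Rightarrow> 'a \<Rightarrow> ((nat \<Rightarrow> real) \<Rightarrow> 'a) set" where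
  "spheroids n X x = {g. continuous_map (cube n) X g \<and> (\<forall>t\<in>cube_boundary n. g t = x)}"

definition spheroid_rel ::
    "nat \<Rightarrow> 'a topology \<Rightarrow> 'a \<Rightarrow> (((nat \<Rightarrow> real) \<Rightarrow> 'a) \<times> ((nat \<Rightarrow> real) \<Rightarrow> 'a)) set" where
  "spheroid_rel n X x =
     {(g, h). g \<in> spheroids n X x \<and> h \<in> spheroids n X x \<and>
              homotopic_with (\<lambda>k. \<forall>t\<in>cube_boundary n. k t = x) (cube n) X g h}"

text \<open>For \<open>n = 0\<close> the cube is a point with empty boundary and this is the set of path components.\<close>

definition htpy_group :: "nat \<Rightarrow> 'a topology \<Rightarrow> 'a \<Rightarrow> ((nat \<Rightarrow> real) \<Rightarrow> 'a) set set" where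
  "htpy_group n X x = spheroids n X x // spheroid_rel n X x"

definition htpy_group_map ::
    "nat \<Rightarrow> 'b topology \<Rightarrow> ('a \<Rightarrow> 'b) \<Rightarrow> 'a \<Rightarrow>
     ((nat \<Rightarrow> real) \<Rightarrow> 'a) set \<Rightarrow> ((nat \<Rightarrow> real) \<Rightarrow> 'b) set" where
  "htpy_group_map n Y f x c = spheroid_rel n Y (f x) `` ((\<lambda>g. f \<circ> g) ` c)"

text \<open>
  The maps induced on homotopy groups are homomorphisms, so they are isomorphisms as soon as they
  are bijective. The condition is only meaningful for nonempty spaces.
\<close>

definition weak_htpy_equivalence :: "'a topology \<Rightarrow> 'b topology \<Rightarrow> ('a \<Rightarrow> 'b) \<Rightarrow> bool" where
  "weak_htpy_equivalence X Y f \<longleftrightarrow>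
     continuous_map X Y f \<and>
     (\<forall>n. \<forall>x\<in>topspace X.
        bij_betw (htpy_group_map n Y f x) (htpy_group n X x) (htpy_group n Y (f x)))"

definition serre_fibration :: "'a topology \<Rightarrow> 'b topology \<Rightarrow> ('a \<Rightarrow> 'b) \<Rightarrow> bool" where
  "serre_fibration X Y p \<longleftrightarrow>
     continuous_map X Y p \<and>
     (\<forall>n g H.
        continuous_map (cube n) X g \<and>
        continuous_map (prod_topology (cube n) (top_of_set {0..1::real})) Y H \<and>
        (\<forall>t\<in>topspace (cube n). H (t, 0) = p (g t)) \<longrightarrow>
        (\<exists>G. continuous_map (prod_topology (cube n) (top_of_set {0..1::real})) X G \<and>
             (\<forall>t\<in>topspace (cube n). G (t, 0) = g t) \<and>
             (\<forall>t\<in>topspace (cube n). \<forall>s\<in>{0..1}. p (G (t, s)) = H (t, s))))"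


section \<open>The category of enriched functors with its projective model structure\<close>

definition functor_category ::
    "('o, 'm) tcat \<Rightarrow> (('o, 'm, 'u) efunctor, ('o, 'm, 'u) ntrans) category" where
  "functor_category C =
     \<lparr>objs = {F. enriched_functor C F},
      arrs = {a. natural_transformation C a},
      source = fst,
      target = (\<lambda>a. fst (snd a)),
      ident = (\<lambda>F. (F, F, \<lambda>V\<in>Ob C. \<lambda>x\<in>pts (obj F V). x)),
      compo = (\<lambda>(_, G, \<beta>) (E, _, \<alpha>). (E, G, \<lambda>V\<in>Ob C. \<lambda>x\<in>pts (obj E V). \<beta> V (\<alpha> V x)))\<rparr>"

definition levelwise_weqs :: "('o, 'm) tcat \<Rightarrow> ('o, 'm, 'u) ntrans set" where
  "levelwise_weqs C = {(E, F, \<alpha>). natural_transformation C (E, F, \<alpha>) \<and>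
     (\<forall>V\<in>Ob C. weak_htpy_equivalence (sp (obj E V)) (sp (obj F V)) (\<alpha> V))}"

definition levelwise_fibs :: "('o, 'm) tcat \<Rightarrow> ('o, 'm, 'u) ntrans set" where
  "levelwise_fibs C = {(E, F, \<alpha>). natural_transformation C (E, F, \<alpha>) \<and>
     (\<forall>V\<in>Ob C. serre_fibration (sp (obj E V)) (sp (obj F V)) (\<alpha> V))}"

definition projective ::
    "('o, 'm) tcat \<Rightarrow> (('o, 'm, 'u) efunctor, ('o, 'm, 'u) ntrans) model_cat" where
  "projective C = category.extend (functor_category C)
     \<lparr>weqs = levelwise_weqs C,
      fibs = levelwise_fibs C,
      cofs = {i \<in> arrs (functor_category C).
                \<forall>p\<in>levelwise_fibs C \<inter> levelwise_weqs C. has_lifting (functor_category C) i p}\<rparr>"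


section \<open>Restriction and enriched left Kan extension\<close>

definition restriction ::
    "('o, 'm) tcat \<Rightarrow> ('o, 'm, 'p, 'n) tfunctor \<Rightarrow>
     (('p, 'n, 'u) efunctor, ('p, 'n, 'u) ntrans, ('o, 'm, 'u) efunctor, ('o, 'm, 'u) ntrans) cfunctor"
  where
  "restriction C r =
    (let R = (\<lambda>F. \<lparr>obj = (\<lambda>W. obj F (on_ob r W)),
                   act = (\<lambda>W W' f. act F (on_ob r W) (on_ob r W') (on_hom r W W' f))\<rparr>)
     in \<lparr>fobj = R, farr = (\<lambda>(E, F, \<alpha>). (R E, R F, \<lambda>W\<in>Ob C. \<alpha> (on_ob r W)))\<rparr>)"

text \<open>
  The coend of \<open>H\<close>, contravariant in its first and covariant in its second argument: \<open>l W W' f\<close> is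
  the map from \<open>H W' W\<close> to \<open>H W W\<close> and \<open>r W W' f\<close> the map from \<open>H W' W\<close> to \<open>H W' W'\<close> induced by
  \<open>f\<close> in \<open>C(W,W')\<close>. Among based compactly generated weak Hausdorff spaces it is the largest weak
  Hausdorff quotient of the disjoint union of the \<open>H W W\<close> in which all base points are identified
  and the images under \<open>l W W' f\<close> and \<open>r W W' f\<close> agree.
\<close>

definition coend_gen ::
    "('o, 'm) tcat \<Rightarrow> ('o \<Rightarrow> 'o \<Rightarrow> 'b based) \<Rightarrow> ('o \<Rightarrow> 'o \<Rightarrow> 'm \<Rightarrow> 'b \<Rightarrow> 'b) \<Rightarrow>
     ('o \<Rightarrow> 'o \<Rightarrow> 'm \<Rightarrow> 'b \<Rightarrow> 'b) \<Rightarrow> (('o \<times> 'b) \<times> ('o \<times> 'b)) set" where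
  "coend_gen C H l r =
     {((W, pt (H W W)), (W', pt (H W' W'))) | W W'. W \<in> Ob C \<and> W' \<in> Ob C} \<union>
     {((W, l W W' f z), (W', r W W' f z)) | W W' f z.
        W \<in> Ob C \<and> W' \<in> Ob C \<and> f \<in> pts (Hom C W W') \<and> z \<in> pts (H W' W)}"

definition coend_sum :: "('o, 'm) tcat \<Rightarrow> ('o \<Rightarrow> 'o \<Rightarrow> 'b based) \<Rightarrow> ('o \<times> 'b) topology" where
  "coend_sum C H = sum_topology (\<lambda>W. sp (H W W)) (Ob C)"

definition coend_rel ::
    "('o, 'm) tcat \<Rightarrow> ('o \<Rightarrow> 'o \<Rightarrow> 'b based) \<Rightarrow> ('o \<Rightarrow> 'o \<Rightarrow> 'm \<Rightarrow> 'b \<Rightarrow> 'b) \<Rightarrow>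
     ('o \<Rightarrow> 'o \<Rightarrow> 'm \<Rightarrow> 'b \<Rightarrow> 'b) \<Rightarrow> (('o \<times> 'b) \<times> ('o \<times> 'b)) set" where
  "coend_rel C H l r =
     \<Inter>{R. equiv (topspace (coend_sum C H)) R \<and> coend_gen C H l r \<subseteq> R \<and>
          weak_hausdorff (quotient_topology (coend_sum C H) (\<lambda>p. R `` {p}))}"

text \<open>
  The points of a coend are equivalence classes; they are renamed injectively to points of type
  \<open>'u\<close>, which is possible whenever there are at most as many classes as elements of \<open>'u\<close>.
\<close>

definition coend_pr ::
    "('o, 'm) tcat \<Rightarrow> ('o \<Rightarrow> 'o \<Rightarrow> 'b based) \<Rightarrow> ('o \<Rightarrow> 'o \<Rightarrow> 'm \<Rightarrow> 'b \<Rightarrow> 'b) \<Rightarrow>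
     ('o \<Rightarrow> 'o \<Rightarrow> 'm \<Rightarrow> 'b \<Rightarrow> 'b) \<Rightarrow> 'o \<times> 'b \<Rightarrow> 'u" where
  "coend_pr C H l r p =
     (SOME e. inj_on e (topspace (coend_sum C H) // coend_rel C H l r)) (coend_rel C H l r `` {p})"

definition coend ::
    "('o, 'm) tcat \<Rightarrow> ('o \<Rightarrow> 'o \<Rightarrow> 'b based) \<Rightarrow> ('o \<Rightarrow> 'o \<Rightarrow> 'm \<Rightarrow> 'b \<Rightarrow> 'b) \<Rightarrow>
     ('o \<Rightarrow> 'o \<Rightarrow> 'm \<Rightarrow> 'b \<Rightarrow> 'b) \<Rightarrow> 'u based" where
  "coend C H l r =
     \<lparr>sp = quotient_topology (coend_sum C H) (coend_pr C H l r),
      pt = (let W = SOME W. W \<in> Ob C in coend_pr C H l r (W, pt (H W W)))\<rparr>"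

definition lan_integrand ::
    "('p, 'n) tcat \<Rightarrow> ('o, 'm, 'p, 'n) tfunctor \<Rightarrow> ('o, 'm, 'u) efunctor \<Rightarrow> 'p \<Rightarrow>
     'o \<Rightarrow> 'o \<Rightarrow> ('u \<times> 'n) based" where
  "lan_integrand D r E V = (\<lambda>W' W. smash (obj E W) (Hom D (on_ob r W') V))"

definition lan_left ::
    "('p, 'n) tcat \<Rightarrow> ('o, 'm, 'p, 'n) tfunctor \<Rightarrow> ('o, 'm, 'u) efunctor \<Rightarrow> 'p \<Rightarrow>
     'o \<Rightarrow> 'o \<Rightarrow> 'm \<Rightarrow> 'u \<times> 'n \<Rightarrow> 'u \<times> 'n" where
  "lan_left D r E V W W' f = (\<lambda>(x, g).
     smash_pt (obj E W) (Hom D (on_ob r W) V) (x, Cmp D g (on_hom r W W' f)))"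

definition lan_right ::
    "('p, 'n) tcat \<Rightarrow> ('o, 'm, 'p, 'n) tfunctor \<Rightarrow> ('o, 'm, 'u) efunctor \<Rightarrow> 'p \<Rightarrow>
     'o \<Rightarrow> 'o \<Rightarrow> 'm \<Rightarrow> 'u \<times> 'n \<Rightarrow> 'u \<times> 'n" where
  "lan_right D r E V W W' f = (\<lambda>(x, g).
     smash_pt (obj E W') (Hom D (on_ob r W') V) (act E W W' f x, g))"

definition lan_pr ::
    "('o, 'm) tcat \<Rightarrow> ('p, 'n) tcat \<Rightarrow> ('o, 'm, 'p, 'n) tfunctor \<Rightarrow> ('o, 'm, 'u) efunctor \<Rightarrow>
     'p \<Rightarrow> 'o \<times> 'u \<times> 'n \<Rightarrow> 'u" where
  "lan_pr C D r E V =
     coend_pr C (lan_integrand D r E V) (lan_left D r E V) (lan_right D r E V)"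

definition lan_space ::
    "('o, 'm) tcat \<Rightarrow> ('p, 'n) tcat \<Rightarrow> ('o, 'm, 'p, 'n) tfunctor \<Rightarrow> ('o, 'm, 'u) efunctor \<Rightarrow>
     'p \<Rightarrow> 'u based" where
  "lan_space C D r E V =
     coend C (lan_integrand D r E V) (lan_left D r E V) (lan_right D r E V)"

text \<open>A representative \<open>(W, x, g)\<close> of a point of the coend.\<close>

definition lan_rep ::
    "('o, 'm) tcat \<Rightarrow> ('p, 'n) tcat \<Rightarrow> ('o, 'm, 'p, 'n) tfunctor \<Rightarrow> ('o, 'm, 'u) efunctor \<Rightarrow>
     'p \<Rightarrow> 'u \<Rightarrow> 'o \<times> 'u \<times> 'n" where
  "lan_rep C D r E V y =
     (SOME p. p \<in> topspace (coend_sum C (lan_integrand D r E V)) \<and> lan_pr C D r E V p = y)"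

definition lan_efunctor ::
    "('o, 'm) tcat \<Rightarrow> ('p, 'n) tcat \<Rightarrow> ('o, 'm, 'p, 'n) tfunctor \<Rightarrow> ('o, 'm, 'u) efunctor \<Rightarrow>
     ('p, 'n, 'u) efunctor" where
  "lan_efunctor C D r E =
     \<lparr>obj = lan_space C D r E,
      act = (\<lambda>V V' h y. case lan_rep C D r E V y of (W, x, g) \<Rightarrow>
        lan_pr C D r E V' (W, smash_pt (obj E W) (Hom D (on_ob r W) V') (x, Cmp D h g)))\<rparr>"

definition lan ::
    "('o, 'm) tcat \<Rightarrow> ('p, 'n) tcat \<Rightarrow> ('o, 'm, 'p, 'n) tfunctor \<Rightarrow>
     (('o, 'm, 'u) efunctor, ('o, 'm, 'u) ntrans, ('p, 'n, 'u) efunctor, ('p, 'n, 'u) ntrans) cfunctor"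
  where
  "lan C D r =
     \<lparr>fobj = lan_efunctor C D r,
      farr = (\<lambda>(E, F, \<alpha>). (lan_efunctor C D r E, lan_efunctor C D r F,
        \<lambda>V\<in>Ob D. \<lambda>y\<in>pts (lan_space C D r E V). case lan_rep C D r E V y of (W, x, g) \<Rightarrow>
          lan_pr C D r F V (W, smash_pt (obj F W) (Hom D (on_ob r W) V) (\<alpha> W x, g))))\<rparr>"


section \<open>Isometries and realification\<close>

text \<open>
  Vectors of \<open>\<F>\<^sup>\<infinity>\<close> are finitely supported sequences. The parameter \<open>c\<close> is the conjugation of the
  scalar field.
\<close>

type_synonym 'f vec = "nat \<Rightarrow> 'f"

definition vscale :: "'f :: real_normed_field \<Rightarrow> 'f vec \<Rightarrow> 'f vec" where
  "vscale a x = (\<lambda>n. a * x n)"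

interpretation vec: vector_space "vscale :: 'f :: real_normed_field \<Rightarrow> 'f vec \<Rightarrow> 'f vec"
  by unfold_locales (auto simp: vscale_def fun_eq_iff algebra_simps)

definition inner_prod :: "('f \<Rightarrow> 'f) \<Rightarrow> 'f :: real_normed_field vec \<Rightarrow> 'f vec \<Rightarrow> 'f" where
  "inner_prod c x y = (\<Sum>n | x n \<noteq> 0. x n * c (y n))"

definition fd_subspaces :: "'f :: real_normed_field vec set set" where
  "fd_subspaces = {U. vec.subspace U \<and> (\<forall>x\<in>U. finite {n. x n \<noteq> 0}) \<and>
                      (\<exists>B. finite B \<and> U \<subseteq> vec.span B)}"

text \<open>Isometries are extended by zero outside of their domain.\<close>

definition isometries ::
    "('f \<Rightarrow> 'f) \<Rightarrow> 'f :: real_normed_field vec set \<Rightarrow> 'f vec set \<Rightarrow> ('f vec \<Rightarrow> 'f vec) set" where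
  "isometries c U V = {T. T ` U \<subseteq> V \<and> (\<forall>x. x \<notin> U \<longrightarrow> T x = 0) \<and>
     (\<forall>x\<in>U. \<forall>y\<in>U. T (x + y) = T x + T y) \<and>
     (\<forall>a. \<forall>x\<in>U. T (vscale a x) = vscale a (T x)) \<and>
     (\<forall>x\<in>U. \<forall>y\<in>U. inner_prod c (T x) (T y) = inner_prod c x y)}"

text \<open>
  \<open>top_of_set\<close> is here the topology of pointwise convergence. On the linear maps from \<open>U\<close> to \<open>V\<close>,
  which form a finite-dimensional space, it is the usual topology, and evaluation on an orthonormal
  basis of \<open>U\<close> is a homeomorphism from the isometries to the Stiefel manifold of frames in \<open>V\<close>.
\<close>

definition J0 ::
    "('f \<Rightarrow> 'f) \<Rightarrow> ('f :: real_normed_field vec set, ('f vec \<Rightarrow> 'f vec) option) tcat" where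
  "J0 c =
     \<lparr>Ob = fd_subspaces,
      Hom = (\<lambda>U V. add_point (top_of_set (isometries c U V))),
      Idt = (\<lambda>U. Some (\<lambda>x. if x \<in> U then x else 0)),
      Cmp = (\<lambda>S T. case (S, T) of (Some S', Some T') \<Rightarrow> Some (S' \<circ> T') | _ \<Rightarrow> None)\<rparr>"

definition J0_O :: "(real vec set, (real vec \<Rightarrow> real vec) option) tcat" where
  "J0_O = J0 (\<lambda>x. x)"

definition J0_U :: "(complex vec set, (complex vec \<Rightarrow> complex vec) option) tcat" where
  "J0_U = J0 cnj"

text \<open>
  The underlying real inner product space of a subspace \<open>W\<close> of \<open>\<complex>\<^sup>\<infinity>\<close> is a subspace of \<open>\<real>\<^sup>\<infinity>\<close>
  through the real isometry of \<open>\<complex>\<^sup>\<infinity>\<close> with \<open>\<real>\<^sup>\<infinity>\<close> that interleaves real and imaginary parts.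
\<close>

definition realify_vec :: "complex vec \<Rightarrow> real vec" where
  "realify_vec z = (\<lambda>n. if even n then Re (z (n div 2)) else Im (z (n div 2)))"

definition unrealify_vec :: "real vec \<Rightarrow> complex vec" where
  "unrealify_vec x = (\<lambda>n. Complex (x (2 * n)) (x (2 * n + 1)))"

definition realification ::
    "(complex vec set, (complex vec \<Rightarrow> complex vec) option,
      real vec set, (real vec \<Rightarrow> real vec) option) tfunctor" where
  "realification =
     \<lparr>on_ob = (\<lambda>W. realify_vec ` W),
      on_hom = (\<lambda>W W'. map_option (\<lambda>T. realify_vec \<circ> T \<circ> unrealify_vec))\<rparr>"

end

theory Submission
  imports Defs
begin

text \<open>
  Restriction preserves levelwise fibrations and levelwise weak equivalences for trivial reasons, and
  since cofibrations are defined by lifting, the left adjoint of restriction preserves them; so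
  everything rests on the existence of the left adjoint, that is on the coends being compactly
  generated weak Hausdorff and carrying a continuous action. Coends are quotients of sums of smash
  products \<open>E(W) \<and> J(W,V)\<close> by an intersection of relations with weak Hausdorff quotient. A
  quotient of a compactly generated space is weak Hausdorff as soon as its points are separated by
  continuous maps to weak Hausdorff spaces, which applies to that intersection. Stiefel manifolds are
  compact Hausdorff, and products with a compact Hausdorff space preserve both compactly generated
  spaces and quotient maps; hence kification plays no role in the smash products and composition of
  isometries induces a continuous action on the coend.
\<close>

section \<open>Compactly generated and weak Hausdorff spaces\<close>

text \<open>Two questions of size shape the proof, as HOL has no universe of all spaces. Test spaces
  have points of type \<open>'a set set\<close>, so compact generation of a quotient refers to other
  test spaces than that of its source; \<open>generated_by\<close> therefore has the type of test
  points as a parameter, passes to sums and quotients at a fixed parameter, and is converted back to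
  \<open>compactly_generated\<close> once the space is known to be weak Hausdorff. Moreover, the
  left Kan extension of a functor with points in \<open>'u\<close> must again have points in
  \<open>'u\<close>. Finite-dimensional subspaces and isometries are coded by finite lists of
  scalars, so an injection of the reals into \<open>'u\<close> makes room for all triples
  \<open>(W, x, g)\<close>.

  Every map out of the Kan extension is defined by evaluating at a representative chosen by
  \<open>lan_rep\<close>; \<open>lan_universal\<close> shows that the choice does not matter and
  that the result is continuous. The adjunction bijection is then explicit: \<open>unit_map\<close>
  evaluates at identities and \<open>transpose\<close> inverts it.\<close>

lemma topspace_quotient_topology [simp]: "topspace (quotient_topology X q) = q ` topspace X"
proof
  show "topspace (quotient_topology X q) \<subseteq> q ` topspace X"
    by (meson openin_quotient_topology openin_topspace)
  have "{x \<in> topspace X. q x \<in> q ` topspace X} = topspace X" by auto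
  then have "openin (quotient_topology X q) (q ` topspace X)"
    by (simp add: openin_quotient_topology)
  then show "q ` topspace X \<subseteq> topspace (quotient_topology X q)" by (rule openin_subset)
qed

lemma quotient_map_quotient_topology: "quotient_map X (quotient_topology X q) q"
  by (simp add: quotient_map_def openin_quotient_topology)

lemma topspace_kify [simp]: "topspace (kify X) = topspace X"
proof
  show "topspace (kify X) \<subseteq> topspace X" by (meson openin_kify openin_topspace)
  have "{k \<in> topspace K. u k \<in> topspace X} = topspace K" if "continuous_map K X u"
    for K :: "'a set set topology" and u
    using continuous_map_image_subset_topspace[OF that] by auto
  then have "openin (kify X) (topspace X)" by (simp add: openin_kify)
  then show "topspace X \<subseteq> topspace (kify X)" by (rule openin_subset)
qed

lemma openin_imp_openin_kify: "openin X U \<Longrightarrow> openin (kify X) U"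
  by (auto simp: openin_kify openin_continuous_map_preimage dest: openin_subset)

lemma continuous_map_from_kify: "continuous_map X Y f \<Longrightarrow> continuous_map (kify X) Y f"
  by (auto simp: continuous_map_def intro: openin_imp_openin_kify)

section \<open>Compact generation relative to a type of test points\<close>

definition test_open :: "'k itself \<Rightarrow> 'a topology \<Rightarrow> 'a set \<Rightarrow> bool" where
  "test_open _ X U \<longleftrightarrow> U \<subseteq> topspace X \<and>
     (\<forall>(K :: 'k topology) u. compact_space K \<and> Hausdorff_space K \<and> continuous_map K X u
          \<longrightarrow> openin K {k \<in> topspace K. u k \<in> U})"

definition generated_by :: "'k itself \<Rightarrow> 'a topology \<Rightarrow> bool" where
  "generated_by T X \<longleftrightarrow> (\<forall>U. test_open T X U \<longrightarrow> openin X U)"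

lemma openin_kify_iff: "openin (kify X) U \<longleftrightarrow> test_open TYPE('a set set) X U"
  for X :: "'a topology"
  by (simp only: openin_kify test_open_def)

lemma compactly_generated_iff:
  "compactly_generated X \<longleftrightarrow> generated_by TYPE('a set set) X"
  for X :: "'a topology"
proof
  assume "compactly_generated X"
  then show "generated_by TYPE('a set set) X"
    by (metis compactly_generated_def generated_by_def openin_kify_iff)
next
  assume "generated_by TYPE('a set set) X"
  then have "openin (kify X) U \<longleftrightarrow> openin X U" for U
    unfolding generated_by_def openin_kify_iff[symmetric] using openin_imp_openin_kify by blast
  then show "compactly_generated X"
    by (simp add: compactly_generated_def topology_eq)
qed

lemma test_open_preimage:
  assumes "test_open T Y U" and f: "continuous_map X Y f"
  shows "test_open T X {x \<in> topspace X. f x \<in> U}"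
  unfolding test_open_def
proof (intro conjI allI impI)
  fix K :: "'a topology" and u
  assume K: "compact_space K \<and> Hausdorff_space K \<and> continuous_map K X u"
  then have "continuous_map K Y (f \<circ> u)" using f by (metis continuous_map_compose)
  then have "openin K {k \<in> topspace K. (f \<circ> u) k \<in> U}"
    using assms(1) K unfolding test_open_def by blast
  moreover have "{k \<in> topspace K. u k \<in> {x \<in> topspace X. f x \<in> U}} = {k \<in> topspace K. (f \<circ> u) k \<in> U}"
    using K continuous_map_image_subset_topspace by fastforce
  ultimately show "openin K {k \<in> topspace K. u k \<in> {x \<in> topspace X. f x \<in> U}}" by simp
qed auto

text \<open>A test-open set of \<open>Y\<close> pulls back along \<open>q\<close> to a test-open set
  of \<open>X\<close>, because test maps into \<open>X\<close> become test maps into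
  \<open>Y\<close>. The test type stays fixed while the type of points changes.\<close>

lemma generated_by_quotient:
  assumes X: "generated_by T X" and q: "quotient_map X Y q"
  shows "generated_by T Y"
  unfolding generated_by_def
proof (intro allI impI)
  fix U assume U: "test_open T Y U"
  then have "openin X {x \<in> topspace X. q x \<in> U}"
    using X test_open_preimage[OF U quotient_imp_continuous_map[OF q]] by (simp add: generated_by_def)
  moreover have "U \<subseteq> topspace Y" using U by (simp add: test_open_def)
  ultimately show "openin Y U" using q by (simp add: quotient_map_def)
qed

lemma generated_by_sum:
  assumes X: "\<And>i. i \<in> I \<Longrightarrow> generated_by T (X i)"
  shows "generated_by T (sum_topology X I)"
  unfolding generated_by_def
proof (intro allI impI)
  fix U assume U: "test_open T (sum_topology X I) U"
  have "openin (X i) {x. (i, x) \<in> U}" if i: "i \<in> I" for i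
  proof -
    have "continuous_map (X i) (sum_topology X I) (\<lambda>x. (i, x))"
      by (rule continuous_map_component_injection[OF i])
    from test_open_preimage[OF U this] have "openin (X i) {x \<in> topspace (X i). (i, x) \<in> U}"
      using X[OF i] by (simp add: generated_by_def)
    moreover have "{x \<in> topspace (X i). (i, x) \<in> U} = {x. (i, x) \<in> U}"
      using U i by (auto simp: test_open_def)
    ultimately show ?thesis by simp
  qed
  then show "openin (sum_topology X I) U"
    using U by (auto simp: openin_sum_topology test_open_def)
qed

text \<open>Regularity in the form needed below: the open \<open>U\<close> serves as the
  neighbourhood, while the closed \<open>C\<close> can be pushed forward or pulled back to a closed
  set.\<close>

lemma compact_Hausdorff_closed_nbhd:
  assumes "compact_space X" "Hausdorff_space X" "openin X W" "x \<in> W"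
  obtains U C where "openin X U" "closedin X C" "x \<in> U" "U \<subseteq> C" "C \<subseteq> W"
proof -
  have "neighbourhood_base_of (closedin X) X"
    using assms compact_Hausdorff_imp_regular_space neighbourhood_base_of_closedin by blast
  then have "\<exists>U C. openin X U \<and> closedin X C \<and> x \<in> U \<and> U \<subseteq> C \<and> C \<subseteq> W"
    unfolding neighbourhood_base_of using assms(3,4) by blast
  then show thesis using that by blast
qed

text \<open>
  The type of test spaces plays no role: a test map restricts, without changing its image, to the
  closure of a set of chosen preimages, and the points of that closure are separated by the traces
  of their neighbourhoods on the chosen set.
\<close>

lemma small_test_space:
  fixes K :: "'k topology" and u :: "'k \<Rightarrow> 'a"
  assumes K: "compact_space K" "Hausdorff_space K"
  obtains L :: "'a set set topology" and j where "compact_space L" "Hausdorff_space L"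
    "continuous_map L K j" "u ` (j ` topspace L) = u ` topspace K"
proof -
  obtain D where D: "D \<subseteq> topspace K" "inj_on u D" "u ` D = u ` topspace K"
    by (metis subset_image_inj order_refl)
  define C where "C = K closure_of D"
  \<comment> \<open>As \<open>u\<close> is injective on \<open>D\<close>, a trace on
    \<open>D\<close> loses nothing when recorded as its image, a set of points of \<open>'a\<close>.
    A point of \<open>C\<close> becomes a set of such sets, whence the type
    \<open>'a set set\<close>.\<close>
  define enc where "enc k = {u ` (V \<inter> D) |V. openin K V \<and> k \<in> V}" for k
  have DC: "D \<subseteq> C" unfolding C_def by (rule closure_of_subset[OF D(1)])
  have CK: "C \<subseteq> topspace K" by (simp add: C_def closure_of_subset_topspace)
  have tC: "topspace (subtopology K C) = C" using CK by (auto simp: topspace_subtopology)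
  have inj: "inj_on enc C"
  proof (rule inj_onI, rule ccontr)
    fix k l assume kl: "k \<in> C" "l \<in> C" and e: "enc k = enc l" and ne: "k \<noteq> l"
    have "k \<in> topspace K" "l \<in> topspace K" using kl CK by auto
    then obtain V W where V: "openin K V" "k \<in> V" and W: "openin K W" "l \<in> W" and d: "disjnt V W"
      using K(2) ne unfolding Hausdorff_space_def by metis
    have "u ` (V \<inter> D) \<in> enc l" using e V by (auto simp: enc_def)
    then obtain V' where V': "openin K V'" "l \<in> V'" "u ` (V \<inter> D) = u ` (V' \<inter> D)"
      by (auto simp: enc_def)
    have eq: "V \<inter> D = V' \<inter> D"
      using V'(3) D(2) by (metis inf_le2 inj_on_image_eq_iff)
    \<comment> \<open>\<open>l\<close> lies in the closure of \<open>D\<close>, so its neighbourhood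
      \<open>V' \<inter> W\<close> meets \<open>D\<close>; by \<open>eq\<close> such a point lies in
      both \<open>V\<close> and \<open>W\<close>.\<close>
    have "openin K (V' \<inter> W)" "l \<in> V' \<inter> W" using V' W by auto
    then obtain d where "d \<in> D" "d \<in> V' \<inter> W"
      using kl(2) unfolding C_def in_closure_of by blast
    then show False using eq d by (auto simp: disjnt_iff)
  qed
  define L where "L = quotient_topology (subtopology K C) enc"
  have hom: "homeomorphic_map (subtopology K C) L enc"
    unfolding homeomorphic_map_def L_def by (simp only: quotient_map_quotient_topology tC inj simp_thms)
  then obtain j where j: "homeomorphic_maps (subtopology K C) L enc j"
    by (auto simp: homeomorphic_map_maps)
  have hs: "subtopology K C homeomorphic_space L" using j by (auto simp: homeomorphic_space_def)
  have "compact_space (subtopology K C)"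
    using K(1) by (simp add: C_def closedin_compact_space compact_space_subtopology)
  moreover have "Hausdorff_space (subtopology K C)" using K(2) by (rule Hausdorff_space_subtopology)
  moreover have "continuous_map L K j"
    using j by (meson continuous_map_into_fulltopology homeomorphic_maps_def)
  moreover have "j ` topspace L = C"
    using j tC by (metis homeomorphic_maps_map homeomorphic_imp_surjective_map)
  \<comment> \<open>The image of \<open>C\<close> under \<open>u\<close> lies between those of
    \<open>D\<close> and of \<open>topspace K\<close>, which are equal.\<close>
  ultimately show thesis
    using that hs homeomorphic_compact_space homeomorphic_Hausdorff_space D(3) DC CK
    by (metis image_mono subset_antisym)
qed

text \<open>The definition quantifies over test points of type \<open>'a set set\<close> alone; a
  test space of any other type is replaced by a small one with the same image.\<close>

lemma weak_hausdorff_closed_image: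
  fixes K :: "'k topology" and X :: "'a topology"
  assumes X: "weak_hausdorff X" and K: "compact_space K" "Hausdorff_space K" "continuous_map K X u"
  shows "closedin X (u ` topspace K)"
proof -
  obtain L :: "'a set set topology" and j where L: "compact_space L" "Hausdorff_space L"
    "continuous_map L K j" "u ` (j ` topspace L) = u ` topspace K"
    using small_test_space[OF K(1,2)] by blast
  have "closedin X ((u \<circ> j) ` topspace L)"
    using X L continuous_map_compose[OF L(3) K(3)] unfolding weak_hausdorff_def by blast
  then show ?thesis using L(4) by (simp add: image_comp)
qed

lemma weak_hausdorff_closed_image_closedin:
  assumes X: "weak_hausdorff X" and K: "compact_space K" "Hausdorff_space K" "continuous_map K X u"
    and C: "closedin K C"
  shows "closedin X (u ` C)"
proof -
  have "compact_space (subtopology K C)"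
    using K(1) C by (simp add: closedin_compact_space compact_space_subtopology)
  moreover have "topspace (subtopology K C) = C"
    using C closedin_subset by (auto simp: topspace_subtopology)
  ultimately show ?thesis
    using weak_hausdorff_closed_image[OF X _ Hausdorff_space_subtopology[OF K(2)]
      continuous_map_from_subtopology[OF K(3)]] by metis
qed

lemma weak_hausdorff_closedin_sing:
  assumes "weak_hausdorff X" "x \<in> topspace X"
  shows "closedin X {x}"
proof -
  have "continuous_map (discrete_topology {()}) X (\<lambda>_. x)" using assms(2) by simp
  moreover have "compact_space (discrete_topology {()})"
    by (simp add: compact_space_discrete_topology)
  ultimately have "closedin X ((\<lambda>_. x) ` topspace (discrete_topology {()}))"
    using weak_hausdorff_closed_image[OF assms(1)] Hausdorff_space_discrete_topology by blast
  then show ?thesis by simp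
qed

text \<open>Openness is transferred from the small test space \<open>L\<close> to \<open>K\<close>
  through closed images: the part of the common image lying outside \<open>U\<close> is closed in
  \<open>X\<close>, and the complement of that part pulls back along \<open>u\<close> to the
  preimage of \<open>U\<close>.\<close>

lemma weak_hausdorff_test_open:
  fixes K :: "'k topology" and X :: "'a topology"
  assumes X: "weak_hausdorff X" and U: "test_open TYPE('a set set) X U"
  shows "test_open TYPE('k) X U"
  unfolding test_open_def
proof (intro conjI allI impI)
  show "U \<subseteq> topspace X" using U by (simp add: test_open_def)
  fix K :: "'k topology" and u
  assume "compact_space K \<and> Hausdorff_space K \<and> continuous_map K X u"
  then have K: "compact_space K" "Hausdorff_space K" "continuous_map K X u" by auto
  obtain L :: "'a set set topology" and j where L: "compact_space L" "Hausdorff_space L"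
    "continuous_map L K j" "u ` (j ` topspace L) = u ` topspace K"
    using small_test_space[OF K(1,2)] by blast
  have uj: "continuous_map L X (u \<circ> j)" using continuous_map_compose[OF L(3) K(3)] .
  have "openin L {l \<in> topspace L. (u \<circ> j) l \<in> U}"
    using U L uj unfolding test_open_def by blast
  then have "closedin L (topspace L - {l \<in> topspace L. (u \<circ> j) l \<in> U})" by blast
  then have "closedin X ((u \<circ> j) ` (topspace L - {l \<in> topspace L. (u \<circ> j) l \<in> U}))" (is "closedin X ?S")
    by (rule weak_hausdorff_closed_image_closedin[OF X L(1,2) uj])
  then have "openin K {k \<in> topspace K. u k \<in> topspace X - ?S}"
    using K(3) by (intro openin_continuous_map_preimage) auto
  moreover have "?S = u ` (j ` topspace L) - U" by (auto simp: image_iff)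
  then have "?S = u ` topspace K - U" by (simp only: L(4))
  then have "{k \<in> topspace K. u k \<in> topspace X - ?S} = {k \<in> topspace K. u k \<in> U}"
    using continuous_map_image_subset_topspace[OF K(3)] by auto
  ultimately show "openin K {k \<in> topspace K. u k \<in> U}" by simp
qed

lemma weak_hausdorff_compactly_generated:
  fixes X :: "'a topology"
  assumes "weak_hausdorff X" "generated_by TYPE('k) X"
  shows "compactly_generated X"
  using assms weak_hausdorff_test_open[where ?'k = 'k]
  unfolding compactly_generated_iff generated_by_def by blast

text \<open>The diagonal of \<open>X\<close> need not be closed in the product topology, so
  compactness of \<open>K\<close> takes its place. If \<open>u k \<noteq> v l\<close>, then, points
  being closed, \<open>k\<close> has a closed neighbourhood \<open>C\<close> whose image misses
  \<open>v l\<close>; that image is closed, and its complement pulls back to a neighbourhood of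
  \<open>l\<close>.\<close>

lemma weak_hausdorff_coincidence:
  assumes X: "weak_hausdorff X" and K: "compact_space K" "Hausdorff_space K" "continuous_map K X u"
    and L: "continuous_map L X v"
  shows "closedin (prod_topology K L) {(k, l). k \<in> topspace K \<and> l \<in> topspace L \<and> u k = v l}"
    (is "closedin ?P ?E")
proof -
  have "\<exists>T. openin ?P T \<and> p \<in> T \<and> T \<subseteq> topspace ?P - ?E" if p: "p \<in> topspace ?P - ?E" for p
  proof -
    obtain k l where kl: "p = (k, l)" "k \<in> topspace K" "l \<in> topspace L" "u k \<noteq> v l"
      using p by auto
    have vl: "v l \<in> topspace X" using L kl(3) by (simp add: continuous_map_def Pi_iff)
    have "closedin K {x \<in> topspace K. u x \<in> {v l}}"
      by (rule closedin_continuous_map_preimage[OF K(3) weak_hausdorff_closedin_sing[OF X vl]])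
    then have "openin K (topspace K - {x \<in> topspace K. u x \<in> {v l}})" by blast
    moreover have "k \<in> topspace K - {x \<in> topspace K. u x \<in> {v l}}" using kl by auto
    ultimately obtain P C where P: "openin K P" "closedin K C" "k \<in> P" "P \<subseteq> C"
        "C \<subseteq> topspace K - {x \<in> topspace K. u x \<in> {v l}}"
      by (rule compact_Hausdorff_closed_nbhd[OF K(1,2)])
    have "closedin X (u ` C)" by (rule weak_hausdorff_closed_image_closedin[OF X K P(2)])
    then have Q: "openin L {y \<in> topspace L. v y \<in> topspace X - u ` C}" (is "openin L ?Q")
      using L by (intro openin_continuous_map_preimage) auto
    have "l \<in> ?Q" using vl kl(3) P(5) by force
    then have "openin ?P (P \<times> ?Q)" "p \<in> P \<times> ?Q" using P(1,3) Q kl(1) by (auto simp: openin_prod_Times_iff)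
    moreover have "u a \<noteq> v b" if "a \<in> P" "v b \<notin> u ` C" for a b using P(4) that by (metis imageI subsetD)
    then have "P \<times> ?Q \<subseteq> topspace ?P - ?E" using openin_subset[OF P(1)] by auto
    ultimately show ?thesis by blast
  qed
  then have "openin ?P (topspace ?P - ?E)" by (subst openin_subopen) blast
  moreover have "?E \<subseteq> topspace ?P" by auto
  ultimately show ?thesis by (simp add: closedin_def)
qed

text \<open>
  A test map \<open>u\<close> has closed image because the preimage of its image under another test map is a
  projection, along a compact space, of coincidence sets in the targets of the maps \<open>f\<close>.
\<close>

lemma weak_hausdorff_quotient:
  fixes X :: "'a topology" and Y :: "'b topology"
  assumes X: "generated_by TYPE('k) X" and q: "quotient_map X Y q" and I: "I \<noteq> {}"
    and f: "\<And>i. i \<in> I \<Longrightarrow> continuous_map Y (Z i) (f i) \<and> weak_hausdorff (Z i)"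
    and sep: "\<And>y y'. y \<in> topspace Y \<Longrightarrow> y' \<in> topspace Y \<Longrightarrow> (\<And>i. i \<in> I \<Longrightarrow> f i y = f i y') \<Longrightarrow> y = y'"
  shows "weak_hausdorff Y"
  unfolding weak_hausdorff_def
proof (intro allI impI)
  fix K :: "'b set set topology" and u
  assume "compact_space K \<and> Hausdorff_space K \<and> continuous_map K Y u"
  then have K: "compact_space K" "Hausdorff_space K" "continuous_map K Y u" by auto
  have uY: "u ` topspace K \<subseteq> topspace Y" using K(3) continuous_map_image_subset_topspace by blast
  have "test_open TYPE('k) X {x \<in> topspace X. q x \<notin> u ` topspace K}"
    unfolding test_open_def
  proof (intro conjI allI impI)
    fix L :: "'k topology" and v
    assume "compact_space L \<and> Hausdorff_space L \<and> continuous_map L X v"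
    then have L: "continuous_map L X v" by auto
    have qv: "continuous_map L Y (q \<circ> v)"
      using continuous_map_compose[OF L quotient_imp_continuous_map[OF q]] .
    let ?E = "\<lambda>i. {(k, l). k \<in> topspace K \<and> l \<in> topspace L \<and> (f i \<circ> u) k = (f i \<circ> (q \<circ> v)) l}"
    have "closedin (prod_topology K L) (?E i)" if "i \<in> I" for i
    proof (rule weak_hausdorff_coincidence[OF _ K(1,2)])
      show "weak_hausdorff (Z i)" using f[OF that] ..
      show "continuous_map K (Z i) (f i \<circ> u)" "continuous_map L (Z i) (f i \<circ> (q \<circ> v))"
        using f[OF that] continuous_map_compose[OF K(3)] continuous_map_compose[OF qv] by blast+
    qed
    \<comment> \<open>The intersection is formed before projecting, so that a single
      \<open>k\<close> agrees with \<open>l\<close> under all \<open>f i\<close> at once; only then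
      does \<open>sep\<close> give \<open>q (v l) = u k\<close>.\<close>
    then have "closedin (prod_topology K L) (\<Inter>i\<in>I. ?E i)" using I by (intro closedin_INT) auto
    then have "closedin L (snd ` (\<Inter>i\<in>I. ?E i))"
      using Abstract_Topological_Spaces.closed_map_snd[OF K(1)] unfolding closed_map_def by blast
    moreover have "snd ` (\<Inter>i\<in>I. ?E i) = {l \<in> topspace L. q (v l) \<in> u ` topspace K}" (is "?A = ?B")
    proof
      show "?A \<subseteq> ?B"
      proof
        fix l assume "l \<in> ?A"
        then obtain k where k: "\<And>i. i \<in> I \<Longrightarrow> (k, l) \<in> ?E i" by fastforce
        then have kl: "k \<in> topspace K" "l \<in> topspace L" using I by auto
        have "q (v l) = u k"
          using k kl uY continuous_map_image_subset_topspace[OF qv] by (intro sep) (auto simp: image_subset_iff)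
        then show "l \<in> ?B" using kl by auto
      qed
      show "?B \<subseteq> ?A"
      proof
        fix l assume "l \<in> ?B"
        then obtain k where "l \<in> topspace L" "k \<in> topspace K" "q (v l) = u k" by auto
        then have "(k, l) \<in> (\<Inter>i\<in>I. ?E i)" by auto
        then show "l \<in> ?A" by force
      qed
    qed
    ultimately have "openin L (topspace L - {l \<in> topspace L. q (v l) \<in> u ` topspace K})" by auto
    then show "openin L {l \<in> topspace L. v l \<in> {x \<in> topspace X. q x \<notin> u ` topspace K}}"
      using continuous_map_image_subset_topspace[OF L]
      by (elim back_subst[where P = "openin L"]) auto
  qed auto
  then have "openin X {x \<in> topspace X. q x \<notin> u ` topspace K}"
    using X by (simp add: generated_by_def)
  also have "{x \<in> topspace X. q x \<notin> u ` topspace K}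
      = {x \<in> topspace X. q x \<in> topspace Y - u ` topspace K}"
    using quotient_imp_surjective_map[OF q] by auto
  finally have "openin Y (topspace Y - u ` topspace K)"
    using q unfolding quotient_map_def by blast
  then show "closedin Y (u ` topspace K)" using uY by (simp add: closedin_def)
qed

text \<open>Let \<open>(x, b)\<close> lie outside the image of \<open>u\<close>. The part of
  \<open>K\<close> over \<open>x\<close> is compact, so its second coordinates form a closed set
  missing \<open>b\<close>, and some closed neighbourhood \<open>C\<close> of \<open>b\<close>
  avoids it. The part of \<open>K\<close> over \<open>C\<close> has closed image in \<open>X\<close>
  not containing \<open>x\<close>; removing this image leaves an open box around
  \<open>(x, b)\<close>.\<close>

lemma weak_hausdorff_prod:
  fixes X :: "'a topology" and B :: "'b topology"
  assumes X: "weak_hausdorff X" and B: "compact_space B" "Hausdorff_space B"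
  shows "weak_hausdorff (prod_topology X B)"
  unfolding weak_hausdorff_def
proof (intro allI impI)
  fix K :: "('a \<times> 'b) set set topology" and u
  let ?P = "prod_topology X B"
  assume "compact_space K \<and> Hausdorff_space K \<and> continuous_map K ?P u"
  then have K: "compact_space K" "Hausdorff_space K" and u: "continuous_map K ?P u" by auto
  have u1: "continuous_map K X (fst \<circ> u)" and u2: "continuous_map K B (snd \<circ> u)"
    using u by (auto simp: continuous_map_pairwise)
  have uP: "u ` topspace K \<subseteq> topspace ?P" using u continuous_map_image_subset_topspace by blast
  have "\<exists>T. openin ?P T \<and> p \<in> T \<and> T \<subseteq> topspace ?P - u ` topspace K"
    if p: "p \<in> topspace ?P - u ` topspace K" for p
  proof -
    obtain x b where xb: "p = (x, b)" "x \<in> topspace X" "b \<in> topspace B" using p by auto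
    let ?F = "{k \<in> topspace K. (fst \<circ> u) k \<in> {x}}"
    have "closedin K ?F"
      by (rule closedin_continuous_map_preimage[OF u1 weak_hausdorff_closedin_sing[OF X xb(2)]])
    then have "compactin B ((snd \<circ> u) ` ?F)"
      using K(1) closedin_compact_space image_compactin[OF _ u2] by blast
    then have "closedin B ((snd \<circ> u) ` ?F)" using B(2) compactin_imp_closedin by blast
    then have op: "openin B (topspace B - (snd \<circ> u) ` ?F)" by blast
    have "b \<in> topspace B - (snd \<circ> u) ` ?F"
    proof -
      have "b \<notin> (snd \<circ> u) ` ?F"
      proof
        assume "b \<in> (snd \<circ> u) ` ?F"
        then obtain k where "k \<in> topspace K" "fst (u k) = x" "snd (u k) = b" by auto
        then have "p \<in> u ` topspace K" using xb(1) by (metis image_eqI prod.collapse)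
        then show False using p by blast
      qed
      then show ?thesis using xb by blast
    qed
    with op obtain N C where N: "openin B N" "closedin B C" "b \<in> N" "N \<subseteq> C"
        "C \<subseteq> topspace B - (snd \<circ> u) ` ?F"
      by (rule compact_Hausdorff_closed_nbhd[OF B])
    have cl: "closedin X ((fst \<circ> u) ` {k \<in> topspace K. (snd \<circ> u) k \<in> C})" (is "closedin X ?S")
      by (rule weak_hausdorff_closed_image_closedin[OF X K u1 closedin_continuous_map_preimage[OF u2 N(2)]])
    have "x \<notin> ?S"
    proof
      assume "x \<in> ?S"
      then obtain k where "k \<in> ?F" "(snd \<circ> u) k \<in> C" by auto
      then show False using N(5) by blast
    qed
    then have "openin ?P ((topspace X - ?S) \<times> N)" "p \<in> (topspace X - ?S) \<times> N"
      using cl N xb by (auto simp: openin_prod_Times_iff)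
    moreover have "(topspace X - ?S) \<times> N \<subseteq> topspace ?P - u ` topspace K"
    proof
      fix z assume z: "z \<in> (topspace X - ?S) \<times> N"
      have "z \<noteq> u k" if "k \<in> topspace K" for k
      proof
        assume e: "z = u k"
        then have "k \<in> {k \<in> topspace K. (snd \<circ> u) k \<in> C}" using z N(4) that by auto
        then have "(fst \<circ> u) k \<in> ?S" by (rule imageI)
        moreover have "fst z \<notin> ?S" using z unfolding mem_Times_iff Diff_iff by blast
        ultimately show False using e by simp
      qed
      moreover have "z \<in> topspace ?P" using z openin_subset[OF N(1)] by auto
      ultimately show "z \<in> topspace ?P - u ` topspace K" by blast
    qed
    ultimately show ?thesis by blast
  qed
  then have "openin ?P (topspace ?P - u ` topspace K)" by (subst openin_subopen) blast
  then show "closedin ?P (u ` topspace K)" using uP by (simp add: closedin_def)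
qed

text \<open>
  Kification is invisible for products with a compact Hausdorff space: the set of all \<open>y\<close> with
  \<open>{y} \<times> C \<subseteq> U\<close>, for \<open>C\<close> compact, is test open by the tube lemma.
\<close>

lemma compactly_generated_prod:
  fixes X :: "'a topology" and B :: "'b topology"
  assumes X: "compactly_generated X" "weak_hausdorff X" and B: "compact_space B" "Hausdorff_space B"
  shows "compactly_generated (prod_topology X B)"
  unfolding compactly_generated_iff generated_by_def
proof (intro allI impI)
  let ?P = "prod_topology X B"
  fix U assume small: "test_open TYPE(('a \<times> 'b) set set) ?P U"
  have UP: "U \<subseteq> topspace ?P" using small by (simp add: test_open_def)
  \<comment> \<open>\<open>W\<close> stays polymorphic in the type of test points: it is used both
    for \<open>B\<close> itself and for products of \<open>B\<close> with a test space of
    \<open>X\<close>.\<close>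
  note W = weak_hausdorff_test_open[OF weak_hausdorff_prod[OF X(2) B] small]
  have "\<exists>T. openin ?P T \<and> p \<in> T \<and> T \<subseteq> U" if "p \<in> U" for p
  proof -
    have "p \<in> topspace X \<times> topspace B" using UP that by auto
    then obtain x b where p: "p = (x, b)" "x \<in> topspace X" "b \<in> topspace B" by blast
    have "openin B {c \<in> topspace B. (x, c) \<in> U}"
    proof -
      have "continuous_map B ?P (\<lambda>c. (x, c))" using p by (simp add: continuous_map_pairwise o_def)
      then show ?thesis using W[where ?'k = 'b] B unfolding test_open_def by blast
    qed
    moreover have "b \<in> {c \<in> topspace B. (x, c) \<in> U}" using p that by simp
    ultimately obtain N C where N: "openin B N" "closedin B C" "b \<in> N" "N \<subseteq> C"
        "C \<subseteq> {c \<in> topspace B. (x, c) \<in> U}"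
      by (rule compact_Hausdorff_closed_nbhd[OF B])
    have CB: "C \<subseteq> topspace B" using N(2) closedin_subset by blast
    let ?V = "{y \<in> topspace X. {y} \<times> C \<subseteq> U}"
    have "test_open TYPE('a set set) X ?V"
      unfolding test_open_def
    proof (intro conjI allI impI)
      fix K :: "'a set set topology" and u
      assume "compact_space K \<and> Hausdorff_space K \<and> continuous_map K X u"
      then have K: "compact_space K" "Hausdorff_space K" "continuous_map K X u" by auto
      let ?Q = "prod_topology K B"
      have "compact_space ?Q \<and> Hausdorff_space ?Q"
        using K B by (simp add: compact_space_prod_topology Hausdorff_space_prod_topology)
      moreover have "continuous_map ?Q ?P (\<lambda>(k, c). (u k, c))"
        unfolding case_prod_beta
        by (intro continuous_map_pairedI continuous_map_snd
            continuous_map_compose[OF continuous_map_fst K(3), unfolded o_def])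
      ultimately have "openin ?Q {z \<in> topspace ?Q. (\<lambda>(k, c). (u k, c)) z \<in> U}" (is "openin ?Q ?O")
        using W[where ?'k = "'a set set \<times> 'b"] unfolding test_open_def by blast
      then have "closedin ?Q (topspace ?Q - ?O)" by blast
      moreover have "closedin ?Q (topspace K \<times> C)" using N(2) by (simp add: closedin_prod_Times_iff)
      ultimately have "closedin ?Q ((topspace ?Q - ?O) \<inter> (topspace K \<times> C))" by blast
      then have "closedin K (fst ` ((topspace ?Q - ?O) \<inter> (topspace K \<times> C)))" (is "closedin K ?A")
        using Abstract_Topological_Spaces.closed_map_fst[OF B(1)] unfolding closed_map_def by blast
      then have "openin K (topspace K - ?A)" by blast
      moreover have "topspace K - ?A = {k \<in> topspace K. u k \<in> ?V}"
      proof -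
        have "k \<in> ?A \<longleftrightarrow> (\<exists>c\<in>C. (u k, c) \<notin> U)" if "k \<in> topspace K" for k
          using that CB by (auto simp: image_iff Bex_def)
        then show ?thesis using continuous_map_image_subset_topspace[OF K(3)] by auto
      qed
      ultimately show "openin K {k \<in> topspace K. u k \<in> ?V}" by simp
    qed auto
    then have "openin X ?V" using X(1) by (simp add: compactly_generated_iff generated_by_def)
    then have "openin ?P (?V \<times> N)" using N by (simp add: openin_prod_Times_iff)
    moreover have "p \<in> ?V \<times> N" using p N by auto
    moreover have "?V \<times> N \<subseteq> U" using N(4) by auto
    ultimately show ?thesis by blast
  qed
  then show "openin ?P U" by (subst openin_subopen) blast
qed

text \<open>Functor actions have the compact mapping space as first factor, the integrand of the Kan
  extension has it as second. Since swapping changes the type of points and thus of test spaces,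
  weak Hausdorffness is transported as well and used to change the test type.\<close>

lemma compactly_generated_prod_swap:
  fixes X :: "'a topology" and B :: "'b topology"
  assumes X: "compactly_generated X" "weak_hausdorff X" and B: "compact_space B" "Hausdorff_space B"
  shows "compactly_generated (prod_topology B X)"
proof -
  have hom: "homeomorphic_map (prod_topology X B) (prod_topology B X) prod.swap"
    unfolding homeomorphic_map_maps homeomorphic_maps_def
    by (rule exI[of _ prod.swap]) (auto simp: prod.swap_def continuous_map_pairwise o_def
        intro: continuous_map_fst continuous_map_snd)
  then have q: "quotient_map (prod_topology X B) (prod_topology B X) prod.swap"
    by (simp add: homeomorphic_map_def)
  have gen: "generated_by TYPE(('a \<times> 'b) set set) (prod_topology X B)"
    using compactly_generated_prod[OF X B] by (simp add: compactly_generated_iff)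
  have "weak_hausdorff (prod_topology B X)"
  proof (rule weak_hausdorff_quotient[OF gen q, where I = "{()}" and f = "\<lambda>_. prod.swap"
        and Z = "\<lambda>_. prod_topology X B"])
    show "continuous_map (prod_topology B X) (prod_topology X B) prod.swap \<and>
        weak_hausdorff (prod_topology X B)"
      using weak_hausdorff_prod[OF X(2) B]
      by (auto simp: prod.swap_def continuous_map_pairwise o_def
          intro: continuous_map_fst continuous_map_snd)
  qed auto
  then show ?thesis
    using weak_hausdorff_compactly_generated generated_by_quotient[OF gen q] by blast
qed

section \<open>Smash products and coends\<close>

lemma pt_smash [simp]: "pt (smash X Y) = (pt X, pt Y)"
  by (simp add: smash_def)

lemma pts_smash: "pts (smash X Y) = smash_pt X Y ` (pts X \<times> pts Y)"
  by (simp add: smash_def)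

lemma smash_pt_idem [simp]: "smash_pt X Y (smash_pt X Y p) = smash_pt X Y p"
  by (simp add: smash_pt_def)

lemma smash_pt_based [simp]:
  "smash_pt X Y (pt X, y) = (pt X, pt Y)" "smash_pt X Y (x, pt Y) = (pt X, pt Y)"
  by (simp_all add: smash_pt_def)

lemma pts_smashD:
  assumes "z \<in> pts (smash X Y)" "pt X \<in> pts X" "pt Y \<in> pts Y"
  shows "z \<in> pts X \<times> pts Y" "smash_pt X Y z = z"
proof -
  obtain p where p: "p \<in> pts X \<times> pts Y" "z = smash_pt X Y p" using assms(1) by (auto simp: pts_smash)
  show "z \<in> pts X \<times> pts Y" using p assms(2,3) by (auto simp: smash_pt_def)
  show "smash_pt X Y z = z" using p by simp
qed

lemma smash_pt_factor:
  assumes "\<And>x. x \<in> pts X \<Longrightarrow> f (x, pt Y) = z" "\<And>y. y \<in> pts Y \<Longrightarrow> f (pt X, y) = z"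
    and "pt X \<in> pts X" "p \<in> pts X \<times> pts Y"
  shows "f (smash_pt X Y p) = f p"
proof (cases "fst p = pt X \<or> snd p = pt Y")
  case True
  have p: "p = (fst p, snd p)" "fst p \<in> pts X" "snd p \<in> pts Y" using assms(4) by auto
  have "f p = z" using True assms(1,2) p by metis
  moreover have "f (pt X, pt Y) = z" using assms(1,3) by blast
  ultimately show ?thesis using True by (simp add: smash_pt_def)
qed (auto simp: smash_pt_def)

text \<open>Kification only adds open sets, so continuity for the plain product topology suffices;
  being constant on the wedge, the map factors through the collapse.\<close>

lemma continuous_map_smash:
  assumes "continuous_map (prod_topology (sp X) (sp Y)) Z f"
    and "\<And>x. x \<in> pts X \<Longrightarrow> f (x, pt Y) = z" "\<And>y. y \<in> pts Y \<Longrightarrow> f (pt X, y) = z"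
    and "pt X \<in> pts X"
  shows "continuous_map (sp (smash X Y)) Z f"
proof -
  let ?P = "kify (prod_topology (sp X) (sp Y))"
  have q: "quotient_map ?P (sp (smash X Y)) (smash_pt X Y)"
    by (simp add: smash_def quotient_map_quotient_topology)
  have "continuous_map ?P Z (f \<circ> smash_pt X Y)"
    by (rule continuous_map_eq[OF continuous_map_from_kify[OF assms(1)]])
       (simp only: o_apply topspace_kify topspace_prod_topology
         smash_pt_factor[where f = f, OF assms(2,3,4)])
  then show ?thesis using continuous_compose_quotient_map[OF q] by blast
qed

text \<open>Here \<open>kify\<close> is eliminated, which makes results on plain products applicable
  to smash products.\<close>

lemma quotient_map_smash:
  assumes "compactly_generated (prod_topology (sp X) (sp Y))"
  shows "quotient_map (prod_topology (sp X) (sp Y)) (sp (smash X Y)) (smash_pt X Y)"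
  using assms quotient_map_quotient_topology
  by (simp add: smash_def compactly_generated_def)

lemma continuous_map_from_sum:
  assumes "\<And>i. i \<in> I \<Longrightarrow> continuous_map (X i) Z (\<lambda>x. f (i, x))"
  shows "continuous_map (sum_topology X I) Z f"
  unfolding continuous_map_def
proof (intro conjI allI impI)
  show "f \<in> topspace (sum_topology X I) \<rightarrow> topspace Z"
    using continuous_map_image_subset_topspace[OF assms] by (auto simp: image_subset_iff)
  fix U assume U: "openin Z U"
  have "openin (X i) {x \<in> topspace (X i). f (i, x) \<in> U}" if "i \<in> I" for i
    by (rule openin_continuous_map_preimage[OF assms[OF that] U])
  then show "openin (sum_topology X I) {p \<in> topspace (sum_topology X I). f p \<in> U}"
    by (auto simp: openin_sum_topology)
qed

text \<open>Summands are open in the sum, so boxes over a single summand are open in the product and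
  continuity can be checked there.\<close>

lemma continuous_map_prod_sum:
  assumes "\<And>i. i \<in> I \<Longrightarrow> continuous_map (prod_topology A (X i)) Z (\<lambda>(a, x). f (a, (i, x)))"
  shows "continuous_map (prod_topology A (sum_topology X I)) Z f"
  unfolding continuous_map_def
proof (intro conjI allI impI)
  show "f \<in> topspace (prod_topology A (sum_topology X I)) \<rightarrow> topspace Z"
  proof
    fix p assume "p \<in> topspace (prod_topology A (sum_topology X I))"
    then obtain a i x where p: "p = (a, (i, x))" "i \<in> I" "a \<in> topspace A" "x \<in> topspace (X i)" by auto
    show "f p \<in> topspace Z"
      using continuous_map_image_subset_topspace[OF assms[OF p(2)]] p by auto
  qed
  fix U assume U: "openin Z U"
  let ?P = "prod_topology A (sum_topology X I)"
  have "\<exists>T. openin ?P T \<and> p \<in> T \<and> T \<subseteq> {p \<in> topspace ?P. f p \<in> U}"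
    if pU: "p \<in> {p \<in> topspace ?P. f p \<in> U}" for p
  proof -
    obtain a i x where p: "p = (a, (i, x))" "i \<in> I" "a \<in> topspace A" "x \<in> topspace (X i)"
      using pU by auto
    let ?O = "{z \<in> topspace (prod_topology A (X i)). (\<lambda>(a, x). f (a, (i, x))) z \<in> U}"
    have "openin (prod_topology A (X i)) ?O"
      by (rule openin_continuous_map_preimage[OF assms[OF p(2)] U])
    moreover have "(a, x) \<in> ?O" using pU p by auto
    ultimately obtain V W where VW: "openin A V" "openin (X i) W" "a \<in> V" "x \<in> W" "V \<times> W \<subseteq> ?O"
      unfolding openin_prod_topology_alt by meson
    have "openin (sum_topology X I) ((\<lambda>x. (i, x)) ` W)"
      using open_map_component_injection[OF p(2)] VW(2) unfolding open_map_def by blast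
    then have "openin ?P (V \<times> (\<lambda>x. (i, x)) ` W)" using VW(1) by (simp add: openin_prod_Times_iff)
    moreover have "p \<in> V \<times> (\<lambda>x. (i, x)) ` W" using p VW by auto
    moreover have "V \<times> (\<lambda>x. (i, x)) ` W \<subseteq> {p \<in> topspace ?P. f p \<in> U}"
      using VW(5) p(2) by auto
    ultimately show ?thesis by blast
  qed
  then show "openin ?P {p \<in> topspace ?P. f p \<in> U}" by (subst openin_subopen) blast
qed

section \<open>The coend as a largest weak Hausdorff quotient\<close>

locale coend_data =
  fixes C :: "('o, 'm) tcat" and H :: "'o \<Rightarrow> 'o \<Rightarrow> 'b based" and l r :: "'o \<Rightarrow> 'o \<Rightarrow> 'm \<Rightarrow> 'b \<Rightarrow> 'b"
    and code :: "'o \<times> 'b \<Rightarrow> 'u"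
  assumes gen: "\<And>W. W \<in> Ob C \<Longrightarrow> generated_by TYPE('b set set) (sp (H W W))"
    and gen_sub: "coend_gen C H l r \<subseteq> topspace (coend_sum C H) \<times> topspace (coend_sum C H)"
    and code: "inj_on code (topspace (coend_sum C H))"
    and ob: "Ob C \<noteq> {}"
begin

abbreviation "S \<equiv> coend_sum C H"
abbreviation "rel \<equiv> coend_rel C H l r"
abbreviation "cls R \<equiv> quotient_topology S (\<lambda>p. R `` {p})"
abbreviation "pr \<equiv> coend_pr C H l r :: 'o \<times> 'b \<Rightarrow> 'u"
abbreviation "Y \<equiv> coend C H l r :: 'u based"

definition relations :: "(('o \<times> 'b) \<times> ('o \<times> 'b)) set set" where
  "relations = {R. equiv (topspace S) R \<and> coend_gen C H l r \<subseteq> R \<and> weak_hausdorff (cls R)}"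

lemma gen_S: "generated_by TYPE('b set set) S"
  unfolding coend_sum_def by (rule generated_by_sum) (rule gen)

text \<open>This is the source of the universal property: the kernel of a compatible map takes part
  in the intersection defining \<open>coend_rel\<close>. Its quotient maps continuously and
  injectively to \<open>Z\<close>, so \<open>weak_hausdorff_quotient\<close> applies with this one
  map.\<close>

lemma separated_in_relations:
  assumes f: "continuous_map S Z f" "weak_hausdorff Z"
    and g: "\<And>p q. (p, q) \<in> coend_gen C H l r \<Longrightarrow> f p = f q"
  shows "{(p, q). p \<in> topspace S \<and> q \<in> topspace S \<and> f p = f q} \<in> relations" (is "?R \<in> _")
proof -
  have eq: "equiv (topspace S) ?R"
    by (auto simp: equiv_def refl_on_def sym_def trans_def)
  let ?f = "\<lambda>c. f (SOME p. p \<in> c)"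
  have val: "?f (?R `` {p}) = f p" if "p \<in> topspace S" for p
  proof -
    have "p \<in> ?R `` {p}" using that by auto
    then have "(SOME q. q \<in> ?R `` {p}) \<in> ?R `` {p}" by (rule someI)
    then show ?thesis by auto
  qed
  have q: "quotient_map S (cls ?R) (\<lambda>p. ?R `` {p})" by (rule quotient_map_quotient_topology)
  have "continuous_map S Z (?f \<circ> (\<lambda>p. ?R `` {p}))"
    using val by (intro continuous_map_eq[OF f(1)]) (simp add: o_def)
  then have c: "continuous_map (cls ?R) Z ?f" using continuous_compose_quotient_map[OF q] by blast
  have "weak_hausdorff (cls ?R)"
  proof (rule weak_hausdorff_quotient[OF gen_S q, where I = "{()}" and f = "\<lambda>_. ?f" and Z = "\<lambda>_. Z"])
    show "continuous_map (cls ?R) Z ?f \<and> weak_hausdorff Z" using c f(2) by simp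
    fix y y' assume y: "y \<in> topspace (cls ?R)" "y' \<in> topspace (cls ?R)"
      and e: "\<And>i. i \<in> {()} \<Longrightarrow> ?f y = ?f y'"
    obtain p p' where p: "p \<in> topspace S" "p' \<in> topspace S" "y = ?R `` {p}" "y' = ?R `` {p'}"
      using y by auto
    have "f p = f p'" using e val p by simp
    then show "y = y'" using p by auto
  qed simp
  then show ?thesis using eq g gen_sub by (auto simp: relations_def)
qed

text \<open>The constant map to a point contributes the total relation. Without a member, the
  intersection would not even be a relation on \<open>topspace S\<close>.\<close>

lemma relations_nonempty: "relations \<noteq> {}"
proof -
  have "continuous_map S (discrete_topology {()}) (\<lambda>_. ())" by simp
  moreover have "weak_hausdorff (discrete_topology {()})"
    by (auto simp: weak_hausdorff_def)
  ultimately show ?thesis using separated_in_relations[where f = "\<lambda>_. ()"] by blast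
qed

lemma rel_eq: "rel = \<Inter>relations"
  by (simp add: coend_rel_def relations_def)

lemma equiv_rel: "equiv (topspace S) rel"
proof -
  have e: "equiv (topspace S) R" if "R \<in> relations" for R using that by (simp add: relations_def)
  show ?thesis
    unfolding rel_eq
  proof (rule equivI)
    obtain R where R: "R \<in> relations" using relations_nonempty by blast
    then have "R \<subseteq> topspace S \<times> topspace S" using e by (simp add: equiv_def)
    then show "\<Inter>relations \<subseteq> topspace S \<times> topspace S" using R by blast
    show "refl_on (topspace S) (\<Inter>relations)"
      using relations_nonempty e unfolding equiv_def refl_on_def by blast
    show "sym (\<Inter>relations)" using e unfolding equiv_def sym_def by blast
    show "trans (\<Inter>relations)" using e unfolding equiv_def trans_def by blast
  qed
qed

lemma pr_eq_iff:
  assumes "p \<in> topspace S" "q \<in> topspace S"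
  shows "pr p = pr q \<longleftrightarrow> (p, q) \<in> rel"
proof -
  define e where "e = (SOME e :: ('o \<times> 'b) set \<Rightarrow> 'u. inj_on e (topspace S // rel))"
  \<comment> \<open>Coding a chosen representative is one injective renaming of the classes, so the
    \<open>SOME\<close> in \<open>coend_pr\<close> selects an injective one too.\<close>
  have "inj_on (\<lambda>c. code (SOME p. p \<in> c)) (topspace S // rel)"
  proof (rule inj_onI)
    fix c d assume cd: "c \<in> topspace S // rel" "d \<in> topspace S // rel"
      and eq: "code (SOME p. p \<in> c) = code (SOME p. p \<in> d)"
    have "(SOME p. p \<in> c) \<in> c" "(SOME p. p \<in> d) \<in> d"
      using cd equiv_rel by (metis ex_in_conv in_quotient_imp_non_empty someI_ex)+
    moreover have "c \<subseteq> topspace S" "d \<subseteq> topspace S"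
      using cd equiv_rel by (meson in_quotient_imp_subset)+
    ultimately have "(SOME p. p \<in> c) = (SOME p. p \<in> d)" using inj_onD[OF code eq] by blast
    then have "c \<inter> d \<noteq> {}"
      using \<open>(SOME p. p \<in> c) \<in> c\<close> \<open>(SOME p. p \<in> d) \<in> d\<close> by auto
    then show "c = d" using quotient_disj[OF equiv_rel cd] by blast
  qed
  then have "inj_on e (topspace S // rel)" unfolding e_def
    by (rule someI[where P = "\<lambda>e. inj_on e (topspace S // rel)"])
  moreover have "rel `` {p} \<in> topspace S // rel" "rel `` {q} \<in> topspace S // rel"
    using assms by (auto intro: quotientI)
  ultimately have "pr p = pr q \<longleftrightarrow> rel `` {p} = rel `` {q}"
    unfolding coend_pr_def e_def[symmetric] by (simp add: inj_on_eq_iff)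
  also have "\<dots> \<longleftrightarrow> (p, q) \<in> rel"
    using equiv_class_eq_iff[OF equiv_rel] assms by blast
  finally show ?thesis .
qed

lemma pr_gen:
  assumes "(p, q) \<in> coend_gen C H l r"
  shows "pr p = pr q"
proof -
  have "(p, q) \<in> rel" using assms unfolding rel_eq relations_def by blast
  then show ?thesis using pr_eq_iff assms gen_sub by blast
qed

lemma pr_universal:
  assumes "continuous_map S Z f" "weak_hausdorff Z"
    and "\<And>p q. (p, q) \<in> coend_gen C H l r \<Longrightarrow> f p = f q"
    and "p \<in> topspace S" "q \<in> topspace S" "pr p = pr q"
  shows "f p = f q"
  using separated_in_relations[OF assms(1-3)] pr_eq_iff[OF assms(4,5)] assms(6)
  by (auto simp: rel_eq)

lemma quotient_map_pr: "quotient_map S (sp Y) pr"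
  by (simp add: coend_def quotient_map_quotient_topology)

lemma pts_coend: "pts Y = pr ` topspace S"
  by (simp add: coend_def)

lemma pt_coend: "W \<in> Ob C \<Longrightarrow> pt Y = pr (W, pt (H W W))"
proof -
  assume W: "W \<in> Ob C"
  let ?W = "SOME W. W \<in> Ob C"
  have "?W \<in> Ob C" using W by (rule someI)
  then have "((?W, pt (H ?W ?W)), (W, pt (H W W))) \<in> coend_gen C H l r"
    using W by (auto simp: coend_gen_def)
  then show ?thesis using pr_gen by (simp add: coend_def Let_def)
qed

text \<open>The maps to the quotients by the members of \<open>relations\<close> separate points: if
  all of them identify two points, the representatives are related by every \<open>R\<close>, hence
  by the intersection. They are defined through \<open>rep\<close> because \<open>pr\<close> has
  renamed the classes to points of \<open>'u\<close>.\<close>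

lemma based_space_coend: "based_space Y"
proof -
  define rep where "rep y = (SOME p. p \<in> topspace S \<and> pr p = y)" for y
  have rep: "rep (pr p) \<in> topspace S \<and> pr (rep (pr p)) = pr p" if "p \<in> topspace S" for p
    unfolding rep_def by (rule someI[of _ p]) (simp add: that)
  have eqv: "R `` {rep (pr p)} = R `` {p}" if "p \<in> topspace S" "R \<in> relations" for p R
  proof -
    have "(rep (pr p), p) \<in> rel" using rep[OF that(1)] pr_eq_iff that by blast
    then have "(rep (pr p), p) \<in> R" using that(2) unfolding rel_eq by blast
    then show ?thesis using that(2) by (intro equiv_class_eq) (auto simp: relations_def)
  qed
  have wh: "weak_hausdorff (sp Y)"
  proof (rule weak_hausdorff_quotient[OF gen_S quotient_map_pr relations_nonempty,
        where f = "\<lambda>R y. R `` {rep y}" and Z = cls])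
    fix R assume R: "R \<in> relations"
    have "continuous_map S (cls R) ((\<lambda>y. R `` {rep y}) \<circ> pr)"
      by (rule continuous_map_eq[OF quotient_imp_continuous_map[OF quotient_map_quotient_topology]])
         (use eqv R in simp)
    then show "continuous_map (sp Y) (cls R) (\<lambda>y. R `` {rep y}) \<and> weak_hausdorff (cls R)"
      using continuous_compose_quotient_map[OF quotient_map_pr] R by (auto simp: relations_def)
  next
    fix y y' assume "y \<in> pts Y" "y' \<in> pts Y" and e: "\<And>R. R \<in> relations \<Longrightarrow> R `` {rep y} = R `` {rep y'}"
    then obtain p p' where p: "p \<in> topspace S" "p' \<in> topspace S" "y = pr p" "y' = pr p'"
      by (auto simp: pts_coend)
    have "(p, p') \<in> R" if R: "R \<in> relations" for R
    proof -
      have "R `` {p} = R `` {p'}" using e[OF R] eqv[OF _ R] p by simp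
      moreover have "equiv (topspace S) R" using R by (simp add: relations_def)
      ultimately show ?thesis using p by (simp add: eq_equiv_class)
    qed
    then have "(p, p') \<in> rel" by (simp add: rel_eq)
    then show "y = y'" using pr_eq_iff p by simp
  qed
  obtain W where W: "W \<in> Ob C" using ob by blast
  then have "((W, pt (H W W)), (W, pt (H W W))) \<in> coend_gen C H l r"
    by (auto simp: coend_gen_def)
  then have "(W, pt (H W W)) \<in> topspace S" using gen_sub by blast
  then have "pt Y \<in> pts Y" using pt_coend[OF W] by (simp add: pts_coend)
  then show ?thesis
    using wh weak_hausdorff_compactly_generated[OF wh generated_by_quotient[OF gen_S quotient_map_pr]]
    by (simp add: based_space_def)
qed

end

section \<open>Functor categories and adjunctions\<close>

lemma enriched_functorD:
  assumes "enriched_functor C F"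
  shows "U \<in> Ob C \<Longrightarrow> based_space (obj F U)"
    and "U \<in> Ob C \<Longrightarrow> V \<in> Ob C \<Longrightarrow>
      based_map (smash (Hom C U V) (obj F U)) (obj F V) (\<lambda>(f, x). act F U V f x)"
    and "U \<in> Ob C \<Longrightarrow> V \<in> Ob C \<Longrightarrow> x \<in> pts (obj F U) \<Longrightarrow> act F U V (pt (Hom C U V)) x = pt (obj F V)"
    and "U \<in> Ob C \<Longrightarrow> V \<in> Ob C \<Longrightarrow> f \<in> pts (Hom C U V) \<Longrightarrow> act F U V f (pt (obj F U)) = pt (obj F V)"
    and "U \<in> Ob C \<Longrightarrow> x \<in> pts (obj F U) \<Longrightarrow> act F U U (Idt C U) x = x"
    and "U \<in> Ob C \<Longrightarrow> V \<in> Ob C \<Longrightarrow> W \<in> Ob C \<Longrightarrow> f \<in> pts (Hom C U V) \<Longrightarrow> g \<in> pts (Hom C V W) \<Longrightarrow>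
      x \<in> pts (obj F U) \<Longrightarrow> act F U W (Cmp C g f) x = act F V W g (act F U V f x)"
  using assms unfolding enriched_functor_def by blast+

lemma enriched_functor_pt: "enriched_functor C F \<Longrightarrow> U \<in> Ob C \<Longrightarrow> pt (obj F U) \<in> pts (obj F U)"
  using enriched_functorD(1)[of C F U] by (simp add: based_space_def)

text \<open>The structure map lives on the smash product, which contains no pair of the wedge except
  the base pair; on the wedge the value is supplied by the clauses on base points.\<close>

lemma enriched_functor_act:
  assumes F: "enriched_functor C F" and UV: "U \<in> Ob C" "V \<in> Ob C"
    and f: "f \<in> pts (Hom C U V)" and x: "x \<in> pts (obj F U)"
  shows "act F U V f x \<in> pts (obj F V)"
proof (cases "f = pt (Hom C U V) \<or> x = pt (obj F U)")
  case True
  then show ?thesis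
    using enriched_functorD(3,4)[OF F UV] enriched_functor_pt[OF F UV(2)] f x by auto
next
  case False
  then have "(f, x) = smash_pt (Hom C U V) (obj F U) (f, x)" by (simp add: smash_pt_def)
  then have "(f, x) \<in> pts (smash (Hom C U V) (obj F U))" using f x by (simp add: pts_smash)
  then show ?thesis
    using enriched_functorD(2)[OF F UV] continuous_map_image_subset_topspace
    by (fastforce simp: based_map_def)
qed

lemma natural_transformationI:
  assumes "enriched_functor C E" "enriched_functor C F"
    and "\<And>V. V \<in> Ob C \<Longrightarrow> continuous_map (sp (obj E V)) (sp (obj F V)) (\<alpha> V)"
    and "\<And>V. V \<in> Ob C \<Longrightarrow> \<alpha> V (pt (obj E V)) = pt (obj F V)"
    and "\<And>U V f x. U \<in> Ob C \<Longrightarrow> V \<in> Ob C \<Longrightarrow> f \<in> pts (Hom C U V) \<Longrightarrow> x \<in> pts (obj E U) \<Longrightarrow>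
      \<alpha> V (act E U V f x) = act F U V f (\<alpha> U x)"
  shows "natural_transformation C (E, F, \<lambda>V\<in>Ob C. \<lambda>x\<in>pts (obj E V). \<alpha> V x)"
  using assms enriched_functor_pt[OF assms(1)] enriched_functor_act[OF assms(1)]
  unfolding natural_transformation_def based_map_def
  by (auto intro: continuous_map_eq[OF assms(3)])

lemma natural_transformationD:
  assumes "natural_transformation C (E, F, \<alpha>)"
  shows "enriched_functor C E" "enriched_functor C F" "\<alpha> \<in> extensional (Ob C)"
    and "V \<in> Ob C \<Longrightarrow> \<alpha> V \<in> extensional (pts (obj E V))"
    and "V \<in> Ob C \<Longrightarrow> continuous_map (sp (obj E V)) (sp (obj F V)) (\<alpha> V)"
    and "V \<in> Ob C \<Longrightarrow> \<alpha> V (pt (obj E V)) = pt (obj F V)"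
    and "V \<in> Ob C \<Longrightarrow> x \<in> pts (obj E V) \<Longrightarrow> \<alpha> V x \<in> pts (obj F V)"
    and "U \<in> Ob C \<Longrightarrow> V \<in> Ob C \<Longrightarrow> f \<in> pts (Hom C U V) \<Longrightarrow> x \<in> pts (obj E U) \<Longrightarrow>
      \<alpha> V (act E U V f x) = act F U V f (\<alpha> U x)"
  using assms unfolding natural_transformation_def based_map_def continuous_map_def by auto

lemma components_eqI:
  assumes "natural_transformation C (E, F, \<alpha>)"
    and "\<And>V x. V \<in> Ob C \<Longrightarrow> x \<in> pts (obj E V) \<Longrightarrow> \<beta> V x = \<alpha> V x"
  shows "(\<lambda>V\<in>Ob C. \<lambda>x\<in>pts (obj E V). \<beta> V x) = \<alpha>"
proof
  fix V
  show "(\<lambda>V\<in>Ob C. \<lambda>x\<in>pts (obj E V). \<beta> V x) V = \<alpha> V"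
  proof (cases "V \<in> Ob C")
    case True
    then show ?thesis
      using assms(2) natural_transformationD(4)[OF assms(1) True] by (auto simp: extensional_def)
  next
    case False
    then show ?thesis
      using extensional_arb[OF natural_transformationD(3)[OF assms(1)] False] by simp
  qed
qed

lemma homset_functor_category:
  "a \<in> homset (functor_category C) E F \<longleftrightarrow> (\<exists>\<alpha>. a = (E, F, \<alpha>) \<and> natural_transformation C (E, F, \<alpha>))"
  by (cases a) (auto simp: homset_def functor_category_def)

lemma compo_functor_category [simp]:
  "compo (functor_category C) (F', G, \<beta>) (E, F, \<alpha>) =
     (E, G, \<lambda>V\<in>Ob C. \<lambda>x\<in>pts (obj E V). \<beta> V (\<alpha> V x))"
  by (simp add: functor_category_def)

lemma ident_functor_category [simp]:
  "ident (functor_category C) F = (F, F, \<lambda>V\<in>Ob C. \<lambda>x\<in>pts (obj F V). x)"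
  by (simp add: functor_category_def)

lemma objs_functor_category [simp]: "objs (functor_category C) = {F. enriched_functor C F}"
  by (simp add: functor_category_def)

lemma natural_transformation_compo:
  assumes a: "natural_transformation C (E, F, \<alpha>)" and b: "natural_transformation C (F, G, \<beta>)"
  shows "natural_transformation C (E, G, \<lambda>V\<in>Ob C. \<lambda>x\<in>pts (obj E V). \<beta> V (\<alpha> V x))"
proof (rule natural_transformationI)
  fix V assume V: "V \<in> Ob C"
  show "continuous_map (sp (obj E V)) (sp (obj G V)) (\<lambda>x. \<beta> V (\<alpha> V x))"
    using continuous_map_compose[OF natural_transformationD(5)[OF a V] natural_transformationD(5)[OF b V]]
    by (simp add: o_def)
qed (simp_all add: natural_transformationD[OF a] natural_transformationD[OF b])

lemma natural_transformation_ident: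
  assumes "enriched_functor C F"
  shows "natural_transformation C (F, F, \<lambda>V\<in>Ob C. \<lambda>x\<in>pts (obj F V). x)"
  using assms by (intro natural_transformationI) auto

lemma is_category_functor_category: "is_category (functor_category C)"
  unfolding is_category_def
proof (intro conjI ballI allI)
  fix f assume "f \<in> arrs (functor_category C)"
  then show "source (functor_category C) f \<in> objs (functor_category C)"
    "target (functor_category C) f \<in> objs (functor_category C)"
    by (auto simp: functor_category_def natural_transformation_def)
next
  fix a assume "a \<in> objs (functor_category C)"
  then show "ident (functor_category C) a \<in> homset (functor_category C) a a"
    by (simp add: homset_functor_category natural_transformation_ident)
next
  fix a b c f g assume "f \<in> homset (functor_category C) a b" "g \<in> homset (functor_category C) b c"
  then show "compo (functor_category C) g f \<in> homset (functor_category C) a c"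
    by (auto simp: homset_functor_category natural_transformation_compo)
next
  fix a b f assume "f \<in> homset (functor_category C) a b"
  then obtain \<alpha> where f: "f = (a, b, \<alpha>)" "natural_transformation C (a, b, \<alpha>)"
    by (auto simp: homset_functor_category)
  then show "compo (functor_category C) f (ident (functor_category C) a) = f"
    "compo (functor_category C) (ident (functor_category C) b) f = f"
    using natural_transformationD(7)[OF f(2)] by (auto intro!: components_eqI[OF f(2)])
next
  fix a b c d f g h
  assume "f \<in> homset (functor_category C) a b" "g \<in> homset (functor_category C) b c"
    "h \<in> homset (functor_category C) c d"
  then show "compo (functor_category C) h (compo (functor_category C) g f) =
      compo (functor_category C) (compo (functor_category C) h g) f"
    by (auto simp: homset_functor_category natural_transformationD(7) intro!: restrict_ext)
qed

text \<open>A lifting problem for \<open>farr L i\<close> against \<open>p\<close> is transposed to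
  one for \<open>i\<close> against \<open>farr R p\<close>. Its solution comes back by surjectivity
  of \<open>\<phi>\<close>, and the two triangles commute by injectivity of \<open>\<phi>\<close>.
  Stated for bare categories, so that it applies to \<open>functor_category\<close>.\<close>

lemma left_adjoint_has_lifting:
  assumes cM: "is_category M" and cN: "is_category N" and A: "adjunction M N L R"
    and i: "i \<in> arrs M" and p: "p \<in> arrs N" and lift: "has_lifting M i (farr R p)"
  shows "has_lifting N (farr L i) p"
proof -
  note CM = cM[unfolded is_category_def] and CN = cN[unfolded is_category_def]
  have L: "is_functor M N L" and R: "is_functor N M R"
    using A by (simp_all add: adjunction_def)
  obtain \<phi> where
    bij: "\<And>a b. a \<in> objs M \<Longrightarrow> b \<in> objs N \<Longrightarrow>
              bij_betw (\<phi> a b) (homset N (fobj L a) b) (homset M a (fobj R b))" and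
    nat: "\<And>a a' b b' h k f. \<lbrakk>a \<in> objs M; a' \<in> objs M; b \<in> objs N; b' \<in> objs N;
              h \<in> homset M a' a; k \<in> homset N b b'; f \<in> homset N (fobj L a) b\<rbrakk> \<Longrightarrow>
              \<phi> a' b' (compo N k (compo N f (farr L h))) =
              compo M (farr R k) (compo M (\<phi> a b f) h)"
    using A unfolding adjunction_def by metis
  define a b x y where "a = source M i" and "b = target M i" and "x = source N p" and "y = target N p"
  have ob: "a \<in> objs M" "b \<in> objs M" "x \<in> objs N" "y \<in> objs N"
    using i p CM CN by (auto simp: a_def b_def x_def y_def)
  have ih: "i \<in> homset M a b" and ph: "p \<in> homset N x y"
    using i p by (simp_all add: homset_def a_def b_def x_def y_def)
  have Lh: "farr L i \<in> homset N (fobj L a) (fobj L b)"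
    and Lid: "farr L (ident M a) = ident N (fobj L a)" "farr L (ident M b) = ident N (fobj L b)"
    using L ob ih unfolding is_functor_def by blast+
  have Rh: "farr R p \<in> homset M (fobj R x) (fobj R y)"
    and Rid: "farr R (ident N x) = ident M (fobj R x)" "farr R (ident N y) = ident M (fobj R y)"
    using R ob ph unfolding is_functor_def by blast+
  have idM: "\<And>x y f. f \<in> homset M x y \<Longrightarrow> compo M f (ident M x) = f \<and> compo M (ident M y) f = f"
    and idN: "\<And>x y f. f \<in> homset N x y \<Longrightarrow> compo N f (ident N x) = f \<and> compo N (ident N y) f = f"
    and idhM: "\<And>x. x \<in> objs M \<Longrightarrow> ident M x \<in> homset M x x"
    and idhN: "\<And>x. x \<in> objs N \<Longrightarrow> ident N x \<in> homset N x x"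
    and coM: "\<And>x y z f g. f \<in> homset M x y \<Longrightarrow> g \<in> homset M y z \<Longrightarrow> compo M g f \<in> homset M x z"
    and coN: "\<And>x y z f g. f \<in> homset N x y \<Longrightarrow> g \<in> homset N y z \<Longrightarrow> compo N g f \<in> homset N x z"
    using CM CN by simp_all
  have phih: "\<phi> c z f \<in> homset M c (fobj R z)"
    if "c \<in> objs M" "z \<in> objs N" "f \<in> homset N (fobj L c) z" for c z f
    using bij that by (meson bij_betw_apply)
  \<comment> \<open>Naturality in one variable at a time, obtained from \<open>nat\<close> by
    inserting an identity in the other.\<close>
  have nat1: "\<phi> a z (compo N f (farr L i)) = compo M (\<phi> b z f) i"
    if z: "z \<in> objs N" "farr R (ident N z) = ident M (fobj R z)" and f: "f \<in> homset N (fobj L b) z" for z f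
  proof -
    have "compo N f (farr L i) \<in> homset N (fobj L a) z" using coN[OF Lh f] .
    moreover have "compo M (\<phi> b z f) i \<in> homset M a (fobj R z)"
      using coM[OF ih phih[OF ob(2) z(1) f]] .
    ultimately show ?thesis
      using nat[OF ob(2) ob(1) z(1) z(1) ih idhN[OF z(1)] f] idN idM z(2) by metis
  qed
  have nat2: "\<phi> c y (compo N p f) = compo M (farr R p) (\<phi> c x f)"
    if c: "c \<in> objs M" "farr L (ident M c) = ident N (fobj L c)" and f: "f \<in> homset N (fobj L c) x" for c f
    using nat[OF c(1) c(1) ob(3) ob(4) idhM[OF c(1)] ph f] c(2) idN[OF f] idM[OF phih[OF c(1) ob(3) f]]
    by metis
  have st: "source N (farr L i) = fobj L a" "target N (farr L i) = fobj L b"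
    "source M (farr R p) = fobj R x" "target M (farr R p) = fobj R y"
    using Lh Rh by (simp_all add: homset_def)
  show ?thesis
    unfolding has_lifting_def st x_def[symmetric] y_def[symmetric]
  proof (intro ballI impI)
    fix f g assume f: "f \<in> homset N (fobj L a) x" and g: "g \<in> homset N (fobj L b) y"
      and sq: "compo N p f = compo N g (farr L i)"
    have "compo M (farr R p) (\<phi> a x f) = compo M (\<phi> b y g) i"
      using nat2[OF ob(1) Lid(1) f] nat1[OF ob(4) Rid(2) g] sq by simp
    then obtain k where k: "k \<in> homset M b (fobj R x)" "compo M k i = \<phi> a x f"
        "compo M (farr R p) k = \<phi> b y g"
      using lift phih[OF ob(1,3) f] phih[OF ob(2,4) g]
      unfolding has_lifting_def st a_def[symmetric] b_def[symmetric] by blast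
    obtain h where h: "h \<in> homset N (fobj L b) x" "\<phi> b x h = k"
      using bij_betw_imp_surj_on[OF bij[OF ob(2,3)]] k(1) by (metis imageE)
    have "\<phi> a x (compo N h (farr L i)) = \<phi> a x f"
      using nat1[OF ob(3) Rid(1) h(1)] h(2) k(2) by simp
    then have "compo N h (farr L i) = f"
      using inj_onD[OF bij_betw_imp_inj_on[OF bij[OF ob(1,3)]] _ coN[OF Lh h(1)] f] by blast
    moreover have "\<phi> b y (compo N p h) = \<phi> b y g"
      using nat2[OF ob(2) Lid(2) h(1)] h(2) k(3) by simp
    then have "compo N p h = g"
      using inj_onD[OF bij_betw_imp_inj_on[OF bij[OF ob(2,4)]] _ coN[OF h(1) ph] g] by blast
    ultimately show "\<exists>h\<in>homset N (fobj L b) x. compo N h (farr L i) = f \<and> compo N p h = g"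
      using h(1) by blast
  qed
qed

section \<open>Kan extension along a functor to a category with compact Hausdorff mapping spaces\<close>

text \<open>
  The injections \<open>code\<close> only ensure that the points of the coends can be renamed to points of
  type \<open>'u\<close>.
\<close>

locale compact_kan_extension =
  fixes C :: "('o, 'm) tcat" and D :: "('p, 'n) tcat" and r :: "('o, 'm, 'p, 'n) tfunctor"
    and code :: "'p \<Rightarrow> 'o \<times> 'u \<times> 'n \<Rightarrow> 'u"
  assumes C_ob: "Ob C \<noteq> {}"
    and C_pt: "\<And>W W'. W \<in> Ob C \<Longrightarrow> W' \<in> Ob C \<Longrightarrow> pt (Hom C W W') \<in> pts (Hom C W W')"
    and r_ob: "\<And>W. W \<in> Ob C \<Longrightarrow> on_ob r W \<in> Ob D"
    and r_hom: "\<And>W W'. W \<in> Ob C \<Longrightarrow> W' \<in> Ob C \<Longrightarrow>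
      based_map (Hom C W W') (Hom D (on_ob r W) (on_ob r W')) (on_hom r W W')"
    and r_id: "\<And>W. W \<in> Ob C \<Longrightarrow> on_hom r W W (Idt C W) = Idt D (on_ob r W)"
    and r_cmp: "\<And>W W' W'' f g. W \<in> Ob C \<Longrightarrow> W' \<in> Ob C \<Longrightarrow> W'' \<in> Ob C \<Longrightarrow>
      f \<in> pts (Hom C W W') \<Longrightarrow> g \<in> pts (Hom C W' W'') \<Longrightarrow>
      on_hom r W W'' (Cmp C g f) = Cmp D (on_hom r W' W'' g) (on_hom r W W' f)"
    and D_compact: "\<And>U V. U \<in> Ob D \<Longrightarrow> V \<in> Ob D \<Longrightarrow> compact_space (sp (Hom D U V))"
    and D_Hausdorff: "\<And>U V. U \<in> Ob D \<Longrightarrow> V \<in> Ob D \<Longrightarrow> Hausdorff_space (sp (Hom D U V))"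
    and D_pt: "\<And>U V. U \<in> Ob D \<Longrightarrow> V \<in> Ob D \<Longrightarrow> pt (Hom D U V) \<in> pts (Hom D U V)"
    and D_id: "\<And>V. V \<in> Ob D \<Longrightarrow> Idt D V \<in> pts (Hom D V V)"
    and D_cmp: "\<And>U V W. U \<in> Ob D \<Longrightarrow> V \<in> Ob D \<Longrightarrow> W \<in> Ob D \<Longrightarrow>
      continuous_map (prod_topology (sp (Hom D V W)) (sp (Hom D U V))) (sp (Hom D U W))
        (\<lambda>(g, f). Cmp D g f)"
    and D_cmp_pt: "\<And>U V W f. U \<in> Ob D \<Longrightarrow> V \<in> Ob D \<Longrightarrow> W \<in> Ob D \<Longrightarrow> f \<in> pts (Hom D U V) \<Longrightarrow>
        Cmp D (pt (Hom D V W)) f = pt (Hom D U W)"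
      "\<And>U V W g. U \<in> Ob D \<Longrightarrow> V \<in> Ob D \<Longrightarrow> W \<in> Ob D \<Longrightarrow> g \<in> pts (Hom D V W) \<Longrightarrow>
        Cmp D g (pt (Hom D U V)) = pt (Hom D U W)"
    and D_unit: "\<And>U V f. U \<in> Ob D \<Longrightarrow> V \<in> Ob D \<Longrightarrow> f \<in> pts (Hom D U V) \<Longrightarrow> Cmp D (Idt D V) f = f"
      "\<And>U V f. U \<in> Ob D \<Longrightarrow> V \<in> Ob D \<Longrightarrow> f \<in> pts (Hom D U V) \<Longrightarrow> Cmp D f (Idt D U) = f"
    and D_assoc: "\<And>U V W X f g h. U \<in> Ob D \<Longrightarrow> V \<in> Ob D \<Longrightarrow> W \<in> Ob D \<Longrightarrow> X \<in> Ob D \<Longrightarrow>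
      f \<in> pts (Hom D U V) \<Longrightarrow> g \<in> pts (Hom D V W) \<Longrightarrow> h \<in> pts (Hom D W X) \<Longrightarrow>
      Cmp D h (Cmp D g f) = Cmp D (Cmp D h g) f"
    and code: "\<And>V. V \<in> Ob D \<Longrightarrow>
      inj_on (code V) {(W, x, g). W \<in> Ob C \<and> g \<in> pts (Hom D (on_ob r W) V)}"
begin

abbreviation "Lan \<equiv> lan_space C D r :: ('o, 'm, 'u) efunctor \<Rightarrow> 'p \<Rightarrow> 'u based"
abbreviation "LHom W V \<equiv> Hom D (on_ob r W) V"

text \<open>The inner \<open>smash_pt\<close> gives a meaning to every pair of the product, so that
  formulas about classes need no case distinction at the base points.\<close>

definition lpr :: "('o, 'm, 'u) efunctor \<Rightarrow> 'p \<Rightarrow> 'o \<Rightarrow> 'u \<Rightarrow> 'n \<Rightarrow> 'u" where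
  "lpr E V W x g = lan_pr C D r E V (W, smash_pt (obj E W) (LHom W V) (x, g))"

lemma r_pt: "W \<in> Ob C \<Longrightarrow> W' \<in> Ob C \<Longrightarrow> on_hom r W W' (pt (Hom C W W')) = pt (LHom W (on_ob r W'))"
  using r_hom by (simp add: based_map_def)

lemma r_in: "W \<in> Ob C \<Longrightarrow> W' \<in> Ob C \<Longrightarrow> f \<in> pts (Hom C W W') \<Longrightarrow> on_hom r W W' f \<in> pts (LHom W (on_ob r W'))"
  using r_hom by (auto simp: based_map_def continuous_map_def)

lemma D_cmp_in: "U \<in> Ob D \<Longrightarrow> V \<in> Ob D \<Longrightarrow> W \<in> Ob D \<Longrightarrow> f \<in> pts (Hom D U V) \<Longrightarrow> g \<in> pts (Hom D V W) \<Longrightarrow>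
    Cmp D g f \<in> pts (Hom D U W)"
  using continuous_map_image_subset_topspace[OF D_cmp, of U V W] by (auto simp: image_subset_iff)

text \<open>As the mapping space is compact Hausdorff, the smash product is a quotient of the plain
  product, and the action is jointly continuous before the wedge is collapsed.\<close>

lemma act_continuous:
  assumes F: "enriched_functor D F" and UV: "U \<in> Ob D" "V \<in> Ob D"
  shows "continuous_map (prod_topology (sp (Hom D U V)) (sp (obj F U))) (sp (obj F V)) (\<lambda>(f, x). act F U V f x)"
proof -
  have "compactly_generated (sp (obj F U))" "weak_hausdorff (sp (obj F U))"
    using enriched_functorD(1)[OF F UV(1)] by (simp_all add: based_space_def)
  then have cg: "compactly_generated (prod_topology (sp (Hom D U V)) (sp (obj F U)))"
    using compactly_generated_prod_swap D_compact[OF UV] D_Hausdorff[OF UV] by blast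
  have "continuous_map (sp (smash (Hom D U V) (obj F U))) (sp (obj F V)) (\<lambda>(f, x). act F U V f x)"
    using enriched_functorD(2)[OF F UV] by (simp add: based_map_def)
  from continuous_map_compose[OF quotient_imp_continuous_map[OF quotient_map_smash[OF cg]] this]
  show ?thesis
  proof (rule continuous_map_eq)
    fix p assume p: "p \<in> topspace (prod_topology (sp (Hom D U V)) (sp (obj F U)))"
    have "(\<lambda>(f, x). act F U V f x) (smash_pt (Hom D U V) (obj F U) p) = (\<lambda>(f, x). act F U V f x) p"
      by (rule smash_pt_factor[where z = "pt (obj F V)"])
         (use p enriched_functorD(3,4)[OF F UV] D_pt[OF UV] in auto)
    then show "((\<lambda>(f, x). act F U V f x) \<circ> smash_pt (Hom D U V) (obj F U)) p = (\<lambda>(f, x). act F U V f x) p"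
      by simp
  qed
qed

context
  fixes E :: "('o, 'm, 'u) efunctor"
  assumes E: "enriched_functor C E"
begin

lemma compactly_generated_prod_obj:
  assumes "V \<in> Ob D" "W \<in> Ob C"
  shows "compactly_generated (prod_topology (sp (obj E W)) (sp (LHom W V)))"
  using enriched_functorD(1)[OF E assms(2)] D_compact[OF r_ob[OF assms(2)] assms(1)]
    D_Hausdorff[OF r_ob[OF assms(2)] assms(1)]
  unfolding based_space_def by (intro compactly_generated_prod) auto

lemma smash_in:
  "V \<in> Ob D \<Longrightarrow> W \<in> Ob C \<Longrightarrow> x \<in> pts (obj E W) \<Longrightarrow> g \<in> pts (LHom W V) \<Longrightarrow>
    smash_pt (obj E W) (LHom W V) (x, g) \<in> pts (smash (obj E W) (LHom W V))"
  by (simp add: pts_smash)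

lemma in_smashD:
  assumes "V \<in> Ob D" "W \<in> Ob C" "(x, g) \<in> pts (smash (obj E W) (LHom W V))"
  shows "x \<in> pts (obj E W)" "g \<in> pts (LHom W V)" "smash_pt (obj E W) (LHom W V) (x, g) = (x, g)"
  using pts_smashD[OF assms(3)] enriched_functor_pt[OF E assms(2)] D_pt r_ob assms by auto

lemma coend_data_lan:
  assumes V: "V \<in> Ob D"
  shows "coend_data C (lan_integrand D r E V) (lan_left D r E V) (lan_right D r E V) (code V)"
proof
  fix W assume W: "W \<in> Ob C"
  show "generated_by TYPE(('u \<times> 'n) set set) (sp (lan_integrand D r E V W W))"
    using generated_by_quotient[OF _ quotient_map_smash] compactly_generated_prod_obj[OF V W]
    by (simp add: lan_integrand_def compactly_generated_iff)
next
  show "coend_gen C (lan_integrand D r E V) (lan_left D r E V) (lan_right D r E V)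
    \<subseteq> topspace (coend_sum C (lan_integrand D r E V)) \<times> topspace (coend_sum C (lan_integrand D r E V))"
  proof
    have base: "(pt (obj E W), pt (LHom W V)) \<in> pts (smash (obj E W) (LHom W V))" if "W \<in> Ob C" for W
      using smash_in[OF V that enriched_functor_pt[OF E that] D_pt[OF r_ob[OF that] V]] by simp
    fix p assume "p \<in> coend_gen C (lan_integrand D r E V) (lan_left D r E V) (lan_right D r E V)"
    then show "p \<in> topspace (coend_sum C (lan_integrand D r E V)) \<times> topspace (coend_sum C (lan_integrand D r E V))"
      unfolding coend_gen_def
    proof (elim UnE CollectE exE conjE)
      fix W W' assume "p = ((W, pt (lan_integrand D r E V W W)), (W', pt (lan_integrand D r E V W' W')))"
        "W \<in> Ob C" "W' \<in> Ob C"
      then show ?thesis using base by (simp add: coend_sum_def lan_integrand_def)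
    next
      fix W W' f z assume p: "p = ((W, lan_left D r E V W W' f z), (W', lan_right D r E V W W' f z))"
        and W: "W \<in> Ob C" "W' \<in> Ob C" and f: "f \<in> pts (Hom C W W')"
        and z: "z \<in> pts (lan_integrand D r E V W' W)"
      obtain x g where xg: "z = (x, g)" "x \<in> pts (obj E W)" "g \<in> pts (LHom W' V)"
        using pts_smashD(1)[of z "obj E W" "LHom W' V"] z enriched_functor_pt[OF E W(1)]
          D_pt[OF r_ob[OF W(2)] V] by (auto simp: lan_integrand_def)
      have "lan_left D r E V W W' f z \<in> pts (smash (obj E W) (LHom W V))"
        using smash_in[OF V W(1) xg(2) D_cmp_in[OF r_ob[OF W(1)] r_ob[OF W(2)] V r_in[OF W f] xg(3)]]
        by (simp add: lan_left_def xg(1))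
      moreover have "lan_right D r E V W W' f z \<in> pts (smash (obj E W') (LHom W' V))"
        using smash_in[OF V W(2) enriched_functor_act[OF E W f xg(2)] xg(3)]
        by (simp add: lan_right_def xg(1))
      ultimately show ?thesis using W p by (simp add: coend_sum_def lan_integrand_def)
    qed
  qed
next
  have "topspace (coend_sum C (lan_integrand D r E V)) \<subseteq> {(W, x, g). W \<in> Ob C \<and> g \<in> pts (LHom W V)}"
    using in_smashD(2)[OF V] by (auto simp: coend_sum_def lan_integrand_def)
  then show "inj_on (code V) (topspace (coend_sum C (lan_integrand D r E V)))"
    using code[OF V] inj_on_subset by blast
qed (rule C_ob)

context
  fixes V assumes V: "V \<in> Ob D"
begin

interpretation K: coend_data C "lan_integrand D r E V" "lan_left D r E V" "lan_right D r E V" "code V"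
  by (rule coend_data_lan[OF V])

lemma K_S: "K.S = sum_topology (\<lambda>W. sp (smash (obj E W) (LHom W V))) (Ob C)"
  by (simp add: coend_sum_def lan_integrand_def)

lemma K_pr: "K.pr = lan_pr C D r E V"
  by (simp add: lan_pr_def)

lemma K_Y: "K.Y = Lan E V"
  by (simp add: lan_space_def)

lemma based_space_Lan: "based_space (Lan E V)"
  using K.based_space_coend by (simp only: K_Y)

lemma quotient_map_lan_pr:
  "quotient_map (sum_topology (\<lambda>W. sp (smash (obj E W) (LHom W V))) (Ob C)) (sp (Lan E V)) (lan_pr C D r E V)"
  using K.quotient_map_pr by (simp only: K_S K_pr K_Y)

lemma lpr_in:
  assumes "W \<in> Ob C" "x \<in> pts (obj E W)" "g \<in> pts (LHom W V)"
  shows "lpr E V W x g \<in> pts (Lan E V)"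
  using quotient_imp_surjective_map[OF quotient_map_lan_pr] smash_in[OF V assms] assms(1)
  by (force simp: lpr_def)

lemma lan_rep_lpr:
  assumes "y \<in> pts (Lan E V)"
  obtains W x g where "lan_rep C D r E V y = (W, x, g)" "W \<in> Ob C" "x \<in> pts (obj E W)"
    "g \<in> pts (LHom W V)" "y = lpr E V W x g"
proof -
  have "y \<in> K.pr ` topspace K.S"
    using assms by (simp only: quotient_imp_surjective_map[OF K.quotient_map_pr] K_Y)
  then have "\<exists>p. p \<in> topspace K.S \<and> lan_pr C D r E V p = y" unfolding K_pr by blast
  then have rep: "lan_rep C D r E V y \<in> topspace K.S" "lan_pr C D r E V (lan_rep C D r E V y) = y"
    unfolding lan_rep_def by (metis (mono_tags, lifting) someI_ex)+
  obtain W x g where e: "lan_rep C D r E V y = (W, x, g)" using prod_cases3 by blast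
  then have W: "W \<in> Ob C" and xg: "(x, g) \<in> pts (smash (obj E W) (LHom W V))"
    using rep(1) by (auto simp: K_S)
  show thesis
    using that[OF e W in_smashD(1,2)[OF V W xg]] rep(2) in_smashD(3)[OF V W xg] by (simp add: lpr_def e)
qed

lemma lpr_pt:
  assumes "W \<in> Ob C"
  shows "lpr E V W (pt (obj E W)) g = pt (Lan E V)" "lpr E V W x (pt (LHom W V)) = pt (Lan E V)"
  using K.pt_coend[OF assms] by (simp_all add: lpr_def lan_space_def lan_pr_def lan_integrand_def)

lemma lpr_dinatural:
  assumes W: "W \<in> Ob C" "W' \<in> Ob C" and f: "f \<in> pts (Hom C W W')" and x: "x \<in> pts (obj E W)"
    and g: "g \<in> pts (LHom W' V)"
  shows "lpr E V W x (Cmp D g (on_hom r W W' f)) = lpr E V W' (act E W W' f x) g"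
proof -
  have rf: "on_hom r W W' f \<in> pts (LHom W (on_ob r W'))" using r_in[OF W f] .
  show ?thesis
  \<comment> \<open>On the wedge both sides are the base point; elsewhere \<open>(x, g)\<close> is a
    point of the smash product and yields a generator of the coend relation.\<close>
  proof (cases "x = pt (obj E W) \<or> g = pt (LHom W' V)")
    case True
    then show ?thesis
      using lpr_pt[OF W(1)] lpr_pt[OF W(2)] enriched_functorD(4)[OF E W f]
        D_cmp_pt(1)[OF r_ob[OF W(1)] r_ob[OF W(2)] V rf] by auto
  next
    case False
    then have "smash_pt (obj E W) (LHom W' V) (x, g) = (x, g)" by (simp add: smash_pt_def)
    then have z: "(x, g) \<in> pts (lan_integrand D r E V W' W)"
      using x g by (auto simp: lan_integrand_def pts_smash image_iff) (metis mem_Sigma_iff)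
    have "((W, lan_left D r E V W W' f (x, g)), (W', lan_right D r E V W W' f (x, g)))
        \<in> coend_gen C (lan_integrand D r E V) (lan_left D r E V) (lan_right D r E V)"
      using W f z unfolding coend_gen_def by blast
    from K.pr_gen[OF this] show ?thesis
      by (simp add: K_pr lpr_def lan_left_def lan_right_def)
  qed
qed

lemma lpr_continuous:
  assumes W: "W \<in> Ob C"
  shows "continuous_map (prod_topology (sp (obj E W)) (sp (LHom W V))) (sp (Lan E V)) (\<lambda>(x, g). lpr E V W x g)"
proof -
  have "continuous_map (prod_topology (sp (obj E W)) (sp (LHom W V))) (sp (Lan E V))
      (lan_pr C D r E V \<circ> (\<lambda>z. (W, z)) \<circ> smash_pt (obj E W) (LHom W V))"
    using continuous_map_compose[OF continuous_map_compose[OF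
        quotient_imp_continuous_map[OF quotient_map_smash[OF compactly_generated_prod_obj[OF V W]]]
        continuous_map_component_injection[OF W, of "\<lambda>W. sp (smash (obj E W) (LHom W V))"]]
        quotient_imp_continuous_map[OF quotient_map_lan_pr]]
    by (simp only: o_assoc)
  then show ?thesis by (rule continuous_map_eq) (auto simp: lpr_def)
qed

lemma continuous_map_Lan:
  assumes "\<And>W. W \<in> Ob C \<Longrightarrow>
    continuous_map (prod_topology (sp (obj E W)) (sp (LHom W V))) Z (\<lambda>(x, g). f (lpr E V W x g))"
  shows "continuous_map (sp (Lan E V)) Z f"
proof (rule continuous_compose_quotient_map[OF quotient_map_lan_pr], rule continuous_map_from_sum)
  fix W assume W: "W \<in> Ob C"
  have "continuous_map (sp (smash (obj E W) (LHom W V))) Z (\<lambda>z. f (lan_pr C D r E V (W, z)))"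
    by (rule continuous_compose_quotient_map[OF quotient_map_smash[OF compactly_generated_prod_obj[OF V W]]],
        rule continuous_map_eq[OF assms[OF W]]) (auto simp: lpr_def)
  then show "continuous_map (sp (smash (obj E W) (LHom W V))) Z (\<lambda>z. (f \<circ> lan_pr C D r E V) (W, z))"
    by (simp add: o_def)
qed

text \<open>Multiplying by \<open>A\<close> preserves two kinds of quotient maps, from the sum onto
  the extension and from products onto smash products; so continuity can be tested on
  triples.\<close>

lemma continuous_map_prod_Lan:
  assumes A: "compact_space A" "Hausdorff_space A" and f: "\<And>W. W \<in> Ob C \<Longrightarrow>
    continuous_map (prod_topology A (prod_topology (sp (obj E W)) (sp (LHom W V)))) Z
      (\<lambda>(a, (x, g)). f (a, lpr E V W x g))"
  shows "continuous_map (prod_topology A (sp (Lan E V))) Z f"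
proof -
  have lc: "locally_compact_space A" using A by (simp add: compact_imp_locally_compact_space)
  have reg: "Hausdorff_space A \<or> regular_space A" using A by simp
  show ?thesis
  proof (rule continuous_compose_quotient_map[OF quotient_map_prod_right[OF lc reg quotient_map_lan_pr]],
      rule continuous_map_prod_sum)
    fix W assume W: "W \<in> Ob C"
    have "continuous_map (prod_topology A (sp (smash (obj E W) (LHom W V)))) Z
        (\<lambda>(a, z). f (a, lan_pr C D r E V (W, z)))"
      by (rule continuous_compose_quotient_map[OF quotient_map_prod_right[OF lc reg
            quotient_map_smash[OF compactly_generated_prod_obj[OF V W]]]],
          rule continuous_map_eq[OF f[OF W]]) (auto simp: lpr_def)
    then show "continuous_map (prod_topology A (sp (smash (obj E W) (LHom W V)))) Z
        (\<lambda>(a, z). (f \<circ> (\<lambda>(a, p). (a, lan_pr C D r E V p))) (a, (W, z)))"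
      by (simp add: o_def)
  qed
qed

text \<open>Evaluation at the representative chosen by \<open>lan_rep\<close> is the form in which
  \<open>lan_efunctor\<close> and \<open>lan\<close> are defined. The family \<open>f\<close> is
  assembled into one map on the sum, whose kernel contains the coend relation; hence any two
  representatives of a point give the same value.\<close>

lemma lan_universal:
  assumes Z: "weak_hausdorff Z"
    and f: "\<And>W. W \<in> Ob C \<Longrightarrow> continuous_map (prod_topology (sp (obj E W)) (sp (LHom W V))) Z (f W)"
    and pt1: "\<And>W g. W \<in> Ob C \<Longrightarrow> g \<in> pts (LHom W V) \<Longrightarrow> f W (pt (obj E W), g) = z"
    and pt2: "\<And>W x. W \<in> Ob C \<Longrightarrow> x \<in> pts (obj E W) \<Longrightarrow> f W (x, pt (LHom W V)) = z"
    and din: "\<And>W W' \<phi> x g. W \<in> Ob C \<Longrightarrow> W' \<in> Ob C \<Longrightarrow> \<phi> \<in> pts (Hom C W W') \<Longrightarrow> x \<in> pts (obj E W) \<Longrightarrow>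
      g \<in> pts (LHom W' V) \<Longrightarrow> f W (x, Cmp D g (on_hom r W W' \<phi>)) = f W' (act E W W' \<phi> x, g)"
  shows "W \<in> Ob C \<Longrightarrow> x \<in> pts (obj E W) \<Longrightarrow> g \<in> pts (LHom W V) \<Longrightarrow>
      (case lan_rep C D r E V (lpr E V W x g) of (W, x, g) \<Rightarrow> f W (x, g)) = f W (x, g)"
    and "continuous_map (sp (Lan E V)) Z (\<lambda>y. case lan_rep C D r E V y of (W, x, g) \<Rightarrow> f W (x, g))"
proof -
  define F where "F = (\<lambda>(W, z). f W z)"
  have fac: "f W (smash_pt (obj E W) (LHom W V) (x, g)) = f W (x, g)"
    if "W \<in> Ob C" "x \<in> pts (obj E W)" "g \<in> pts (LHom W V)" for W x g
    by (rule smash_pt_factor[where z = z]) (use that pt1 pt2 enriched_functor_pt[OF E] in auto)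
  have cF: "continuous_map K.S Z F"
    unfolding K_S
  proof (rule continuous_map_from_sum)
    fix W assume W: "W \<in> Ob C"
    show "continuous_map (sp (smash (obj E W) (LHom W V))) Z (\<lambda>x. F (W, x))"
      unfolding F_def using continuous_map_smash[OF f[OF W] pt2[OF W] pt1[OF W]] enriched_functor_pt[OF E W]
      by simp
  qed
  have genF: "F p = F q"
    if "(p, q) \<in> coend_gen C (lan_integrand D r E V) (lan_left D r E V) (lan_right D r E V)" for p q
    using that unfolding coend_gen_def
  proof (elim UnE CollectE exE conjE)
    fix W W' assume "(p, q) = ((W, pt (lan_integrand D r E V W W)), (W', pt (lan_integrand D r E V W' W')))"
      "W \<in> Ob C" "W' \<in> Ob C"
    then show ?thesis using pt2 enriched_functor_pt[OF E] by (simp add: lan_integrand_def F_def)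
  next
    fix W W' \<phi> y assume p: "(p, q) = ((W, lan_left D r E V W W' \<phi> y), (W', lan_right D r E V W W' \<phi> y))"
      and W: "W \<in> Ob C" "W' \<in> Ob C" and \<phi>: "\<phi> \<in> pts (Hom C W W')"
      and y: "y \<in> pts (lan_integrand D r E V W' W)"
    obtain x g where xg: "y = (x, g)" "x \<in> pts (obj E W)" "g \<in> pts (LHom W' V)"
      using pts_smashD(1)[of y "obj E W" "LHom W' V"] y enriched_functor_pt[OF E W(1)]
        D_pt[OF r_ob[OF W(2)] V] by (auto simp: lan_integrand_def)
    have "F p = f W (x, Cmp D g (on_hom r W W' \<phi>))"
      using p fac[OF W(1) xg(2) D_cmp_in[OF r_ob[OF W(1)] r_ob[OF W(2)] V r_in[OF W \<phi>] xg(3)]]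
      by (simp add: F_def lan_left_def xg(1))
    moreover have "F q = f W' (act E W W' \<phi> x, g)"
      using p fac[OF W(2) enriched_functor_act[OF E W \<phi> xg(2)] xg(3)]
      by (simp add: F_def lan_right_def xg(1))
    ultimately show ?thesis using din[OF W \<phi> xg(2,3)] by simp
  qed
  have val: "(case lan_rep C D r E V (lpr E V W x g) of (W, x, g) \<Rightarrow> f W (x, g)) = f W (x, g)"
    if W: "W \<in> Ob C" and x: "x \<in> pts (obj E W)" and g: "g \<in> pts (LHom W V)" for W x g
  proof -
    obtain W' x' g' where r': "lan_rep C D r E V (lpr E V W x g) = (W', x', g')" "W' \<in> Ob C"
      "x' \<in> pts (obj E W')" "g' \<in> pts (LHom W' V)" "lpr E V W x g = lpr E V W' x' g'"
      using lan_rep_lpr[OF lpr_in[OF W x g]] by metis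
    have "F (W, smash_pt (obj E W) (LHom W V) (x, g)) = F (W', smash_pt (obj E W') (LHom W' V) (x', g'))"
    proof (rule K.pr_universal[OF cF Z])
      show "(W, smash_pt (obj E W) (LHom W V) (x, g)) \<in> topspace K.S"
        "(W', smash_pt (obj E W') (LHom W' V) (x', g')) \<in> topspace K.S"
        using smash_in[OF V W x g] smash_in[OF V r'(2-4)] W r'(2) by (auto simp: K_S)
    qed (use genF r'(5) in \<open>auto simp: K_pr lpr_def\<close>)
    then show ?thesis using fac[OF W x g] fac[OF r'(2-4)] by (simp add: F_def r'(1))
  qed
  then show "W \<in> Ob C \<Longrightarrow> x \<in> pts (obj E W) \<Longrightarrow> g \<in> pts (LHom W V) \<Longrightarrow>
      (case lan_rep C D r E V (lpr E V W x g) of (W, x, g) \<Rightarrow> f W (x, g)) = f W (x, g)" .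
  show "continuous_map (sp (Lan E V)) Z (\<lambda>y. case lan_rep C D r E V y of (W, x, g) \<Rightarrow> f W (x, g))"
    by (rule continuous_map_Lan, rule continuous_map_eq[OF f]) (use val in auto)
qed

end

end

end

lemma projective_sel [simp]:
  "objs (projective C) = objs (functor_category C)" "arrs (projective C) = arrs (functor_category C)"
  "source (projective C) = source (functor_category C)" "target (projective C) = target (functor_category C)"
  "ident (projective C) = ident (functor_category C)" "compo (projective C) = compo (functor_category C)"
  "weqs (projective C) = levelwise_weqs C" "fibs (projective C) = levelwise_fibs C"
  "cofs (projective C) = {i \<in> arrs (functor_category C).
     \<forall>p\<in>levelwise_fibs C \<inter> levelwise_weqs C. has_lifting (functor_category C) i p}"
  by (simp_all add: projective_def functor_category_def category.extend_def)

lemma homset_projective [simp]: "homset (projective C) = homset (functor_category C)"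
  by (intro ext) (simp add: homset_def)

lemma has_lifting_projective [simp]: "has_lifting (projective C) = has_lifting (functor_category C)"
  by (intro ext) (simp add: has_lifting_def)

lemma adjunction_projective:
  "adjunction (projective C) (projective D) L R = adjunction (functor_category C) (functor_category D) L R"
  by (simp add: adjunction_def is_functor_def)

section \<open>The Kan extension as an enriched functor\<close>

context compact_kan_extension
begin

abbreviation "L \<equiv> lan C D r ::
  (('o, 'm, 'u) efunctor, ('o, 'm, 'u) ntrans, ('p, 'n, 'u) efunctor, ('p, 'n, 'u) ntrans) cfunctor"
abbreviation "R \<equiv> restriction C r ::
  (('p, 'n, 'u) efunctor, ('p, 'n, 'u) ntrans, ('o, 'm, 'u) efunctor, ('o, 'm, 'u) ntrans) cfunctor"

lemma weak_hausdorff_obj: "enriched_functor D F \<Longrightarrow> V \<in> Ob D \<Longrightarrow> weak_hausdorff (sp (obj F V))"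
  using enriched_functorD(1)[of D F V] by (simp add: based_space_def)

lemma lan_obj: "obj (fobj L E) V = Lan E V"
  by (simp add: lan_def lan_efunctor_def)

text \<open>The right-hand side keeps a function applied to the pair \<open>(x, g)\<close>, so that
  it matches the shape of \<open>lan_universal\<close>.\<close>

lemma lan_act: "act (fobj L E) V V' h y =
    (case lan_rep C D r E V y of (W, x, g) \<Rightarrow> (\<lambda>(x, g). lpr E V' W x (Cmp D h g)) (x, g))"
  by (simp add: lan_def lan_efunctor_def lpr_def)

lemma cmp_left_continuous:
  assumes "U \<in> Ob D" "V \<in> Ob D" "V' \<in> Ob D" "h \<in> pts (Hom D V V')"
  shows "continuous_map (sp (Hom D U V)) (sp (Hom D U V')) (\<lambda>g. Cmp D h g)"
proof -
  have "continuous_map (sp (Hom D U V)) (prod_topology (sp (Hom D V V')) (sp (Hom D U V))) (\<lambda>g. (h, g))"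
    using assms(4) by (simp add: continuous_map_pairwise o_def)
  from continuous_map_compose[OF this D_cmp[OF assms(1-3)]] show ?thesis by (simp add: o_def)
qed

text \<open>Composition with \<open>h\<close> gives a family of maps into the extension at
  \<open>V'\<close>; its compatibility with the coend relation is associativity in \<open>D\<close>
  followed by \<open>lpr_dinatural\<close>.\<close>

lemma lan_act_lpr:
  assumes E: "enriched_functor C E" and V: "V \<in> Ob D" "V' \<in> Ob D" and h: "h \<in> pts (Hom D V V')"
    and W: "W \<in> Ob C" and x: "x \<in> pts (obj E W)" and g: "g \<in> pts (LHom W V)"
  shows "act (fobj L E) V V' h (lpr E V W x g) = lpr E V' W x (Cmp D h g)"
proof -
  have "(case lan_rep C D r E V (lpr E V W x g) of (W, x, g) \<Rightarrow> (\<lambda>(x, g). lpr E V' W x (Cmp D h g)) (x, g))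
      = (\<lambda>(x, g). lpr E V' W x (Cmp D h g)) (x, g)"
  proof (rule lan_universal(1)[OF E V(1), where Z = "sp (Lan E V')" and z = "pt (Lan E V')"])
    show "weak_hausdorff (sp (Lan E V'))" using based_space_Lan[OF E V(2)] by (simp add: based_space_def)
  next
    fix W assume W: "W \<in> Ob C"
    have "continuous_map (prod_topology (sp (obj E W)) (sp (LHom W V)))
        (prod_topology (sp (obj E W)) (sp (LHom W V'))) (\<lambda>z. (fst z, Cmp D h (snd z)))"
      by (intro continuous_map_pairedI continuous_map_fst
          continuous_map_compose[OF continuous_map_snd cmp_left_continuous[OF r_ob[OF W] V h], unfolded o_def])
    from continuous_map_compose[OF this lpr_continuous[OF E V(2) W]]
    show "continuous_map (prod_topology (sp (obj E W)) (sp (LHom W V))) (sp (Lan E V'))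
        (\<lambda>(x, g). lpr E V' W x (Cmp D h g))"
      by (simp add: o_def case_prod_unfold)
  next
    fix W g assume "W \<in> Ob C"
    then show "(case (pt (obj E W), g) of (x, g) \<Rightarrow> lpr E V' W x (Cmp D h g)) = pt (Lan E V')"
      by (simp add: lpr_pt[OF E V(2)])
  next
    fix W x assume "W \<in> Ob C"
    then show "(case (x, pt (LHom W V)) of (x, g) \<Rightarrow> lpr E V' W x (Cmp D h g)) = pt (Lan E V')"
      using D_cmp_pt(2)[OF r_ob V h] by (simp add: lpr_pt[OF E V(2)])
  next
    fix W W' \<phi> x g assume W: "W \<in> Ob C" "W' \<in> Ob C" and \<phi>: "\<phi> \<in> pts (Hom C W W')"
      and x: "x \<in> pts (obj E W)" and g: "g \<in> pts (LHom W' V)"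
    have "Cmp D h (Cmp D g (on_hom r W W' \<phi>)) = Cmp D (Cmp D h g) (on_hom r W W' \<phi>)"
      by (rule D_assoc[OF r_ob[OF W(1)] r_ob[OF W(2)] V r_in[OF W \<phi>] g h])
    then show "(case (x, Cmp D g (on_hom r W W' \<phi>)) of (x, g) \<Rightarrow> lpr E V' W x (Cmp D h g)) =
        (case (act E W W' \<phi> x, g) of (x, g) \<Rightarrow> lpr E V' W' x (Cmp D h g))"
      using lpr_dinatural[OF E V(2) W \<phi> x D_cmp_in[OF r_ob[OF W(2)] V g h]] by simp
  qed (use W x g in auto)
  then show ?thesis by (simp add: lan_act)
qed

text \<open>Compactness of \<open>Hom D V V'\<close> allows joint continuity to be tested on triples
  \<open>(h, x, g)\<close>, where the action is composition in \<open>D\<close> followed by the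
  continuous map \<open>lpr\<close>.\<close>

lemma lan_act_continuous:
  assumes E: "enriched_functor C E" and V: "V \<in> Ob D" "V' \<in> Ob D"
  shows "continuous_map (prod_topology (sp (Hom D V V')) (sp (Lan E V))) (sp (Lan E V'))
    (\<lambda>(h, y). act (fobj L E) V V' h y)"
proof (rule continuous_map_prod_Lan[OF E V(1) D_compact[OF V] D_Hausdorff[OF V]])
  fix W assume W: "W \<in> Ob C"
  let ?P = "prod_topology (sp (Hom D V V')) (prod_topology (sp (obj E W)) (sp (LHom W V)))"
  have c1: "continuous_map ?P (sp (obj E W)) (\<lambda>z. fst (snd z))"
    using continuous_map_compose[OF continuous_map_snd continuous_map_fst] by (simp add: o_def)
  have "continuous_map ?P (sp (LHom W V)) (\<lambda>z. snd (snd z))"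
    using continuous_map_compose[OF continuous_map_snd continuous_map_snd] by (simp add: o_def)
  then have "continuous_map ?P (prod_topology (sp (Hom D V V')) (sp (LHom W V))) (\<lambda>z. (fst z, snd (snd z)))"
    by (intro continuous_map_pairedI continuous_map_fst)
  from continuous_map_compose[OF this D_cmp[OF r_ob[OF W] V]]
  have "continuous_map ?P (prod_topology (sp (obj E W)) (sp (LHom W V')))
      (\<lambda>z. (fst (snd z), Cmp D (fst z) (snd (snd z))))"
    by (intro continuous_map_pairedI c1) (simp add: o_def)
  from continuous_map_compose[OF this lpr_continuous[OF E V(2) W]]
  show "continuous_map ?P (sp (Lan E V'))
      (\<lambda>(a, x, g). case (a, lpr E V W x g) of (h, y) \<Rightarrow> act (fobj L E) V V' h y)"
    by (rule continuous_map_eq) (auto simp: lan_act_lpr[OF E V _ W])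
qed

lemma lan_act_base:
  assumes E: "enriched_functor C E" and V: "V \<in> Ob D" "V' \<in> Ob D"
  shows "h \<in> pts (Hom D V V') \<Longrightarrow> act (fobj L E) V V' h (pt (Lan E V)) = pt (Lan E V')"
    and "y \<in> pts (Lan E V) \<Longrightarrow> act (fobj L E) V V' (pt (Hom D V V')) y = pt (Lan E V')"
proof -
  assume h: "h \<in> pts (Hom D V V')"
  obtain W where W: "W \<in> Ob C" using C_ob by blast
  have "pt (Lan E V) = lpr E V W (pt (obj E W)) (pt (LHom W V))"
    using lpr_pt[OF E V(1) W] by simp
  then show "act (fobj L E) V V' h (pt (Lan E V)) = pt (Lan E V')"
    using lan_act_lpr[OF E V h W enriched_functor_pt[OF E W] D_pt[OF r_ob[OF W] V(1)]] lpr_pt[OF E V(2) W]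
    by simp
next
  assume "y \<in> pts (Lan E V)"
  then obtain W x g where W: "W \<in> Ob C" "x \<in> pts (obj E W)" "g \<in> pts (LHom W V)" "y = lpr E V W x g"
    by (rule lan_rep_lpr[OF E V(1)])
  show "act (fobj L E) V V' (pt (Hom D V V')) y = pt (Lan E V')"
    using lan_act_lpr[OF E V D_pt[OF V] W(1-3)] D_cmp_pt(1)[OF r_ob[OF W(1)] V W(3)] lpr_pt[OF E V(2) W(1)]
    by (simp add: W(4))
qed

text \<open>Every point is some \<open>lpr E V W x g\<close>, on which the action is composition
  with \<open>g\<close>; the functor laws thereby reduce to the unit and associativity laws of
  \<open>D\<close>.\<close>

lemma enriched_functor_lan:
  assumes E: "enriched_functor C E"
  shows "enriched_functor D (fobj L E)"
  unfolding enriched_functor_def lan_obj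
proof (intro conjI ballI)
  fix V assume V: "V \<in> Ob D"
  show "based_space (Lan E V)" by (rule based_space_Lan[OF E V])
next
  fix V V' assume V: "V \<in> Ob D" "V' \<in> Ob D"
  note base = lan_act_base[OF E V]
  show "act (fobj L E) V V' (pt (Hom D V V')) x = pt (Lan E V')" if "x \<in> pts (Lan E V)" for x
    using base(2) that .
  show "act (fobj L E) V V' h (pt (Lan E V)) = pt (Lan E V')" if "h \<in> pts (Hom D V V')" for h
    using base(1) that .
  show "based_map (smash (Hom D V V') (Lan E V)) (Lan E V') (\<lambda>(f, x). act (fobj L E) V V' f x)"
    unfolding based_map_def
  proof
    show "continuous_map (sp (smash (Hom D V V') (Lan E V))) (sp (Lan E V')) (\<lambda>(f, x). act (fobj L E) V V' f x)"
      by (rule continuous_map_smash[OF lan_act_continuous[OF E V], where z = "pt (Lan E V')"])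
         (use base D_pt[OF V] in auto)
    show "(\<lambda>(f, x). act (fobj L E) V V' f x) (pt (smash (Hom D V V') (Lan E V))) = pt (Lan E V')"
      using base(1) D_pt[OF V] by simp
  qed
next
  fix V x assume V: "V \<in> Ob D" and x: "x \<in> pts (Lan E V)"
  from x obtain W u g where W: "W \<in> Ob C" "u \<in> pts (obj E W)" "g \<in> pts (LHom W V)" "x = lpr E V W u g"
    by (rule lan_rep_lpr[OF E V(1)])
  show "act (fobj L E) V V (Idt D V) x = x"
    using lan_act_lpr[OF E V V D_id[OF V] W(1-3)] D_unit(1)[OF r_ob[OF W(1)] V W(3)] by (simp add: W(4))
next
  fix U V V' f g x assume V: "U \<in> Ob D" "V \<in> Ob D" "V' \<in> Ob D" and f: "f \<in> pts (Hom D U V)"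
    and g: "g \<in> pts (Hom D V V')" and x: "x \<in> pts (Lan E U)"
  from x obtain W u k where W: "W \<in> Ob C" "u \<in> pts (obj E W)" "k \<in> pts (LHom W U)" "x = lpr E U W u k"
    by (rule lan_rep_lpr[OF E V(1)])
  have fk: "Cmp D f k \<in> pts (LHom W V)" by (rule D_cmp_in[OF r_ob[OF W(1)] V(1,2) W(3) f])
  show "act (fobj L E) U V' (Cmp D g f) x = act (fobj L E) V V' g (act (fobj L E) U V f x)"
    using lan_act_lpr[OF E V(1,3) D_cmp_in[OF V f g] W(1-3)] lan_act_lpr[OF E V(1,2) f W(1-3)]
      lan_act_lpr[OF E V(2,3) g W(1,2) fk] D_assoc[OF r_ob[OF W(1)] V W(3) f g]
    by (simp add: W(4))
qed

section \<open>Restriction, transposition and the unit\<close>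

definition transpose :: "('o, 'm, 'u) efunctor \<Rightarrow> ('p, 'n, 'u) efunctor \<Rightarrow> ('o \<Rightarrow> 'u \<Rightarrow> 'u) \<Rightarrow> 'p \<Rightarrow> 'u \<Rightarrow> 'u" where
  "transpose E F \<beta> V y = (case lan_rep C D r E V y of (W, x, g) \<Rightarrow>
     (\<lambda>(x, g). act F (on_ob r W) V g (\<beta> W x)) (x, g))"

lemma restriction_obj [simp]: "obj (fobj R F) W = obj F (on_ob r W)"
  by (simp add: restriction_def)

lemma restriction_act [simp]: "act (fobj R F) W W' f = act F (on_ob r W) (on_ob r W') (on_hom r W W' f)"
  by (simp add: restriction_def)

lemma restriction_arr: "farr R (E, F, \<alpha>) = (fobj R E, fobj R F, \<lambda>W\<in>Ob C. \<alpha> (on_ob r W))"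
  by (simp add: restriction_def)

lemma enriched_functor_restriction:
  assumes F: "enriched_functor D F"
  shows "enriched_functor C (fobj R F)"
  unfolding enriched_functor_def restriction_obj restriction_act
proof (intro conjI ballI)
  fix W W' assume W: "W \<in> Ob C" "W' \<in> Ob C"
  note rW = r_ob[OF W(1)] r_ob[OF W(2)]
  show "based_map (smash (Hom C W W') (obj F (on_ob r W))) (obj F (on_ob r W'))
      (\<lambda>(f, x). act F (on_ob r W) (on_ob r W') (on_hom r W W' f) x)"
    unfolding based_map_def
  proof
    \<comment> \<open>On the plain product \<open>on_hom r\<close> acts in the first factor alone
      and can be followed by the jointly continuous action; the composite descends to the smash
      product because \<open>on_hom r\<close> preserves base points.\<close>
    have "continuous_map (sp (Hom C W W')) (sp (LHom W (on_ob r W'))) (on_hom r W W')"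
      using r_hom[OF W] by (simp add: based_map_def)
    then have "continuous_map (prod_topology (sp (Hom C W W')) (sp (obj F (on_ob r W))))
      (prod_topology (sp (LHom W (on_ob r W'))) (sp (obj F (on_ob r W)))) (\<lambda>z. (on_hom r W W' (fst z), snd z))"
      by (intro continuous_map_pairedI continuous_map_snd
          continuous_map_compose[OF continuous_map_fst, unfolded o_def])
    from continuous_map_compose[OF this act_continuous[OF F rW]]
    have "continuous_map (prod_topology (sp (Hom C W W')) (sp (obj F (on_ob r W)))) (sp (obj F (on_ob r W')))
        (\<lambda>(f, x). act F (on_ob r W) (on_ob r W') (on_hom r W W' f) x)"
      by (simp add: o_def case_prod_unfold)
    then show "continuous_map (sp (smash (Hom C W W') (obj F (on_ob r W)))) (sp (obj F (on_ob r W')))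
        (\<lambda>(f, x). act F (on_ob r W) (on_ob r W') (on_hom r W W' f) x)"
      by (rule continuous_map_smash[where z = "pt (obj F (on_ob r W'))"])
         (use enriched_functorD(3,4)[OF F rW] r_in[OF W] r_pt[OF W] C_pt[OF W] in auto)
    show "(case pt (smash (Hom C W W') (obj F (on_ob r W))) of
        (f, x) \<Rightarrow> act F (on_ob r W) (on_ob r W') (on_hom r W W' f) x) = pt (obj F (on_ob r W'))"
      using enriched_functorD(3)[OF F rW] enriched_functor_pt[OF F rW(1)] r_pt[OF W] by simp
  qed
next
  fix W assume "W \<in> Ob C"
  then show "based_space (obj F (on_ob r W))" using enriched_functorD(1)[OF F] r_ob by blast
next
  fix W W' x assume W: "W \<in> Ob C" "W' \<in> Ob C" and x: "x \<in> pts (obj F (on_ob r W))"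
  then show "act F (on_ob r W) (on_ob r W') (on_hom r W W' (pt (Hom C W W'))) x = pt (obj F (on_ob r W'))"
    using enriched_functorD(3)[OF F r_ob r_ob] r_pt by simp
next
  fix W W' f assume W: "W \<in> Ob C" "W' \<in> Ob C" and f: "f \<in> pts (Hom C W W')"
  then show "act F (on_ob r W) (on_ob r W') (on_hom r W W' f) (pt (obj F (on_ob r W))) = pt (obj F (on_ob r W'))"
    using enriched_functorD(4)[OF F r_ob r_ob r_in] by simp
next
  fix W x assume W: "W \<in> Ob C" and x: "x \<in> pts (obj F (on_ob r W))"
  then show "act F (on_ob r W) (on_ob r W) (on_hom r W W (Idt C W)) x = x"
    using enriched_functorD(5)[OF F r_ob] r_id by simp
next
  fix W W' W'' f g x assume W: "W \<in> Ob C" "W' \<in> Ob C" "W'' \<in> Ob C" and f: "f \<in> pts (Hom C W W')"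
    and g: "g \<in> pts (Hom C W' W'')" and x: "x \<in> pts (obj F (on_ob r W))"
  show "act F (on_ob r W) (on_ob r W'') (on_hom r W W'' (Cmp C g f)) x =
      act F (on_ob r W') (on_ob r W'') (on_hom r W' W'' g) (act F (on_ob r W) (on_ob r W') (on_hom r W W' f) x)"
    using enriched_functorD(6)[OF F r_ob[OF W(1)] r_ob[OF W(2)] r_ob[OF W(3)] r_in[OF W(1,2) f] r_in[OF W(2,3) g] x]
      r_cmp[OF W f g] by simp
qed

lemma natural_transformation_restriction:
  assumes a: "natural_transformation D (E, F, \<alpha>)"
  shows "natural_transformation C (farr R (E, F, \<alpha>))"
proof -
  note N = natural_transformationD[OF a]
  have "natural_transformation C (fobj R E, fobj R F,
      \<lambda>W\<in>Ob C. \<lambda>x\<in>pts (obj (fobj R E) W). \<alpha> (on_ob r W) x)"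
    by (rule natural_transformationI)
       (use N r_ob r_in in \<open>auto simp: enriched_functor_restriction\<close>)
  moreover have "(\<lambda>W\<in>Ob C. \<lambda>x\<in>pts (obj (fobj R E) W). \<alpha> (on_ob r W) x) = (\<lambda>W\<in>Ob C. \<alpha> (on_ob r W))"
    using N(4) r_ob by (intro restrict_ext) (auto simp: extensional_restrict)
  ultimately show ?thesis by (simp add: restriction_arr)
qed

lemma is_functor_restriction: "is_functor (functor_category D) (functor_category C) R"
  unfolding is_functor_def
proof (intro conjI ballI)
  fix F :: "('p, 'n, 'u) efunctor" assume "F \<in> objs (functor_category D)"
  then show "fobj R F \<in> objs (functor_category C)" by (simp add: enriched_functor_restriction)
  show "farr R (ident (functor_category D) F) = ident (functor_category C) (fobj R F)"
    by (auto simp: restriction_arr r_ob intro!: restrict_ext)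
next
  fix E F :: "('p, 'n, 'u) efunctor" and f assume "f \<in> homset (functor_category D) E F"
  then show "farr R f \<in> homset (functor_category C) (fobj R E) (fobj R F)"
    using natural_transformation_restriction
    by (auto simp: homset_functor_category restriction_arr)
next
  fix E F G :: "('p, 'n, 'u) efunctor" and f g
  assume "f \<in> homset (functor_category D) E F" "g \<in> homset (functor_category D) F G"
  then show "farr R (compo (functor_category D) g f) = compo (functor_category C) (farr R g) (farr R f)"
    by (auto simp: homset_functor_category restriction_arr r_ob intro!: restrict_ext)
qed

context
  fixes E :: "('o, 'm, 'u) efunctor" and F :: "('p, 'n, 'u) efunctor" and \<beta> :: "'o \<Rightarrow> 'u \<Rightarrow> 'u"
  assumes \<beta>: "natural_transformation C (E, fobj R F, \<beta>)" and F: "enriched_functor D F"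
begin

lemma transpose_aux:
  assumes V: "V \<in> Ob D"
  shows "W \<in> Ob C \<Longrightarrow> x \<in> pts (obj E W) \<Longrightarrow> g \<in> pts (LHom W V) \<Longrightarrow>
      transpose E F \<beta> V (lpr E V W x g) = act F (on_ob r W) V g (\<beta> W x)"
    and "continuous_map (sp (Lan E V)) (sp (obj F V)) (transpose E F \<beta> V)"
proof -
  note N = natural_transformationD[OF \<beta>]
  let ?f = "\<lambda>W. \<lambda>(x, g). act F (on_ob r W) V g (\<beta> W x)"
  have 1: "continuous_map (prod_topology (sp (obj E W)) (sp (LHom W V))) (sp (obj F V)) (?f W)"
    if W: "W \<in> Ob C" for W
  proof -
    have "continuous_map (prod_topology (sp (obj E W)) (sp (LHom W V)))
        (prod_topology (sp (LHom W V)) (sp (obj F (on_ob r W)))) (\<lambda>z. (snd z, \<beta> W (fst z)))"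
      using N(5)[OF W] by (intro continuous_map_pairedI continuous_map_snd
          continuous_map_compose[OF continuous_map_fst, unfolded o_def]) simp
    from continuous_map_compose[OF this act_continuous[OF F r_ob[OF W] V]]
    show ?thesis by (simp add: o_def case_prod_unfold)
  qed
  have 2: "?f W (pt (obj E W), g) = pt (obj F V)" if "W \<in> Ob C" "g \<in> pts (LHom W V)" for W g
    using N(6) enriched_functorD(4)[OF F r_ob V] that by simp
  have 3: "?f W (x, pt (LHom W V)) = pt (obj F V)" if "W \<in> Ob C" "x \<in> pts (obj E W)" for W x
    using N(7) enriched_functorD(3)[OF F r_ob V] that by simp
  \<comment> \<open>Compatibility with the coend relation is naturality of \<open>\<beta>\<close>
    combined with functoriality of \<open>F\<close>.\<close>
  have 4: "?f W (x, Cmp D g (on_hom r W W' \<phi>)) = ?f W' (act E W W' \<phi> x, g)"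
    if W: "W \<in> Ob C" "W' \<in> Ob C" and \<phi>: "\<phi> \<in> pts (Hom C W W')" and x: "x \<in> pts (obj E W)"
      and g: "g \<in> pts (LHom W' V)" for W W' \<phi> x g
    using N(8)[OF W \<phi> x] N(7)[OF W(1) x]
      enriched_functorD(6)[OF F r_ob[OF W(1)] r_ob[OF W(2)] V r_in[OF W \<phi>] g] by simp
  note U = lan_universal[OF N(1) V weak_hausdorff_obj[OF F V] 1 2 3 4]
  show "W \<in> Ob C \<Longrightarrow> x \<in> pts (obj E W) \<Longrightarrow> g \<in> pts (LHom W V) \<Longrightarrow>
      transpose E F \<beta> V (lpr E V W x g) = act F (on_ob r W) V g (\<beta> W x)"
    unfolding transpose_def using U(1) by simp
  show "continuous_map (sp (Lan E V)) (sp (obj F V)) (transpose E F \<beta> V)"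
    unfolding transpose_def[abs_def] by (rule U(2))
qed

lemma natural_transformation_transpose:
  "natural_transformation D (fobj L E, F, \<lambda>V\<in>Ob D. \<lambda>y\<in>pts (obj (fobj L E) V). transpose E F \<beta> V y)"
proof (rule natural_transformationI)
  note N = natural_transformationD[OF \<beta>]
  show "enriched_functor D (fobj L E)" by (rule enriched_functor_lan[OF N(1)])
  show "enriched_functor D F" by (rule F)
  fix V assume V: "V \<in> Ob D"
  show "continuous_map (sp (obj (fobj L E) V)) (sp (obj F V)) (transpose E F \<beta> V)"
    unfolding lan_obj by (rule transpose_aux(2)[OF V])
  obtain W where W: "W \<in> Ob C" using C_ob by blast
  have "pt (Lan E V) = lpr E V W (pt (obj E W)) (pt (LHom W V))"
    using lpr_pt[OF N(1) V W] by simp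
  then show "transpose E F \<beta> V (pt (obj (fobj L E) V)) = pt (obj F V)"
    using transpose_aux(1)[OF V W enriched_functor_pt[OF N(1) W] D_pt[OF r_ob[OF W] V]] N(6)[OF W]
      enriched_functorD(4)[OF F r_ob[OF W] V D_pt[OF r_ob[OF W] V]]
    by (simp add: lan_obj)
next
  note N = natural_transformationD[OF \<beta>]
  fix V V' h y assume V: "V \<in> Ob D" "V' \<in> Ob D" and h: "h \<in> pts (Hom D V V')"
    and "y \<in> pts (obj (fobj L E) V)"
  then have "y \<in> pts (Lan E V)" by (simp only: lan_obj)
  then obtain W x g where W: "W \<in> Ob C" "x \<in> pts (obj E W)" "g \<in> pts (LHom W V)" "y = lpr E V W x g"
    by (rule lan_rep_lpr[OF N(1) V(1)])
  have bx: "\<beta> W x \<in> pts (obj F (on_ob r W))" using N(7)[OF W(1,2)] by simp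
  show "transpose E F \<beta> V' (act (fobj L E) V V' h y) = act F V V' h (transpose E F \<beta> V y)"
    using lan_act_lpr[OF N(1) V h W(1-3)] transpose_aux(1)[OF V(1) W(1-3)]
      transpose_aux(1)[OF V(2) W(1,2) D_cmp_in[OF r_ob[OF W(1)] V W(3) h]]
      enriched_functorD(6)[OF F r_ob[OF W(1)] V W(3) h bx]
    by (simp add: W(4))
qed

end

text \<open>The unit sends \<open>x\<close> to the class of \<open>x\<close> paired with an
  identity. For naturality, \<open>lpr_dinatural\<close> moves \<open>f\<close> from the element to
  that identity, past which it commutes by the unit laws.\<close>

lemma lan_unit:
  assumes E: "enriched_functor C E"
  shows "natural_transformation C (E, fobj R (fobj L E),
    \<lambda>W\<in>Ob C. \<lambda>x\<in>pts (obj E W). lpr E (on_ob r W) W x (Idt D (on_ob r W)))"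
proof (rule natural_transformationI)
  show "enriched_functor C E" by (rule E)
  show "enriched_functor C (fobj R (fobj L E))"
    by (rule enriched_functor_restriction[OF enriched_functor_lan[OF E]])
  fix W assume W: "W \<in> Ob C"
  have "continuous_map (sp (obj E W)) (prod_topology (sp (obj E W)) (sp (LHom W (on_ob r W))))
      (\<lambda>x. (x, Idt D (on_ob r W)))"
    using D_id[OF r_ob[OF W]] by (simp add: continuous_map_pairwise o_def)
  from continuous_map_compose[OF this lpr_continuous[OF E r_ob[OF W] W]]
  show "continuous_map (sp (obj E W)) (sp (obj (fobj R (fobj L E)) W))
      (\<lambda>x. lpr E (on_ob r W) W x (Idt D (on_ob r W)))"
    by (simp add: o_def lan_obj)
  show "lpr E (on_ob r W) W (pt (obj E W)) (Idt D (on_ob r W)) = pt (obj (fobj R (fobj L E)) W)"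
    using lpr_pt(1)[OF E r_ob[OF W] W] by (simp add: lan_obj)
next
  fix W W' f x assume W: "W \<in> Ob C" "W' \<in> Ob C" and f: "f \<in> pts (Hom C W W')" and x: "x \<in> pts (obj E W)"
  note rW = r_ob[OF W(1)] r_ob[OF W(2)]
  have "lpr E (on_ob r W') W' (act E W W' f x) (Idt D (on_ob r W')) =
      lpr E (on_ob r W') W x (Cmp D (Idt D (on_ob r W')) (on_hom r W W' f))"
    using lpr_dinatural[OF E rW(2) W f x D_id[OF rW(2)]] by simp
  also have "\<dots> = lpr E (on_ob r W') W x (Cmp D (on_hom r W W' f) (Idt D (on_ob r W)))"
    using D_unit[OF rW r_in[OF W f]] by simp
  also have "\<dots> = act (fobj R (fobj L E)) W W' f (lpr E (on_ob r W) W x (Idt D (on_ob r W)))"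
    using lan_act_lpr[OF E rW r_in[OF W f] W(1) x D_id[OF rW(1)]] by simp
  finally show "lpr E (on_ob r W') W' (act E W W' f x) (Idt D (on_ob r W')) =
      act (fobj R (fobj L E)) W W' f (lpr E (on_ob r W) W x (Idt D (on_ob r W)))" .
qed

text \<open>On arrows the extension is the transpose of the arrow followed by the unit.\<close>

lemma lan_arr:
  assumes a: "natural_transformation C (E, F, \<alpha>)"
  obtains \<alpha>' where "farr L (E, F, \<alpha>) = (fobj L E, fobj L F, \<alpha>')"
    "natural_transformation D (fobj L E, fobj L F, \<alpha>')"
    "\<And>V W x g. V \<in> Ob D \<Longrightarrow> W \<in> Ob C \<Longrightarrow> x \<in> pts (obj E W) \<Longrightarrow> g \<in> pts (LHom W V) \<Longrightarrow>
       \<alpha>' V (lpr E V W x g) = lpr F V W (\<alpha> W x) g"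
proof -
  note N = natural_transformationD[OF a]
  let ?u = "\<lambda>W\<in>Ob C. \<lambda>x\<in>pts (obj F W). lpr F (on_ob r W) W x (Idt D (on_ob r W))"
  let ?\<beta> = "\<lambda>W\<in>Ob C. \<lambda>x\<in>pts (obj E W). ?u W (\<alpha> W x)"
  have \<beta>: "natural_transformation C (E, fobj R (fobj L F), ?\<beta>)"
    by (rule natural_transformation_compo[OF a lan_unit[OF N(2)]])
  note LF = enriched_functor_lan[OF N(2)]
  let ?\<alpha> = "\<lambda>V\<in>Ob D. \<lambda>y\<in>pts (obj (fobj L E) V). transpose E (fobj L F) ?\<beta> V y"
  have val: "act (fobj L F) (on_ob r W) V g (?\<beta> W x) = lpr F V W (\<alpha> W x) g"
    if "V \<in> Ob D" "W \<in> Ob C" "x \<in> pts (obj E W)" "g \<in> pts (LHom W V)" for V W x g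
    using lan_act_lpr[OF N(2) r_ob[OF that(2)] that(1) that(4) that(2) N(7)[OF that(2,3)] D_id[OF r_ob[OF that(2)]]]
      D_unit(2)[OF r_ob[OF that(2)] that(1,4)] N(7)[OF that(2,3)] that by simp
  \<comment> \<open>Both sides evaluate at the same representative chosen by \<open>lan_rep\<close>,
    where \<open>val\<close> compares them.\<close>
  have "?\<alpha> = (\<lambda>V\<in>Ob D. \<lambda>y\<in>pts (lan_space C D r E V). case lan_rep C D r E V y of (W, x, g) \<Rightarrow>
          lan_pr C D r F V (W, smash_pt (obj F W) (Hom D (on_ob r W) V) (\<alpha> W x, g)))" (is "_ = ?\<alpha>'")
    unfolding lan_obj
  proof (intro restrict_ext)
    fix V y assume V: "V \<in> Ob D" and "y \<in> pts (Lan E V)"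
    then obtain W x g where W: "lan_rep C D r E V y = (W, x, g)" "W \<in> Ob C" "x \<in> pts (obj E W)"
      "g \<in> pts (LHom W V)" by (metis lan_rep_lpr[OF N(1) V])
    show "transpose E (fobj L F) ?\<beta> V y = (case lan_rep C D r E V y of (W, x, g) \<Rightarrow>
          lan_pr C D r F V (W, smash_pt (obj F W) (Hom D (on_ob r W) V) (\<alpha> W x, g)))"
      unfolding transpose_def W(1) using val[OF V W(2-4)] by (simp add: lpr_def)
  qed
  then have e: "farr L (E, F, \<alpha>) = (fobj L E, fobj L F, ?\<alpha>)" by (simp add: lan_def)
  show thesis
  proof (rule that[OF e natural_transformation_transpose[OF \<beta> LF]])
    fix V W x g assume V: "V \<in> Ob D" and W: "W \<in> Ob C" "x \<in> pts (obj E W)" "g \<in> pts (LHom W V)"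
    show "?\<alpha> V (lpr E V W x g) = lpr F V W (\<alpha> W x) g"
      using transpose_aux(1)[OF \<beta> LF V W] val[OF V W] lpr_in[OF N(1) V W] V by (simp add: lan_obj)
  qed
qed

lemma Lan_components_eqI:
  assumes E: "enriched_functor C E" and a: "natural_transformation D (fobj L E, F, \<alpha>)"
    and b: "natural_transformation D (fobj L E, F, \<beta>)"
    and eq: "\<And>V W x g. V \<in> Ob D \<Longrightarrow> W \<in> Ob C \<Longrightarrow> x \<in> pts (obj E W) \<Longrightarrow> g \<in> pts (LHom W V) \<Longrightarrow>
      \<alpha> V (lpr E V W x g) = \<beta> V (lpr E V W x g)"
  shows "\<alpha> = \<beta>"
proof -
  have *: "\<alpha> V y = \<beta> V y" if V: "V \<in> Ob D" and "y \<in> pts (obj (fobj L E) V)" for V y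
    using that(2) eq[OF V] unfolding lan_obj by (metis lan_rep_lpr[OF E V])
  have "(\<lambda>V\<in>Ob D. \<lambda>y\<in>pts (obj (fobj L E) V). \<beta> V y) = \<alpha>"
    by (rule components_eqI[OF a]) (simp add: *)
  moreover have "(\<lambda>V\<in>Ob D. \<lambda>y\<in>pts (obj (fobj L E) V). \<beta> V y) = \<beta>"
    by (rule components_eqI[OF b]) simp
  ultimately show ?thesis by simp
qed

lemma is_functor_lan: "is_functor (functor_category C) (functor_category D) L"
  unfolding is_functor_def
proof (intro conjI ballI)
  fix E :: "('o, 'm, 'u) efunctor" assume "E \<in> objs (functor_category C)"
  then have E: "enriched_functor C E" by simp
  show "fobj L E \<in> objs (functor_category D)" by (simp add: enriched_functor_lan[OF E])
  have i: "natural_transformation C (E, E, \<lambda>W\<in>Ob C. \<lambda>x\<in>pts (obj E W). x)"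
    by (rule natural_transformation_ident[OF E])
  obtain \<alpha>' where a: "farr L (E, E, \<lambda>W\<in>Ob C. \<lambda>x\<in>pts (obj E W). x) = (fobj L E, fobj L E, \<alpha>')"
    "natural_transformation D (fobj L E, fobj L E, \<alpha>')"
    "\<And>V W x g. V \<in> Ob D \<Longrightarrow> W \<in> Ob C \<Longrightarrow> x \<in> pts (obj E W) \<Longrightarrow> g \<in> pts (LHom W V) \<Longrightarrow>
       \<alpha>' V (lpr E V W x g) = lpr E V W ((\<lambda>W\<in>Ob C. \<lambda>x\<in>pts (obj E W). x) W x) g"
    using lan_arr[OF i] by metis
  have "\<alpha>' = (\<lambda>V\<in>Ob D. \<lambda>y\<in>pts (obj (fobj L E) V). y)"
    by (rule Lan_components_eqI[OF E a(2) natural_transformation_ident[OF enriched_functor_lan[OF E]]])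
       (simp add: a(3) lan_obj lpr_in[OF E])
  then show "farr L (ident (functor_category C) E) = ident (functor_category D) (fobj L E)"
    using a(1) by simp
next
  fix E F :: "('o, 'm, 'u) efunctor" and f assume "f \<in> homset (functor_category C) E F"
  then obtain \<alpha> where f: "f = (E, F, \<alpha>)" "natural_transformation C (E, F, \<alpha>)"
    by (auto simp: homset_functor_category)
  then show "farr L f \<in> homset (functor_category D) (fobj L E) (fobj L F)"
    using lan_arr[OF f(2)] by (metis homset_functor_category)
next
  fix E F G :: "('o, 'm, 'u) efunctor" and f g
  assume "f \<in> homset (functor_category C) E F" "g \<in> homset (functor_category C) F G"
  then obtain \<alpha> \<beta> where f: "f = (E, F, \<alpha>)" "natural_transformation C (E, F, \<alpha>)"
    and g: "g = (F, G, \<beta>)" "natural_transformation C (F, G, \<beta>)"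
    by (auto simp: homset_functor_category)
  note N = natural_transformationD[OF f(2)]
  obtain \<alpha>' where a: "farr L (E, F, \<alpha>) = (fobj L E, fobj L F, \<alpha>')"
    "natural_transformation D (fobj L E, fobj L F, \<alpha>')"
    "\<And>V W x g. V \<in> Ob D \<Longrightarrow> W \<in> Ob C \<Longrightarrow> x \<in> pts (obj E W) \<Longrightarrow> g \<in> pts (LHom W V) \<Longrightarrow>
       \<alpha>' V (lpr E V W x g) = lpr F V W (\<alpha> W x) g"
    using lan_arr[OF f(2)] by metis
  obtain \<beta>' where b: "farr L (F, G, \<beta>) = (fobj L F, fobj L G, \<beta>')"
    "natural_transformation D (fobj L F, fobj L G, \<beta>')"
    "\<And>V W x g. V \<in> Ob D \<Longrightarrow> W \<in> Ob C \<Longrightarrow> x \<in> pts (obj F W) \<Longrightarrow> g \<in> pts (LHom W V) \<Longrightarrow>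
       \<beta>' V (lpr F V W x g) = lpr G V W (\<beta> W x) g"
    using lan_arr[OF g(2)] by metis
  let ?\<gamma> = "\<lambda>W\<in>Ob C. \<lambda>x\<in>pts (obj E W). \<beta> W (\<alpha> W x)"
  obtain \<gamma>' where c: "farr L (E, G, ?\<gamma>) = (fobj L E, fobj L G, \<gamma>')"
    "natural_transformation D (fobj L E, fobj L G, \<gamma>')"
    "\<And>V W x g. V \<in> Ob D \<Longrightarrow> W \<in> Ob C \<Longrightarrow> x \<in> pts (obj E W) \<Longrightarrow> g \<in> pts (LHom W V) \<Longrightarrow>
       \<gamma>' V (lpr E V W x g) = lpr G V W (?\<gamma> W x) g"
  proof (rule lan_arr[OF natural_transformation_compo[OF f(2) g(2)]])
    fix \<gamma>'
    assume "farr L (E, G, ?\<gamma>) = (fobj L E, fobj L G, \<gamma>')"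
      "natural_transformation D (fobj L E, fobj L G, \<gamma>')"
      "\<And>V W x g. V \<in> Ob D \<Longrightarrow> W \<in> Ob C \<Longrightarrow> x \<in> pts (obj E W) \<Longrightarrow> g \<in> pts (LHom W V) \<Longrightarrow>
         \<gamma>' V (lpr E V W x g) = lpr G V W (?\<gamma> W x) g"
    then show thesis by (rule that)
  qed
  have "\<gamma>' = (\<lambda>V\<in>Ob D. \<lambda>y\<in>pts (obj (fobj L E) V). \<beta>' V (\<alpha>' V y))"
    by (rule Lan_components_eqI[OF N(1) c(2) natural_transformation_compo[OF a(2) b(2)]])
       (simp add: a(3) b(3) c(3) lan_obj lpr_in[OF N(1)] natural_transformationD(7)[OF f(2)])
  then show "farr L (compo (functor_category C) g f) = compo (functor_category D) (farr L g) (farr L f)"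
    using a(1) b(1) c(1) by (simp add: f(1) g(1))
qed

text \<open>The adjunct of \<open>f\<close>: the arrow \<open>farr R f\<close> after the unit of
  \<open>lan_unit\<close>, spelled out on elements.\<close>

definition unit_map :: "('o, 'm, 'u) efunctor \<Rightarrow> ('p, 'n, 'u) efunctor \<Rightarrow> ('p, 'n, 'u) ntrans \<Rightarrow> ('o, 'm, 'u) ntrans" where
  "unit_map E F f = (E, fobj R F,
     \<lambda>W\<in>Ob C. \<lambda>x\<in>pts (obj E W). snd (snd f) (on_ob r W) (lpr E (on_ob r W) W x (Idt D (on_ob r W))))"

lemma natural_transformation_unit_map:
  assumes E: "enriched_functor C E" and a: "natural_transformation D (fobj L E, F, \<alpha>)"
  shows "natural_transformation C (unit_map E F (fobj L E, F, \<alpha>))"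
proof -
  have "natural_transformation C (fobj R (fobj L E), fobj R F, \<lambda>W\<in>Ob C. \<alpha> (on_ob r W))"
    using natural_transformation_restriction[OF a] by (simp add: restriction_arr)
  from natural_transformation_compo[OF lan_unit[OF E] this]
  have "natural_transformation C (E, fobj R F, \<lambda>V\<in>Ob C. \<lambda>x\<in>pts (obj E V). (\<lambda>W\<in>Ob C. \<alpha> (on_ob r W)) V
      ((\<lambda>W\<in>Ob C. \<lambda>x\<in>pts (obj E W). lpr E (on_ob r W) W x (Idt D (on_ob r W))) V x))" .
  also have "(\<lambda>V\<in>Ob C. \<lambda>x\<in>pts (obj E V). (\<lambda>W\<in>Ob C. \<alpha> (on_ob r W)) V
      ((\<lambda>W\<in>Ob C. \<lambda>x\<in>pts (obj E W). lpr E (on_ob r W) W x (Idt D (on_ob r W))) V x))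
     = (\<lambda>W\<in>Ob C. \<lambda>x\<in>pts (obj E W). \<alpha> (on_ob r W) (lpr E (on_ob r W) W x (Idt D (on_ob r W))))"
    by (intro restrict_ext) simp
  finally show ?thesis by (simp only: unit_map_def snd_conv)
qed

lemma bij_betw_unit_map:
  assumes E: "enriched_functor C E" and F: "enriched_functor D F"
  shows "bij_betw (unit_map E F) (homset (functor_category D) (fobj L E) F) (homset (functor_category C) E (fobj R F))"
proof (rule bij_betw_byWitness)
  let ?\<psi> = "\<lambda>b. (fobj L E, F, \<lambda>V\<in>Ob D. \<lambda>y\<in>pts (obj (fobj L E) V). transpose E F (snd (snd b)) V y)"
  show "unit_map E F ` homset (functor_category D) (fobj L E) F \<subseteq> homset (functor_category C) E (fobj R F)"
  proof
    fix b assume "b \<in> unit_map E F ` homset (functor_category D) (fobj L E) F"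
    then obtain \<alpha> where "b = unit_map E F (fobj L E, F, \<alpha>)" "natural_transformation D (fobj L E, F, \<alpha>)"
      by (auto simp: homset_functor_category)
    then show "b \<in> homset (functor_category C) E (fobj R F)"
      using natural_transformation_unit_map[OF E] by (simp add: homset_functor_category unit_map_def)
  qed
  show "?\<psi> ` homset (functor_category C) E (fobj R F) \<subseteq> homset (functor_category D) (fobj L E) F"
    using natural_transformation_transpose[OF _ F] by (auto simp: homset_functor_category)
  show "\<forall>a\<in>homset (functor_category D) (fobj L E) F. ?\<psi> (unit_map E F a) = a"
  proof
    fix a assume "a \<in> homset (functor_category D) (fobj L E) F"
    then obtain \<alpha> where a: "a = (fobj L E, F, \<alpha>)" "natural_transformation D (fobj L E, F, \<alpha>)"
      by (auto simp: homset_functor_category)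
    let ?\<beta> = "snd (snd (unit_map E F a))"
    have \<beta>: "natural_transformation C (E, fobj R F, ?\<beta>)"
      using natural_transformation_unit_map[OF E a(2)] by (simp add: unit_map_def a(1))
    have "(\<lambda>V\<in>Ob D. \<lambda>y\<in>pts (obj (fobj L E) V). transpose E F ?\<beta> V y) = \<alpha>"
    proof (rule Lan_components_eqI[OF E natural_transformation_transpose[OF \<beta> F] a(2)])
      fix V W x g assume V: "V \<in> Ob D" and W: "W \<in> Ob C" "x \<in> pts (obj E W)" "g \<in> pts (LHom W V)"
      note rW = r_ob[OF W(1)] and i = D_id[OF r_ob[OF W(1)]]
      have "(\<lambda>V\<in>Ob D. \<lambda>y\<in>pts (obj (fobj L E) V). transpose E F ?\<beta> V y) V (lpr E V W x g) =
          act F (on_ob r W) V g (\<alpha> (on_ob r W) (lpr E (on_ob r W) W x (Idt D (on_ob r W))))"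
        using transpose_aux(1)[OF \<beta> F V W] V W(1,2) lpr_in[OF E V W] by (simp add: lan_obj unit_map_def a(1))
      \<comment> \<open>The Yoneda step: naturality of \<open>\<alpha>\<close> moves
        \<open>g\<close> inside, where it replaces the identity in the class.\<close>
      also have "\<dots> = \<alpha> V (act (fobj L E) (on_ob r W) V g (lpr E (on_ob r W) W x (Idt D (on_ob r W))))"
        using natural_transformationD(8)[OF a(2) rW V W(3)] lpr_in[OF E rW W(1,2) i] by (simp add: lan_obj)
      also have "\<dots> = \<alpha> V (lpr E V W x g)"
        using lan_act_lpr[OF E rW V W(3) W(1,2) i] D_unit(2)[OF rW V W(3)] by simp
      finally show "(\<lambda>V\<in>Ob D. \<lambda>y\<in>pts (obj (fobj L E) V). transpose E F ?\<beta> V y) V (lpr E V W x g) =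
          \<alpha> V (lpr E V W x g)" .
    qed
    then show "?\<psi> (unit_map E F a) = a" using a(1) by simp
  qed
  show "\<forall>b\<in>homset (functor_category C) E (fobj R F). unit_map E F (?\<psi> b) = b"
  proof
    fix b assume "b \<in> homset (functor_category C) E (fobj R F)"
    then obtain \<beta> where b: "b = (E, fobj R F, \<beta>)" "natural_transformation C (E, fobj R F, \<beta>)"
      by (auto simp: homset_functor_category)
    \<comment> \<open>On the class of \<open>x\<close> and an identity, the transpose lets that
      identity act on \<open>\<beta> W x\<close>.\<close>
    have "(\<lambda>W\<in>Ob C. \<lambda>x\<in>pts (obj E W). (\<lambda>V\<in>Ob D. \<lambda>y\<in>pts (obj (fobj L E) V). transpose E F \<beta> V y)
        (on_ob r W) (lpr E (on_ob r W) W x (Idt D (on_ob r W)))) = \<beta>"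
    proof (rule components_eqI[OF b(2)])
      fix W x assume W: "W \<in> Ob C" "x \<in> pts (obj E W)"
      note rW = r_ob[OF W(1)] and i = D_id[OF r_ob[OF W(1)]]
      have "\<beta> W x \<in> pts (obj F (on_ob r W))" using natural_transformationD(7)[OF b(2) W] by simp
      then show "(\<lambda>V\<in>Ob D. \<lambda>y\<in>pts (obj (fobj L E) V). transpose E F \<beta> V y)
        (on_ob r W) (lpr E (on_ob r W) W x (Idt D (on_ob r W))) = \<beta> W x"
        using transpose_aux(1)[OF b(2) F rW W i] lpr_in[OF E rW W i] rW enriched_functorD(5)[OF F rW]
        by (simp add: lan_obj)
    qed
    then show "unit_map E F (?\<psi> b) = b" by (simp add: b(1) unit_map_def)
  qed
qed

lemma unit_map_natural:
  assumes E: "enriched_functor C E" and E': "enriched_functor C E'" and F: "enriched_functor D F"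
    and F': "enriched_functor D F'"
    and h: "h \<in> homset (functor_category C) E' E" and k: "k \<in> homset (functor_category D) F F'"
    and f: "f \<in> homset (functor_category D) (fobj L E) F"
  shows "unit_map E' F' (compo (functor_category D) k (compo (functor_category D) f (farr L h))) =
    compo (functor_category C) (farr R k) (compo (functor_category C) (unit_map E F f) h)"
proof -
  obtain \<eta> where h: "h = (E', E, \<eta>)" "natural_transformation C (E', E, \<eta>)"
    using h by (auto simp: homset_functor_category)
  obtain \<kappa> where k: "k = (F, F', \<kappa>)" using k by (auto simp: homset_functor_category)
  obtain \<alpha> where f: "f = (fobj L E, F, \<alpha>)" using f by (auto simp: homset_functor_category)
  obtain \<eta>' where L: "farr L (E', E, \<eta>) = (fobj L E', fobj L E, \<eta>')"
    "\<And>V W x g. V \<in> Ob D \<Longrightarrow> W \<in> Ob C \<Longrightarrow> x \<in> pts (obj E' W) \<Longrightarrow> g \<in> pts (LHom W V) \<Longrightarrow>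
       \<eta>' V (lpr E' V W x g) = lpr E V W (\<eta> W x) g"
    using lan_arr[OF h(2)] by metis
  have "lpr E' (on_ob r W) W x (Idt D (on_ob r W)) \<in> pts (Lan E' (on_ob r W))"
    "\<eta> W x \<in> pts (obj E W)"
    if "W \<in> Ob C" "x \<in> pts (obj E' W)" for W x
    using that lpr_in[OF E' r_ob _ _ D_id] r_ob natural_transformationD(7)[OF h(2)] by auto
  then show ?thesis
    by (auto simp: h(1) k f L(1) unit_map_def restriction_arr lan_obj r_ob L(2) D_id intro!: restrict_ext)
qed

lemma adjunction_lan: "adjunction (functor_category C) (functor_category D) L R"
  unfolding adjunction_def
  using is_functor_lan is_functor_restriction bij_betw_unit_map unit_map_natural
  by (intro conjI exI[of _ unit_map]) simp_all

text \<open>\<open>P\<close> is arbitrary so that fibrations and weak equivalences are treated at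
  once: the component of the restriction at \<open>W\<close> is the component at
  \<open>on_ob r W\<close>.\<close>

lemma restriction_levelwise:
  assumes "p \<in> {(E, F, \<alpha>). natural_transformation D (E, F, \<alpha>) \<and> (\<forall>V\<in>Ob D. P (sp (obj E V)) (sp (obj F V)) (\<alpha> V))}"
  shows "farr R p \<in> {(E, F, \<alpha>). natural_transformation C (E, F, \<alpha>) \<and> (\<forall>V\<in>Ob C. P (sp (obj E V)) (sp (obj F V)) (\<alpha> V))}"
proof -
  obtain E F \<alpha> where p: "p = (E, F, \<alpha>)" by (cases p)
  show ?thesis
    using assms natural_transformation_restriction r_ob unfolding p by (auto simp: restriction_arr)
qed

theorem quillen_adjunction_lan: "quillen_adjunction (projective C) (projective D) L R"
proof -
  have adj: "adjunction (projective C) (projective D) L R"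
    by (simp add: adjunction_projective adjunction_lan)
  have fib: "farr R p \<in> levelwise_fibs C" if "p \<in> levelwise_fibs D" for p
    using that unfolding levelwise_fibs_def by (rule restriction_levelwise)
  have weq: "farr R p \<in> levelwise_weqs C" if "p \<in> levelwise_weqs D" for p
    using that unfolding levelwise_weqs_def by (rule restriction_levelwise)
  have "farr L i \<in> cofs (projective D)" if i: "i \<in> cofs (projective C)" for i
  proof -
    have ia: "i \<in> arrs (functor_category C)" using i by simp
    then obtain E F \<alpha> where "i = (E, F, \<alpha>)" "natural_transformation C (E, F, \<alpha>)"
      by (cases i) (auto simp: functor_category_def)
    then have "farr L i \<in> arrs (functor_category D)"
      by (auto simp: functor_category_def elim: lan_arr)
    moreover have "has_lifting (functor_category D) (farr L i) p"
      if p: "p \<in> levelwise_fibs D \<inter> levelwise_weqs D" for p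
    proof -
      have "p \<in> arrs (functor_category D)" using p by (auto simp: levelwise_fibs_def functor_category_def)
      moreover have "has_lifting (functor_category C) i (farr R p)" using i p fib weq by simp
      ultimately show ?thesis
        using left_adjoint_has_lifting[OF is_category_functor_category is_category_functor_category
            adjunction_lan ia] by blast
    qed
    ultimately show ?thesis by simp
  qed
  then show ?thesis using adj fib weq unfolding quillen_adjunction_def by auto
qed

end

section \<open>Spaces of isometries\<close>

lemma topspace_add_point [simp]: "topspace (sp (add_point X)) = insert None (Some ` topspace X)"
proof
  show "topspace (sp (add_point X)) \<subseteq> insert None (Some ` topspace X)"
    by (meson openin_add_point openin_topspace)
  have "Some -` insert None (Some ` topspace X) = topspace X" by auto
  then have "openin (sp (add_point X)) (insert None (Some ` topspace X))" by (simp add: openin_add_point)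
  then show "insert None (Some ` topspace X) \<subseteq> topspace (sp (add_point X))" by (rule openin_subset)
qed

lemma pt_add_point [simp]: "pt (add_point X) = None"
  by (simp add: add_point_def)

lemma openin_add_point_Some: "openin X U \<Longrightarrow> openin (sp (add_point X)) (Some ` U)"
  using openin_subset[of X U] by (auto simp: openin_add_point inj_vimage_image_eq)

lemma openin_add_point_None: "openin (sp (add_point X)) {None}"
  by (simp add: openin_add_point vimage_def)

lemma continuous_map_Some: "continuous_map X (sp (add_point X)) Some"
proof -
  have "{x \<in> topspace X. Some x \<in> U} = topspace X \<inter> Some -` U" for U by auto
  then show ?thesis by (auto simp: continuous_map_def openin_add_point)
qed

lemma compact_space_add_point:
  assumes "compact_space X"
  shows "compact_space (sp (add_point X))"
proof -
  have "compactin (sp (add_point X)) (Some ` topspace X)"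
    using image_compactin[OF _ continuous_map_Some] assms by (simp add: compact_space_def)
  then have "compactin (sp (add_point X)) ({None} \<union> Some ` topspace X)"
    by (intro compactin_Un) (auto simp: finite_imp_compactin)
  then show ?thesis by (simp add: compact_space_def)
qed

lemma Hausdorff_space_add_point:
  assumes "Hausdorff_space X"
  shows "Hausdorff_space (sp (add_point X))"
  unfolding Hausdorff_space_def
proof (intro allI impI)
  let ?P = "sp (add_point X)"
  fix x y assume xy: "x \<in> topspace ?P \<and> y \<in> topspace ?P \<and> x \<noteq> y"
  have S: "openin ?P (Some ` topspace X)" by (simp add: openin_add_point_Some)
  consider "x = None" | "y = None" | a b where "x = Some a" "y = Some b" by (cases x; cases y) auto
  then show "\<exists>U V. openin ?P U \<and> openin ?P V \<and> x \<in> U \<and> y \<in> V \<and> disjnt U V"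
  proof cases
    case 1
    then have "y \<in> Some ` topspace X" using xy by auto
    then show ?thesis using 1 S openin_add_point_None
      by (intro exI[of _ "{None}"] exI[of _ "Some ` topspace X"]) (auto simp: disjnt_def)
  next
    case 2
    then have "x \<in> Some ` topspace X" using xy by auto
    then show ?thesis using 2 S openin_add_point_None
      by (intro exI[of _ "Some ` topspace X"] exI[of _ "{None}"]) (auto simp: disjnt_def)
  next
    case 3
    then have "a \<in> topspace X" "b \<in> topspace X" "a \<noteq> b" using xy by auto
    then obtain U V where "openin X U" "openin X V" "a \<in> U" "b \<in> V" "disjnt U V"
      using assms unfolding Hausdorff_space_def by metis
    then show ?thesis using 3
      by (intro exI[of _ "Some ` U"] exI[of _ "Some ` V"]) (auto simp: openin_add_point_Some disjnt_iff)
  qed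
qed

lemma continuous_map_add_point_map:
  assumes "continuous_map X Y f"
  shows "continuous_map (sp (add_point X)) (sp (add_point Y)) (map_option f)"
  unfolding continuous_map_def
proof (intro conjI allI impI)
  show "map_option f \<in> topspace (sp (add_point X)) \<rightarrow> topspace (sp (add_point Y))"
    using assms by (auto simp: continuous_map_def)
  fix U assume "openin (sp (add_point Y)) U"
  then have "openin X {x \<in> topspace X. f x \<in> Some -` U}"
    using assms by (auto simp: continuous_map_def openin_add_point)
  then show "openin (sp (add_point X)) {x \<in> topspace (sp (add_point X)). map_option f x \<in> U}"
    by (auto simp: openin_add_point elim: back_subst[where P = "openin X"])
qed

text \<open>The added points are isolated, so the pairs with a coordinate \<open>None\<close> form
  an open set on which \<open>f\<close> is constant, and the remaining pairs form an open copy of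
  the product of \<open>X\<close> and \<open>Y\<close>.\<close>

lemma continuous_map_add_point_prod:
  assumes m: "continuous_map (prod_topology X Y) Z m"
    and f: "\<And>x y. f (Some x, Some y) = Some (m (x, y))" "\<And>p. f (None, p) = None" "\<And>p. f (p, None) = None"
  shows "continuous_map (prod_topology (sp (add_point X)) (sp (add_point Y))) (sp (add_point Z)) f"
    (is "continuous_map ?P _ _")
  unfolding continuous_map_def
proof (intro conjI allI impI)
  have f': "f p = (case p of (Some x, Some y) \<Rightarrow> Some (m (x, y)) | _ \<Rightarrow> None)" for p
    using f by (auto split: prod.split option.split)
  show "f \<in> topspace ?P \<rightarrow> topspace (sp (add_point Z))"
    using m f by (auto simp: continuous_map_def Pi_iff)
  fix U assume U: "openin (sp (add_point Z)) U"
  then have UZ: "openin Z (Some -` U)" by (simp add: openin_add_point)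
  have "\<exists>T. openin ?P T \<and> p \<in> T \<and> T \<subseteq> {p \<in> topspace ?P. f p \<in> U}"
    if p: "p \<in> {p \<in> topspace ?P. f p \<in> U}" for p
  proof (cases "fst p = None \<or> snd p = None")
    case True
    then have N: "None \<in> U" using p f by (cases p) auto
    have "openin ?P ({None} \<times> topspace (sp (add_point Y)))" "openin ?P (topspace (sp (add_point X)) \<times> {None})"
      unfolding openin_prod_Times_iff using openin_add_point_None openin_topspace by blast+
    then have "openin ?P ({None} \<times> topspace (sp (add_point Y)) \<union> topspace (sp (add_point X)) \<times> {None})"
      by (rule openin_Un)
    moreover have "p \<in> {None} \<times> topspace (sp (add_point Y)) \<union> topspace (sp (add_point X)) \<times> {None}"
      using True p by (cases p) auto
    moreover have "{None} \<times> topspace (sp (add_point Y)) \<union> topspace (sp (add_point X)) \<times> {None}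
        \<subseteq> {p \<in> topspace ?P. f p \<in> U}"
      using N f by auto
    ultimately show ?thesis by blast
  next
    case False
    then obtain x y where xy: "p = (Some x, Some y)" "x \<in> topspace X" "y \<in> topspace Y"
      using p by (cases p) auto
    let ?O = "{z \<in> topspace (prod_topology X Y). m z \<in> Some -` U}"
    have "openin (prod_topology X Y) ?O" by (rule openin_continuous_map_preimage[OF m UZ])
    moreover have "(x, y) \<in> ?O" using xy p f by auto
    ultimately obtain V W where VW: "openin X V" "openin Y W" "x \<in> V" "y \<in> W" "V \<times> W \<subseteq> ?O"
      unfolding openin_prod_topology_alt by meson
    have "openin ?P (Some ` V \<times> Some ` W)"
      using VW by (simp add: openin_prod_Times_iff openin_add_point_Some)
    moreover have "p \<in> Some ` V \<times> Some ` W" using xy VW by simp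
    moreover have "Some ` V \<times> Some ` W \<subseteq> {p \<in> topspace ?P. f p \<in> U}"
      using VW(5) f(1) by auto
    ultimately show ?thesis by blast
  qed
  then show "openin ?P {p \<in> topspace ?P. f p \<in> U}" by (subst openin_subopen) blast
qed

section \<open>Finite-dimensional subspaces of the space of sequences\<close>

lemma sum_fun_apply: "(\<Sum>i\<in>A. f i) x = (\<Sum>i\<in>A. f i x)"
  for f :: "'a \<Rightarrow> 'b \<Rightarrow> 'c :: comm_monoid_add"
  by (induction A rule: infinite_finite_induct) auto

lemma continuous_on_eval: "continuous_on S f \<Longrightarrow> continuous_on S (\<lambda>x. f x i j)"
  for f :: "'a :: topological_space \<Rightarrow> 'b \<Rightarrow> 'c \<Rightarrow> 'd :: topological_space"
  by (rule continuous_on_product_then_coordinatewise[OF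
      continuous_on_product_then_coordinatewise[of S f]])

lemma zero_in_fd_subspaces: "U \<in> fd_subspaces \<Longrightarrow> 0 \<in> U"
  unfolding fd_subspaces_def using vec.subspace_0 by blast

lemma fd_subspacesD:
  assumes "U \<in> fd_subspaces"
  shows "x \<in> U \<Longrightarrow> y \<in> U \<Longrightarrow> x + y \<in> U" "x \<in> U \<Longrightarrow> vscale a x \<in> U"
  using assms unfolding fd_subspaces_def by (auto intro: vec.subspace_add vec.subspace_scale)

text \<open>A finite basis inside \<open>U\<close> consists of finitely supported vectors, hence has
  a common bound \<open>M\<close>; vanishing from \<open>M\<close> on is a linear condition and
  extends to the span.\<close>

lemma fd_subspaces_bounded:
  assumes "U \<in> fd_subspaces"
  obtains M where "\<And>x n. x \<in> U \<Longrightarrow> M \<le> n \<Longrightarrow> x n = 0"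
proof -
  obtain S where S: "finite S" "U \<subseteq> vec.span S" using assms by (auto simp: fd_subspaces_def)
  obtain B where B: "B \<subseteq> U" "vec.independent B" "U \<subseteq> vec.span B"
    using vec.maximal_independent_subset by blast
  have fB: "finite B" using vec.independent_span_bound[OF S(1) B(2)] B(1) S(2) by blast
  have "finite (\<Union>x\<in>B. {n. x n \<noteq> 0})"
    using fB B(1) assms by (intro finite_UN_I) (auto simp: fd_subspaces_def)
  then obtain M where M: "\<And>n. n \<in> (\<Union>x\<in>B. {n. x n \<noteq> 0}) \<Longrightarrow> n < M"
    unfolding finite_nat_set_iff_bounded by blast
  have "vec.subspace {x. \<forall>n\<ge>M. x n = 0}" by (auto simp: vec.subspace_def vscale_def)
  moreover have "B \<subseteq> {x. \<forall>n\<ge>M. x n = 0}" using M by fastforce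
  ultimately have "U \<subseteq> {x. \<forall>n\<ge>M. x n = 0}" using B(3) vec.span_minimal by blast
  then show thesis using that by blast
qed

definition unit_vec :: "nat \<Rightarrow> 'f :: real_normed_field vec" where
  "unit_vec n = (\<lambda>m. if m = n then 1 else 0)"

lemma vec_eq_sum:
  assumes "\<And>n. M \<le> n \<Longrightarrow> x n = 0"
  shows "x = (\<Sum>n<M. vscale (x n) (unit_vec n))"
proof
  fix k
  show "x k = (\<Sum>n<M. vscale (x n) (unit_vec n)) k"
    using assms[of k] by (cases "k < M") (auto simp: sum_fun_apply vscale_def unit_vec_def sum.delta' if_distrib cong: if_cong)
qed

lemma fd_subspacesI:
  assumes "vec.subspace U" "\<And>x n. x \<in> U \<Longrightarrow> M \<le> n \<Longrightarrow> x n = 0"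
  shows "U \<in> fd_subspaces"
proof -
  have "finite {n. x n \<noteq> 0}" if "x \<in> U" for x
  proof (rule finite_subset[of _ "{..<M}"])
    show "{n. x n \<noteq> 0} \<subseteq> {..<M}" using assms(2)[OF that] not_less by blast
  qed simp
  moreover have "x \<in> vec.span (unit_vec ` {..<M})" if "x \<in> U" for x
  proof -
    have "(\<Sum>n<M. vscale (x n) (unit_vec n)) \<in> vec.span (unit_vec ` {..<M})"
      by (intro vec.span_sum vec.span_scale vec.span_base) auto
    then show ?thesis by (simp only: vec_eq_sum[of M x, OF assms(2)[OF that], symmetric])
  qed
  ultimately show ?thesis using assms(1) unfolding fd_subspaces_def by blast
qed

text \<open>
  The vectors \<open>p n\<close> are the images of the unit vectors under a linear projection onto \<open>U\<close>. They
  replace a basis: coordinates with respect to them are continuous for pointwise convergence.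
\<close>

lemma fd_subspaces_frame:
  assumes "U \<in> fd_subspaces"
  shows "\<exists>M p. (\<forall>n. p n \<in> U) \<and>
    (\<forall>x. x \<in> U \<longleftrightarrow> (\<forall>n\<ge>M. x n = 0) \<and> x = (\<Sum>n<M. vscale (x n) (p n)))"
proof -
  obtain M where M: "\<And>x n. x \<in> U \<Longrightarrow> M \<le> n \<Longrightarrow> x n = 0" using fd_subspaces_bounded[OF assms] by blast
  interpret pair: vector_space_pair "vscale :: 'a \<Rightarrow> _" "vscale :: 'a \<Rightarrow> _" by unfold_locales
  have U: "vec.subspace U" using assms by (simp add: fd_subspaces_def)
  have "Vector_Spaces.linear vscale vscale (\<lambda>x :: 'a vec. x)" using vec.linear_id by (simp add: id_def)
  \<comment> \<open>A linear left inverse of the identity on \<open>U\<close>, with range in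
    \<open>U\<close>, is a projection onto \<open>U\<close>.\<close>
  from pair.linear_exists_left_inverse_on[OF this U]
  obtain g where g: "range g \<subseteq> U" "Vector_Spaces.linear vscale vscale g" "\<And>v. v \<in> U \<Longrightarrow> g v = v"
    by auto
  interpret g: Vector_Spaces.linear vscale vscale g by (rule g(2))
  have gx: "g x = (\<Sum>n<M. vscale (x n) (g (unit_vec n)))" if "\<forall>n\<ge>M. x n = 0" for x
  proof -
    have "g x = g (\<Sum>n<M. vscale (x n) (unit_vec n))" using vec_eq_sum[of M x] that by simp
    also have "\<dots> = (\<Sum>n<M. vscale (x n) (g (unit_vec n)))" by (simp add: g.sum g.scale)
    finally show ?thesis .
  qed
  have "x \<in> U \<longleftrightarrow> (\<forall>n\<ge>M. x n = 0) \<and> x = (\<Sum>n<M. vscale (x n) (g (unit_vec n)))" for x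
  proof
    assume "x \<in> U"
    then show "(\<forall>n\<ge>M. x n = 0) \<and> x = (\<Sum>n<M. vscale (x n) (g (unit_vec n)))"
      using M g(3)[of x] gx[of x] by simp
  next
    assume x: "(\<forall>n\<ge>M. x n = 0) \<and> x = (\<Sum>n<M. vscale (x n) (g (unit_vec n)))"
    then have "x = g x" using gx[of x] by simp
    then show "x \<in> U" using g(1) by (metis rangeI subsetD)
  qed
  then have "\<forall>x. x \<in> U \<longleftrightarrow> (\<forall>n\<ge>M. x n = 0) \<and> x = (\<Sum>n<M. vscale (x n) (g (unit_vec n)))" by simp
  moreover have "\<forall>n. g (unit_vec n) \<in> U" using g(1) by blast
  ultimately show ?thesis by (intro exI conjI)
qed

section \<open>Compactness and composition of spaces of isometries\<close>

lemma inner_prod_eq_sum: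
  assumes "\<And>n. M \<le> n \<Longrightarrow> x n = 0"
  shows "inner_prod c x y = (\<Sum>n<M. x n * c (y n))"
  unfolding inner_prod_def
proof (rule sum.mono_neutral_left)
  show "{n. x n \<noteq> 0} \<subseteq> {..<M}" using assms not_less by blast
qed auto

lemma isometriesD:
  assumes "T \<in> isometries c U V"
  shows "x \<in> U \<Longrightarrow> T x \<in> V" "x \<notin> U \<Longrightarrow> T x = 0" "x \<in> U \<Longrightarrow> y \<in> U \<Longrightarrow> T (x + y) = T x + T y"
    "x \<in> U \<Longrightarrow> T (vscale a x) = vscale a (T x)"
    "x \<in> U \<Longrightarrow> y \<in> U \<Longrightarrow> inner_prod c (T x) (T y) = inner_prod c x y"
  using assms by (auto simp: isometries_def)

lemma isometries_zero: "T \<in> isometries c U V \<Longrightarrow> U \<in> fd_subspaces \<Longrightarrow> T 0 = 0"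
  using isometriesD(4)[of T c U V 0 0] zero_in_fd_subspaces[of U] by (simp add: vscale_def fun_eq_iff zero_fun_def)

text \<open>\<open>T\<close> is linear only on \<open>U\<close>, so membership of the partial sums
  in \<open>U\<close> has to be carried through the induction.\<close>

lemma isometries_sum:
  assumes T: "T \<in> isometries c U V" and U: "U \<in> fd_subspaces" and p: "\<And>n. p n \<in> U"
  shows "T (\<Sum>n<(M::nat). vscale (a n) (p n)) = (\<Sum>n<M. vscale (a n) (T (p n)))
    \<and> (\<Sum>n<M. vscale (a n) (p n)) \<in> U"
proof (induction M)
  case 0
  then show ?case using isometries_zero[OF T U] zero_in_fd_subspaces[OF U] by (simp add: zero_fun_def)
next
  case (Suc M)
  let ?s = "\<Sum>n<M. vscale (a n) (p n)"
  have v: "vscale (a M) (p M) \<in> U" using fd_subspacesD(2)[OF U] p by blast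
  have s: "T ?s = (\<Sum>n<M. vscale (a n) (T (p n)))" "?s \<in> U" using Suc.IH by blast+
  have "T (?s + vscale (a M) (p M)) = (\<Sum>n<M. vscale (a n) (T (p n))) + vscale (a M) (T (p M))"
    by (simp only: isometriesD(3)[OF T s(2) v] isometriesD(4)[OF T p] s(1))
  then show ?case
    unfolding sum.lessThan_Suc using fd_subspacesD(1)[OF U s(2) v] by (rule conjI)
qed

text \<open>Isometries form a closed subset of a product of closed balls, which is compact by
  Tychonoff's theorem. By \<open>cn\<close>, the inner product of a vector with itself is a sum of
  squared norms, which bounds every entry.\<close>

lemma compact_isometries:
  fixes c :: "'f :: {real_normed_field, heine_borel} \<Rightarrow> 'f"
  assumes V: "V \<in> fd_subspaces" and U: "U \<in> fd_subspaces" and c: "continuous_on UNIV c"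
    and cn: "\<And>a. a * c a = of_real ((norm a)\<^sup>2)"
  shows "compact (isometries c U V)"
proof -
  obtain N q where q': "\<forall>n. q n \<in> V"
    "\<forall>x. x \<in> V \<longleftrightarrow> (\<forall>n\<ge>N. x n = 0) \<and> x = (\<Sum>n<N. vscale (x n) (q n))"
    using fd_subspaces_frame[OF V] by (elim exE conjE)
  note q = q'(1)[rule_format] q'(2)[THEN spec]
  have V0: "y n = 0" if "y \<in> V" "N \<le> n" for y n using q(2) that by blast
  \<comment> \<open>On \<open>U\<close> this is the norm of \<open>x\<close>, which no entry of
    \<open>T x\<close> exceeds; off \<open>U\<close> the bound is trivial because
    \<open>T x = 0\<close>.\<close>
  define b where "b x = sqrt (norm (inner_prod c x x))" for x
  define K where "K = {T :: 'f vec \<Rightarrow> 'f vec. \<forall>x n. T x n \<in> cball 0 (b x)}"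
  have "compactin (product_topology (\<lambda>x. product_topology (\<lambda>n. euclidean) UNIV) UNIV)
      (PiE UNIV (\<lambda>x :: 'f vec. PiE UNIV (\<lambda>n :: nat. cball (0 :: 'f) (b x))))"
    unfolding compactin_PiE compactin_euclidean_iff by (intro disjI2 ballI compact_cball)
  then have "compact (PiE UNIV (\<lambda>x :: 'f vec. PiE UNIV (\<lambda>n :: nat. cball (0 :: 'f) (b x))))"
    unfolding euclidean_product_topology compactin_euclidean_iff .
  also have "PiE UNIV (\<lambda>x. PiE UNIV (\<lambda>n. cball 0 (b x))) = K" by (auto simp: K_def PiE_iff)
  finally have K: "compact K" .
  have ev: "continuous_on UNIV (\<lambda>T :: 'f vec \<Rightarrow> 'f vec. T x n)" for x n
    by (rule continuous_on_eval[OF continuous_on_id])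
  have evc: "continuous_on UNIV (\<lambda>T :: 'f vec \<Rightarrow> 'f vec. c (T x n))" for x n
    by (rule continuous_on_compose2[OF c ev]) simp
  have bound: "norm (T x n) \<le> b x" if T: "T \<in> isometries c U V" and x: "x \<in> U" for T x n
  proof (cases "n < N")
    case True
    have "(\<Sum>k<N. T x k * c (T x k)) = of_real (\<Sum>k<N. (norm (T x k))\<^sup>2)"
      by (simp add: cn)
    then have "norm (\<Sum>k<N. T x k * c (T x k)) = (\<Sum>k<N. (norm (T x k))\<^sup>2)"
      by (simp only: norm_of_real) (simp add: sum_nonneg)
    then have "norm (inner_prod c x x) = (\<Sum>k<N. (norm (T x k))\<^sup>2)"
      using isometriesD(5)[OF T x x] inner_prod_eq_sum[of N "T x" c "T x"] V0[OF isometriesD(1)[OF T x]] by simp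
    moreover have "(norm (T x n))\<^sup>2 \<le> (\<Sum>k<N. (norm (T x k))\<^sup>2)"
      using True by (intro member_le_sum) auto
    ultimately show ?thesis unfolding b_def by (simp add: real_le_rsqrt)
  next
    case False
    then show ?thesis using V0[OF isometriesD(1)[OF T x], of n] by (simp add: b_def)
  qed
  \<comment> \<open>Membership in \<open>V\<close> is expressed through the frame \<open>q\<close>,
    so that every condition is an equation between finite expressions in values of \<open>T\<close>,
    continuous for pointwise convergence. The premises do not depend on \<open>T\<close>, hence the
    implications remain closed conditions.\<close>
  define Q where "Q T \<longleftrightarrow>
    (\<forall>x n. x \<in> U \<longrightarrow> N \<le> n \<longrightarrow> T x n = 0) \<and> (\<forall>x k. x \<in> U \<longrightarrow> T x k = (\<Sum>n<N. T x n * q n k)) \<and>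
    (\<forall>x k. x \<notin> U \<longrightarrow> T x k = 0) \<and> (\<forall>x y k. x \<in> U \<longrightarrow> y \<in> U \<longrightarrow> T (x + y) k = T x k + T y k) \<and>
    (\<forall>a x k. x \<in> U \<longrightarrow> T (vscale a x) k = a * T x k) \<and>
    (\<forall>x y. x \<in> U \<longrightarrow> y \<in> U \<longrightarrow> (\<Sum>n<N. T x n * c (T y n)) = inner_prod c x y)" for T :: "'f vec \<Rightarrow> 'f vec"
  have "closed (Collect Q)"
    unfolding Q_def
    by (intro closed_Collect_conj closed_Collect_all closed_Collect_imp open_Collect_const closed_Collect_eq
        continuous_on_sum continuous_on_mult continuous_on_add continuous_on_const ev evc)
  moreover have "isometries c U V = K \<inter> Collect Q"
  proof
    show "isometries c U V \<subseteq> K \<inter> Collect Q"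
    proof
      fix T assume T: "T \<in> isometries c U V"
      have 1: "T x k = (\<Sum>n<N. T x n * q n k)" if "x \<in> U" for x k
      proof -
        have "T x = (\<Sum>n<N. vscale (T x n) (q n))" by (rule conjunct2[OF iffD1[OF q(2) isometriesD(1)[OF T that]]])
        from fun_cong[OF this, of k] show ?thesis by (simp add: sum_fun_apply vscale_def)
      qed
      have 2: "(\<Sum>n<N. T x n * c (T y n)) = inner_prod c x y" if "x \<in> U" "y \<in> U" for x y
        using inner_prod_eq_sum[of N "T x" c "T y"] V0[OF isometriesD(1)[OF T that(1)]]
          isometriesD(5)[OF T that] by simp
      have "T x n \<in> cball 0 (b x)" for x n
        using bound[OF T] isometriesD(2)[OF T] by (cases "x \<in> U") (auto simp: b_def)
      then have "T \<in> K" by (simp add: K_def)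
      moreover have "Q T"
        unfolding Q_def
      proof (intro conjI allI impI)
        show "T x n = 0" if "x \<in> U" "N \<le> n" for x n using V0[OF isometriesD(1)[OF T]] that .
        show "T x k = 0" if "x \<notin> U" for x k using isometriesD(2)[OF T that] by simp
        show "T (x + y) k = T x k + T y k" if "x \<in> U" "y \<in> U" for x y k
          using isometriesD(3)[OF T that] by simp
        show "T (vscale a x) k = a * T x k" if "x \<in> U" for a x k
          using isometriesD(4)[OF T that] by (simp add: vscale_def)
      qed (fact 1 2)+
      ultimately show "T \<in> K \<inter> Collect Q" by blast
    qed
    show "K \<inter> Collect Q \<subseteq> isometries c U V"
    proof
      fix T assume "T \<in> K \<inter> Collect Q"
      then have "Q T" by blast
      note Q = this[unfolded Q_def]
      note Q2 = Q[THEN conjunct2] note Q3 = Q2[THEN conjunct2] note Q4 = Q3[THEN conjunct2]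
      note Q5 = Q4[THEN conjunct2]
      note c1 = Q[THEN conjunct1, rule_format] and c2 = Q2[THEN conjunct1, rule_format]
        and c3 = Q3[THEN conjunct1, rule_format] and c4 = Q4[THEN conjunct1, rule_format]
        and c5 = Q5[THEN conjunct1, rule_format] and c6 = Q5[THEN conjunct2, rule_format]
      have "T x \<in> V" if "x \<in> U" for x
        unfolding q(2)
      proof
        show "\<forall>n\<ge>N. T x n = 0" using c1[OF that] by blast
        show "T x = (\<Sum>n<N. vscale (T x n) (q n))"
          by (rule ext) (simp only: sum_fun_apply vscale_def c2[OF that, symmetric])
      qed
      moreover have "inner_prod c (T x) (T y) = inner_prod c x y" if "x \<in> U" "y \<in> U" for x y
        using inner_prod_eq_sum[of N "T x" c "T y"] c1[OF that(1)] c6[OF that] by simp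
      ultimately show "T \<in> isometries c U V"
        using c3 c4 c5 unfolding isometries_def by (auto simp: fun_eq_iff vscale_def)
    qed
  qed
  ultimately show ?thesis using compact_Int_closed[OF K] by simp
qed

lemma Hausdorff_space_top_of_set_functions:
  "Hausdorff_space (top_of_set (S :: ('a \<Rightarrow> 'b \<Rightarrow> 'f :: metric_space) set))"
proof -
  have "Hausdorff_space (product_topology (\<lambda>x :: 'a. product_topology (\<lambda>n :: 'b. euclidean :: 'f topology) UNIV) UNIV)"
    by (simp add: Hausdorff_space_product_topology)
  then show ?thesis
    unfolding euclidean_product_topology by (rule Hausdorff_space_subtopology)
qed

lemma isometries_comp:
  assumes "S \<in> isometries c V W" "T \<in> isometries c U V" "V \<in> fd_subspaces"
  shows "S \<circ> T \<in> isometries c U W"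
  unfolding isometries_def o_def
proof (intro CollectI conjI ballI allI impI)
  note S = isometriesD[OF assms(1)] and T = isometriesD[OF assms(2)]
  show "(\<lambda>x. S (T x)) ` U \<subseteq> W" using S(1) T(1) by blast
  \<comment> \<open>Off \<open>U\<close> the default value zero of \<open>T\<close> is preserved by
    \<open>S\<close>.\<close>
  show "S (T x) = 0" if "x \<notin> U" for x
    using T(2)[OF that] isometries_zero[OF assms(1,3)] by simp
  show "S (T (x + y)) = S (T x) + S (T y)" if "x \<in> U" "y \<in> U" for x y
    using S(3)[OF T(1) T(1)] T(3) that by simp
  show "S (T (vscale a x)) = vscale a (S (T x))" if "x \<in> U" for a x
    using S(4)[OF T(1)] T(4) that by simp
  show "inner_prod c (S (T x)) (S (T y)) = inner_prod c x y" if "x \<in> U" "y \<in> U" for x y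
    using S(5)[OF T(1) T(1)] T(5) that by simp
qed

text \<open>Pointwise convergence does not by itself control \<open>S\<close> at the varying point
  \<open>T x\<close>. Expanding \<open>T x\<close> in the frame of \<open>V\<close> leaves the
  values of \<open>S\<close> at finitely many fixed vectors, with the entries of \<open>T x\<close>
  as coefficients.\<close>

lemma continuous_isometries_comp:
  assumes V: "V \<in> fd_subspaces"
  shows "continuous_on (isometries c V W \<times> isometries c U V) (\<lambda>(S, T). S \<circ> T)"
proof -
  obtain N q where q': "\<forall>n. q n \<in> V"
    "\<forall>x. x \<in> V \<longleftrightarrow> (\<forall>n\<ge>N. x n = 0) \<and> x = (\<Sum>n<N. vscale (x n) (q n))"
    using fd_subspaces_frame[OF V] by (elim exE conjE)
  note q = q'(1)[rule_format] q'(2)[THEN spec]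
  show ?thesis
  proof (intro continuous_on_coordinatewise_then_product)
    fix x k
    let ?A = "isometries c V W \<times> isometries c U V"
    have "(S \<circ> T) x k = (\<Sum>n<N. T x n * S (q n) k)"
      if S: "S \<in> isometries c V W" and T: "T \<in> isometries c U V" for S T
    proof -
      have "T x \<in> V" using isometriesD(1,2)[OF T] zero_in_fd_subspaces[OF V] by (cases "x \<in> U") auto
      then have "T x = (\<Sum>n<N. vscale (T x n) (q n))" by (rule conjunct2[OF iffD1[OF q(2)]])
      then have "S (T x) = S (\<Sum>n<N. vscale (T x n) (q n))" by (rule arg_cong)
      then show ?thesis
        using isometries_sum[OF S V q(1), where M = N and a = "T x"] by (simp add: sum_fun_apply vscale_def)
    qed
    moreover have "continuous_on ?A (\<lambda>z. snd z x n)" "continuous_on ?A (\<lambda>z. fst z (q n) k)" for n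
      by (rule continuous_on_eval[OF continuous_on_snd[OF continuous_on_id]],
          rule continuous_on_eval[OF continuous_on_fst[OF continuous_on_id]])
    then have "continuous_on ?A (\<lambda>z. \<Sum>n<N. snd z x n * fst z (q n) k)"
      by (intro continuous_on_sum continuous_on_mult)
    ultimately show "continuous_on ?A (\<lambda>z. (case z of (S, T) \<Rightarrow> S \<circ> T) x k)"
      by (elim continuous_on_eq) auto
  qed
qed

lemma isometries_id: "(\<lambda>x. if x \<in> U then x else 0) \<in> isometries c U U" if "U \<in> fd_subspaces"
  using fd_subspacesD[OF that] by (auto simp: isometries_def)

section \<open>Realification\<close>

lemma J0_sel [simp]:
  "Ob (J0 c) = fd_subspaces"
  "Hom (J0 c) U V = add_point (top_of_set (isometries c U V))"
  "Idt (J0 c) U = Some (\<lambda>x. if x \<in> U then x else 0)"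
  by (simp_all add: J0_def)

lemma Cmp_J0 [simp]:
  "Cmp (J0 c) (Some S) (Some T) = Some (S \<circ> T)" "Cmp (J0 c) None T' = None" "Cmp (J0 c) S' None = None"
  by (simp_all add: J0_def split: option.split)

lemma isometries_comp_id:
  assumes T: "T \<in> isometries c U V" and "U \<in> fd_subspaces"
  shows "(\<lambda>x. if x \<in> V then x else 0) \<circ> T = T" "T \<circ> (\<lambda>x. if x \<in> U then x else 0) = T"
  using isometriesD(1,2)[OF T] isometries_zero[OF assms] by (auto simp: fun_eq_iff)

lemma realify_unrealify [simp]: "realify_vec (unrealify_vec x) = x"
  by (auto simp: realify_vec_def unrealify_vec_def fun_eq_iff elim: evenE oddE)

lemma unrealify_realify [simp]: "unrealify_vec (realify_vec z) = z"
  by (auto simp: realify_vec_def unrealify_vec_def fun_eq_iff)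

lemma realify_vec_simps:
  "realify_vec (y + z) = realify_vec y + realify_vec z"
  "realify_vec (vscale (of_real a) z) = vscale a (realify_vec z)" "realify_vec 0 = 0"
  by (auto simp: realify_vec_def vscale_def fun_eq_iff)

lemma unrealify_vec_simps:
  "unrealify_vec (x + y) = unrealify_vec x + unrealify_vec y"
  "unrealify_vec (vscale a x) = vscale (of_real a) (unrealify_vec x)"
  by (auto simp: unrealify_vec_def vscale_def fun_eq_iff complex_eq_iff)

lemma in_realify_image: "x \<in> realify_vec ` W \<longleftrightarrow> unrealify_vec x \<in> W"
  by (metis image_iff realify_unrealify unrealify_realify)

lemma realify_fd_subspaces:
  assumes W: "W \<in> fd_subspaces"
  shows "realify_vec ` W \<in> fd_subspaces"
proof -
  obtain M where M: "\<And>z n. z \<in> W \<Longrightarrow> M \<le> n \<Longrightarrow> z n = 0" using fd_subspaces_bounded[OF W] by blast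
  show ?thesis
  \<comment> \<open>Coordinate \<open>n\<close> of a realified vector comes from coordinate
    \<open>n div 2\<close>, so the bound on the supports doubles.\<close>
  proof (rule fd_subspacesI[where M = "2 * M"])
    show "vec.subspace (realify_vec ` W)"
      unfolding vec.subspace_def in_realify_image
      unfolding unrealify_vec_simps
      using fd_subspacesD[OF W] zero_in_fd_subspaces[OF W] unrealify_realify[of 0]
      by (simp add: realify_vec_simps(3))
    fix x and n :: nat assume x: "x \<in> realify_vec ` W" and n: "2 * M \<le> n"
    obtain z where z: "z \<in> W" "x = realify_vec z" using x by blast
    have "M \<le> n div 2" using n by linarith
    then have "z (n div 2) = 0" using M z(1) by blast
    then show "x n = 0" by (simp add: z(2) realify_vec_def)
  qed
qed

text \<open>The terms with indices \<open>2 * n\<close> and \<open>2 * n + 1\<close> of the real sum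
  add up to \<open>Re (z n * cnj (w n))\<close>.\<close>

lemma inner_prod_realify:
  assumes "\<And>n. M \<le> n \<Longrightarrow> z n = 0"
  shows "inner_prod (\<lambda>x. x) (realify_vec z) (realify_vec w) = Re (inner_prod cnj z w)"
proof -
  have "realify_vec z n = 0" if "2 * M \<le> n" for n
  proof -
    have "M \<le> n div 2" using that by linarith
    then show ?thesis using assms by (simp add: realify_vec_def)
  qed
  then have "inner_prod (\<lambda>x. x) (realify_vec z) (realify_vec w) = (\<Sum>n<2 * M. realify_vec z n * realify_vec w n)"
    by (rule inner_prod_eq_sum)
  also have "\<dots> = (\<Sum>n<M. Re (z n * cnj (w n)))"
    by (induction M) (auto simp: realify_vec_def)
  also have "\<dots> = Re (inner_prod cnj z w)"
    using inner_prod_eq_sum[of M z cnj w] assms by simp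
  finally show ?thesis .
qed

lemma realify_isometries:
  assumes T: "T \<in> isometries cnj W W'" and W: "W \<in> fd_subspaces" "W' \<in> fd_subspaces"
  shows "realify_vec \<circ> T \<circ> unrealify_vec \<in> isometries (\<lambda>x. x) (realify_vec ` W) (realify_vec ` W')"
proof -
  obtain M where M: "\<And>z n. z \<in> W \<Longrightarrow> M \<le> n \<Longrightarrow> z n = 0" using fd_subspaces_bounded[OF W(1)] by blast
  obtain M' where M': "\<And>z n. z \<in> W' \<Longrightarrow> M' \<le> n \<Longrightarrow> z n = 0" using fd_subspaces_bounded[OF W(2)] by blast
  note TD = isometriesD[OF T]
  show ?thesis
    unfolding isometries_def
  proof (intro CollectI conjI allI ballI impI)
    show "(realify_vec \<circ> T \<circ> unrealify_vec) ` realify_vec ` W \<subseteq> realify_vec ` W'"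
      using TD(1) by (auto simp: image_iff)
    fix x
    show "(realify_vec \<circ> T \<circ> unrealify_vec) x = 0" if "x \<notin> realify_vec ` W"
      using that TD(2) by (simp add: in_realify_image realify_vec_simps)
    assume x: "x \<in> realify_vec ` W"
    then have x': "unrealify_vec x \<in> W" by (simp add: in_realify_image)
    show "(realify_vec \<circ> T \<circ> unrealify_vec) (vscale a x) = vscale a ((realify_vec \<circ> T \<circ> unrealify_vec) x)" for a
      using TD(4)[OF x'] by (simp add: unrealify_vec_simps realify_vec_simps)
    fix y assume y: "y \<in> realify_vec ` W"
    then have y': "unrealify_vec y \<in> W" by (simp add: in_realify_image)
    show "(realify_vec \<circ> T \<circ> unrealify_vec) (x + y) =
        (realify_vec \<circ> T \<circ> unrealify_vec) x + (realify_vec \<circ> T \<circ> unrealify_vec) y"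
      using TD(3)[OF x' y'] by (simp add: unrealify_vec_simps realify_vec_simps)
    show "inner_prod (\<lambda>x. x) ((realify_vec \<circ> T \<circ> unrealify_vec) x) ((realify_vec \<circ> T \<circ> unrealify_vec) y) =
        inner_prod (\<lambda>x. x) x y"
      using inner_prod_realify[of M' "T (unrealify_vec x)" "T (unrealify_vec y)"] M'[OF TD(1)[OF x']]
        inner_prod_realify[of M "unrealify_vec x" "unrealify_vec y"] M[OF x'] TD(5)[OF x' y']
      by simp
  qed
qed

lemma continuous_on_realify_map: "continuous_on S (\<lambda>T. realify_vec \<circ> T \<circ> unrealify_vec)"
proof (intro continuous_on_coordinatewise_then_product)
  fix x k
  have "continuous_on S (\<lambda>T. T (unrealify_vec x) (k div 2))"
    by (rule continuous_on_eval[OF continuous_on_id])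
  then show "continuous_on S (\<lambda>T. (realify_vec \<circ> T \<circ> unrealify_vec) x k)"
    by (cases "even k") (auto simp: realify_vec_def intro!: continuous_intros)
qed

section \<open>Cardinality: fitting the points of the Kan extension into \<open>'u\<close>\<close>

definition embeds :: "'a set \<Rightarrow> 'u itself \<Rightarrow> bool" where
  "embeds A _ \<longleftrightarrow> (\<exists>f :: 'a \<Rightarrow> 'u. inj_on f A)"

lemma embeds_inj_on:
  fixes f :: "'a \<Rightarrow> 'b"
  assumes "embeds (UNIV :: 'b set) TYPE('u)" "inj_on f A"
  shows "embeds A TYPE('u)"
  using assms comp_inj_on[OF assms(2)] inj_on_subset unfolding embeds_def by blast

lemma embeds_prod:
  assumes "infinite (UNIV :: 'u set)" "embeds A TYPE('u)" "embeds B TYPE('u)"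
  shows "embeds (A \<times> B) TYPE('u)"
proof -
  obtain h :: "'u \<times> 'u \<Rightarrow> 'u" where h: "inj h"
    using card_of_Times_same_infinite[OF assms(1)]
    unfolding card_of_ordIso[symmetric] bij_betw_def by auto
  obtain f g where fg: "inj_on (f :: _ \<Rightarrow> 'u) A" "inj_on (g :: _ \<Rightarrow> 'u) B"
    using assms by (auto simp: embeds_def)
  have "inj_on (h \<circ> map_prod f g) (A \<times> B)"
    by (rule comp_inj_on[OF map_prod_inj_on[OF fg] inj_on_subset[OF h subset_UNIV]])
  then show ?thesis unfolding embeds_def by blast
qed

text \<open>A list is folded into a single point with the pairing \<open>h\<close>. The length is
  recorded as well, since the starting value \<open>undefined\<close> may itself be a value of
  \<open>h\<close>, so that folding alone need not be injective across lengths.\<close>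

lemma embeds_list:
  assumes inf: "infinite (UNIV :: 'u set)" and A: "embeds (UNIV :: 'a set) TYPE('u)"
  shows "embeds (UNIV :: 'a list set) TYPE('u)"
proof -
  have "embeds (UNIV \<times> UNIV :: ('a \<times> 'u) set) TYPE('u)"
    by (rule embeds_prod[OF inf A]) (auto simp: embeds_def intro: exI[of _ id])
  then obtain h :: "'a \<times> 'u \<Rightarrow> 'u" where h: "inj h" by (auto simp: embeds_def)
  have "embeds (UNIV :: nat set) TYPE('u)"
    using infinite_countable_subset[OF inf] by (auto simp: embeds_def)
  then have N: "embeds (UNIV \<times> UNIV :: (nat \<times> 'u) set) TYPE('u)"
    by (rule embeds_prod[OF inf]) (auto simp: embeds_def intro: exI[of _ id])
  let ?f = "\<lambda>xs. foldr (\<lambda>x u. h (x, u)) xs undefined"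
  have "xs = ys" if "length xs = length ys" "?f xs = ?f ys" for xs ys :: "'a list"
    using that by (induction xs ys rule: list_induct2) (auto dest: injD[OF h])
  then have "inj (\<lambda>xs. (length xs, ?f xs))" by (auto simp: inj_def)
  with N show ?thesis unfolding UNIV_Times_UNIV by (rule embeds_inj_on)
qed

text \<open>A subspace is recovered as the span of finitely many vectors, each given by finitely
  many scalars, so a list of lists of scalars determines it.\<close>

lemma embeds_fd_subspaces:
  assumes inf: "infinite (UNIV :: 'u set)" and F: "embeds (UNIV :: 'f :: real_normed_field set) TYPE('u)"
  shows "embeds (fd_subspaces :: 'f vec set set) TYPE('u)"
proof -
  define v :: "'f list \<Rightarrow> 'f vec" where "v l = (\<lambda>n. if n < length l then l ! n else 0)" for l
  define ls where "ls U = (SOME ls. U = vec.span (v ` set ls))" for U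
  have ls: "U = vec.span (v ` set (ls U))" if U: "U \<in> fd_subspaces" for U
    unfolding ls_def
  proof (rule someI_ex)
    obtain M p where p': "\<forall>n. p n \<in> U" "\<forall>x. x \<in> U \<longleftrightarrow> (\<forall>n\<ge>M. x n = 0) \<and> x = (\<Sum>n<M. vscale (x n) (p n))"
      using fd_subspaces_frame[OF U] by (elim exE conjE)
    note p = p'(1)[rule_format] p'(2)[THEN spec]
    \<comment> \<open>The frame vectors with index below \<open>M\<close> span \<open>U\<close>; as
      elements of \<open>U\<close> they vanish from \<open>M\<close> on, so \<open>M\<close> entries
      of each suffice.\<close>
    let ?ls = "map (\<lambda>n. map (p n) [0..<M]) [0..<M]"
    have v: "v (map (p n) [0..<M]) = p n" for n
    proof
      fix k
      have "\<forall>k\<ge>M. p n k = 0" using p(1)[of n] p(2) by blast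
      then show "v (map (p n) [0..<M]) k = p n k" by (simp add: v_def)
    qed
    have set_ls: "v ` set ?ls = p ` {..<M}" by (simp add: image_image v atLeast0LessThan)
    have "x \<in> vec.span (p ` {..<M})" if "x \<in> U" for x
    proof -
      have "(\<Sum>n<M. vscale (x n) (p n)) \<in> vec.span (p ` {..<M})"
        by (intro vec.span_sum vec.span_scale vec.span_base) auto
      moreover have "x = (\<Sum>n<M. vscale (x n) (p n))" using that p(2) by blast
      ultimately show ?thesis by simp
    qed
    moreover have "vec.subspace U" using U by (simp add: fd_subspaces_def)
    then have "vec.span (p ` {..<M}) \<subseteq> U" by (intro vec.span_minimal) (use p(1) in auto)
    ultimately have "U = vec.span (v ` set ?ls)" unfolding set_ls by blast
    then show "\<exists>ls. U = vec.span (v ` set ls)" by blast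
  qed
  then have "inj_on ls fd_subspaces" by (metis inj_onI)
  then show ?thesis using embeds_inj_on embeds_list[OF inf embeds_list[OF inf F]] by blast
qed

text \<open>An isometry is determined by its matrix, the entries of its values on the frame of
  \<open>U\<close>. The outermost list codes the option: empty for \<open>None\<close>, a singleton
  for \<open>Some\<close>.\<close>

lemma embeds_isometries:
  fixes c :: "'f :: real_normed_field \<Rightarrow> 'f"
  assumes inf: "infinite (UNIV :: 'u set)" and F: "embeds (UNIV :: 'f set) TYPE('u)"
    and U: "U \<in> fd_subspaces" and V: "V \<in> fd_subspaces"
  shows "embeds (topspace (sp (add_point (top_of_set (isometries c U V))))) TYPE('u)"
proof -
  obtain M p where p': "\<forall>n. p n \<in> U" "\<forall>x. x \<in> U \<longleftrightarrow> (\<forall>n\<ge>M. x n = 0) \<and> x = (\<Sum>n<M. vscale (x n) (p n))"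
    using fd_subspaces_frame[OF U] by (elim exE conjE)
  note p = p'(1)[rule_format] p'(2)[THEN spec]
  obtain N where N: "\<And>x n. x \<in> V \<Longrightarrow> N \<le> n \<Longrightarrow> x n = 0" using fd_subspaces_bounded[OF V] by blast
  define h :: "('f vec \<Rightarrow> 'f vec) option \<Rightarrow> 'f list list list" where
    "h g = (case g of None \<Rightarrow> [] | Some T \<Rightarrow> [map (\<lambda>n. map (T (p n)) [0..<N]) [0..<M]])" for g
  have "S = T" if S: "S \<in> isometries c U V" and T: "T \<in> isometries c U V" and "h (Some S) = h (Some T)" for S T
  proof
    fix x
    have e: "S (p n) k = T (p n) k" if "n < M" "k < N" for n k
      using \<open>h (Some S) = h (Some T)\<close> that by (simp add: h_def)
    have "S (p n) k = T (p n) k" if "n < M" for n k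
      using e[OF that] N[OF isometriesD(1)[OF S p(1)]] N[OF isometriesD(1)[OF T p(1)]] by (cases "k < N") auto
    then have Sp: "S (p n) = T (p n)" if "n < M" for n using that by blast
    show "S x = T x"
    proof (cases "x \<in> U")
      case True
      then have x: "x = (\<Sum>n<M. vscale (x n) (p n))" using p(2) by blast
      have "S (\<Sum>n<M. vscale (x n) (p n)) = T (\<Sum>n<M. vscale (x n) (p n))"
        using isometries_sum[OF S U p(1), where a = x and M = M]
          isometries_sum[OF T U p(1), where a = x and M = M] Sp by simp
      then show ?thesis by (simp only: x[symmetric])
    next
      case False
      then show ?thesis using isometriesD(2)[OF S] isometriesD(2)[OF T] by simp
    qed
  qed
  then have "inj_on h (topspace (sp (add_point (top_of_set (isometries c U V)))))"
    by (intro inj_onI) (auto simp: h_def)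
  then show ?thesis using embeds_inj_on embeds_list[OF inf embeds_list[OF inf embeds_list[OF inf F]]] by blast
qed

lemma embeds_lan_points:
  assumes inj: "inj (e :: real \<Rightarrow> 'u)" and V: "V \<in> fd_subspaces"
  shows "\<exists>code :: complex vec set \<times> 'u \<times> (real vec \<Rightarrow> real vec) option \<Rightarrow> 'u.
    inj_on code {(W, x, g). W \<in> Ob J0_U \<and> g \<in> pts (Hom J0_O (on_ob realification W) V)}"
proof -
  have inf: "infinite (UNIV :: 'u set)"
    using inj finite_imageD[of e UNIV] infinite_UNIV_char_0 finite_subset[OF subset_UNIV] by blast
  have r: "embeds (UNIV :: real set) TYPE('u)" using inj by (auto simp: embeds_def)
  have "inj (\<lambda>z. (Re z, Im z))" by (auto simp: inj_def complex_eq_iff)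
  with embeds_prod[OF inf r r] have "embeds (UNIV :: complex set) TYPE('u)"
    unfolding UNIV_Times_UNIV by (rule embeds_inj_on)
  from embeds_fd_subspaces[OF inf this] obtain a :: "complex vec set \<Rightarrow> 'u" where a: "inj_on a fd_subspaces"
    by (auto simp: embeds_def)
  have "\<forall>W\<in>fd_subspaces. \<exists>b :: _ \<Rightarrow> 'u. inj_on b (pts (Hom J0_O (on_ob realification W) V))"
    using embeds_isometries[OF inf r realify_fd_subspaces V] by (simp add: embeds_def J0_O_def realification_def)
  then obtain b :: "_ \<Rightarrow> _ \<Rightarrow> 'u" where b: "\<And>W. W \<in> fd_subspaces \<Longrightarrow> inj_on (b W) (pts (Hom J0_O (on_ob realification W) V))"
    by metis
  have u: "embeds (UNIV :: 'u set) TYPE('u)" by (auto simp: embeds_def intro: exI[of _ id])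
  have "embeds (UNIV \<times> (UNIV \<times> UNIV) :: ('u \<times> 'u \<times> 'u) set) TYPE('u)"
    by (intro embeds_prod inf u)
  then obtain h :: "'u \<times> 'u \<times> 'u \<Rightarrow> 'u" where h: "inj h" by (auto simp: embeds_def)
  \<comment> \<open>The injection \<open>b W\<close> depends on \<open>W\<close>, so
    \<open>W\<close> is decoded from \<open>a W\<close> before \<open>g\<close>.\<close>
  have "inj_on (\<lambda>(W, x, g). h (a W, x, b W g)) {(W, x, g). W \<in> Ob J0_U \<and> g \<in> pts (Hom J0_O (on_ob realification W) V)}"
    (is "inj_on ?code ?P")
  proof (rule inj_onI)
    fix p q assume pq: "p \<in> ?P" "q \<in> ?P" "?code p = ?code q"
    obtain W x g W' x' g' where e: "p = (W, x, g)" "q = (W', x', g')" using prod_cases3 by metis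
    have W: "W \<in> fd_subspaces" "W' \<in> fd_subspaces" using pq by (auto simp: e J0_U_def)
    have "h (a W, x, b W g) = h (a W', x', b W' g')" using pq(3) by (simp add: e)
    then have "(a W, x, b W g) = (a W', x', b W' g')" by (rule injD[OF h])
    then have eq: "a W = a W'" "x = x'" "b W g = b W' g'" by auto
    then have "W = W'" using inj_onD[OF a] W by blast
    moreover have "g = g'" using inj_onD[OF b[OF W(1)]] eq(3) pq(1,2) \<open>W = W'\<close> by (simp add: e)
    ultimately show "p = q" using eq(2) by (simp add: e)
  qed
  then show ?thesis by blast
qed

text \<open>The hypothesis says that \<open>'u\<close> has at least the cardinality of the
  continuum; the points of the left Kan extension then fit into \<open>'u\<close>, and
  \<open>quillen_adjunction_lan\<close> applies to realification.\<close>

theorem lemma3p1: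
  assumes "\<exists>e :: real \<Rightarrow> 'u. inj e"
  shows "quillen_adjunction
           (projective J0_U ::
              ((complex vec set, (complex vec \<Rightarrow> complex vec) option, 'u) efunctor,
               (complex vec set, (complex vec \<Rightarrow> complex vec) option, 'u) ntrans) model_cat)
           (projective J0_O ::
              ((real vec set, (real vec \<Rightarrow> real vec) option, 'u) efunctor,
               (real vec set, (real vec \<Rightarrow> real vec) option, 'u) ntrans) model_cat)
           (lan J0_U J0_O realification)
           (restriction J0_U realification)"
proof -
  obtain e :: "real \<Rightarrow> 'u" where e: "inj e" using assms by blast
  have "\<forall>V\<in>fd_subspaces. \<exists>code :: complex vec set \<times> 'u \<times> (real vec \<Rightarrow> real vec) option \<Rightarrow> 'u.
    inj_on code {(W, x, g). W \<in> Ob J0_U \<and> g \<in> pts (Hom J0_O (on_ob realification W) V)}"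
    using embeds_lan_points[OF e] by blast
  from bchoice[OF this]
  obtain code :: "real vec set \<Rightarrow> complex vec set \<times> 'u \<times> (real vec \<Rightarrow> real vec) option \<Rightarrow> 'u"
    where code: "\<forall>V\<in>fd_subspaces.
      inj_on (code V) {(W, x, g). W \<in> Ob J0_U \<and> g \<in> pts (Hom J0_O (on_ob realification W) V)}"
    by (elim exE)
  have compact_O: "compact_space (top_of_set (isometries (\<lambda>x. x :: real) U V))"
    if "U \<in> fd_subspaces" "V \<in> fd_subspaces" for U V
    using compact_isometries[OF that(2,1), of "\<lambda>x. x"]
    by (simp add: compact_space_subtopology power2_eq_square)
  have cmp: "continuous_map (prod_topology (top_of_set (isometries (\<lambda>x. x :: real) V W)) (top_of_set (isometries (\<lambda>x. x) U V)))
     (top_of_set (isometries (\<lambda>x. x) U W)) (\<lambda>(S, T). S \<circ> T)"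
    if "V \<in> fd_subspaces" for U V W
    using continuous_isometries_comp[OF that] isometries_comp[OF _ _ that]
    by (auto simp: image_subset_iff)
  have r: "continuous_map (top_of_set (isometries cnj W W'))
     (top_of_set (isometries (\<lambda>x. x) (realify_vec ` W) (realify_vec ` W'))) (\<lambda>T. realify_vec \<circ> T \<circ> unrealify_vec)"
    if "W \<in> fd_subspaces" "W' \<in> fd_subspaces" for W W'
    using continuous_on_realify_map realify_isometries that by (auto simp: image_subset_iff)
  \<comment> \<open>An object of \<open>J0_U\<close>, which provides \<open>C_ob\<close>.\<close>
  have "{0} \<in> (fd_subspaces :: complex vec set set)"
    by (rule fd_subspacesI[where M = 0]) auto
  interpret compact_kan_extension J0_U J0_O realification code
  proof
    show "inj_on (code V) {(W, x, g). W \<in> Ob J0_U \<and> g \<in> pts (Hom J0_O (on_ob realification W) V)}"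
      if "V \<in> Ob J0_O" for V using code that by (simp add: J0_O_def)
  next
    fix U V W assume UVW: "U \<in> Ob J0_O" "V \<in> Ob J0_O" "W \<in> Ob J0_O"
    show "continuous_map (prod_topology (sp (Hom J0_O V W)) (sp (Hom J0_O U V))) (sp (Hom J0_O U W))
        (\<lambda>(g, f). Cmp J0_O g f)"
      using UVW unfolding J0_O_def J0_sel
      by (intro continuous_map_add_point_prod[OF cmp]) auto
  next
    fix W W' assume "W \<in> Ob J0_U" "W' \<in> Ob J0_U"
    then show "based_map (Hom J0_U W W') (Hom J0_O (on_ob realification W) (on_ob realification W'))
       (on_hom realification W W')"
      using continuous_map_add_point_map[OF r]
      by (simp add: based_map_def J0_U_def J0_O_def realification_def)
  next
    fix U V assume "U \<in> Ob J0_O" "V \<in> Ob J0_O"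
    then show "compact_space (sp (Hom J0_O U V))" "Hausdorff_space (sp (Hom J0_O U V))"
      by (simp_all add: J0_O_def compact_space_add_point compact_O Hausdorff_space_add_point
          Hausdorff_space_top_of_set_functions)
  next
    fix U V f assume "U \<in> Ob J0_O" "V \<in> Ob J0_O" "f \<in> pts (Hom J0_O U V)"
    then show "Cmp J0_O (Idt J0_O V) f = f" "Cmp J0_O f (Idt J0_O U) = f"
      unfolding J0_O_def by (auto simp: isometries_comp_id)
  next
    fix U V W X f g h
    assume "f \<in> pts (Hom J0_O U V)" "g \<in> pts (Hom J0_O V W)" "h \<in> pts (Hom J0_O W X)"
    then show "Cmp J0_O h (Cmp J0_O g f) = Cmp J0_O (Cmp J0_O h g) f"
      by (auto simp: J0_O_def o_assoc)
  next
    fix W W' W'' f g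
    assume "f \<in> pts (Hom J0_U W W')" "g \<in> pts (Hom J0_U W' W'')"
    then show "on_hom realification W W'' (Cmp J0_U g f) =
        Cmp J0_O (on_hom realification W' W'' g) (on_hom realification W W' f)"
      by (auto simp: J0_U_def J0_O_def realification_def fun_eq_iff)
  next
    fix W assume "W \<in> Ob J0_U"
    show "on_hom realification W W (Idt J0_U W) = Idt J0_O (on_ob realification W)"
      by (auto simp: J0_U_def J0_O_def realification_def fun_eq_iff in_realify_image realify_vec_simps)
  qed (use \<open>{0} \<in> fd_subspaces\<close> in
      \<open>auto simp: J0_U_def J0_O_def realification_def realify_fd_subspaces isometries_id\<close>)
  show ?thesis by (rule quillen_adjunction_lan)
qed

end
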